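(* If $X=(X_1,\dots,X_n)$ is a tuple of elements in some tracial $W^*$-probability space $(\mathcal{M},\tau)$ with $\Delta(X)=n$, then $X$ has the strong Atiyah property.
   Context: Tracial $W^*$-probability space: a von Neumann algebra $\mathcal{M}$ with a faithful normal tracial state $\tau$. For $Q\in M_N(\mathcal{M})$, $\operatorname{rank}(Q):=(\operatorname{Tr}_N\circ\tau^{(N)})(p_{\overline{\operatorname{im}(Q)}})$, where $p_{\overline{\operatorname{im}(Q)}}\in M_N(\mathcal{M})$ is the orthogonal projection onto the closure of the image of $Q$, $\tau^{(N)}$ applies $\tau$ entrywise, and $\operatorname{Tr}_N$ is the unnormalized trace on $M_N(\mathbb{C})$. The tuple $X$ has the strong Atiyah property if for every $N\geq1$ and every matrix $P\in M_N(\mathbb{C}\langle x_1,\dots,x_n\rangle)$ over the free algebra, $\operatorname{rank}(P(X))$ is a nonnegative integer, where $P(X)$ is obtained by replacing each $x_i$ by $X_i$. $\Delta$: let $\mathcal{F}(L^2(\mathcal{M},\tau))$ be the finite rank operators on $L^2(\mathcal{M},\tau)$ and $J$ the conjugate-linear isometry of $L^2(\mathcal{M},\tau)$ extending $x\mapsto x^*$ on $\mathcal{M}$. Then $$\Delta(X):=n-\dim_{\mathcal{M}\overline{\otimes}\mathcal{M}^{\mathrm{op}}}\overline{\Big\{(T_1,\dots,T_n)\in\mathcal{F}(L^2(\mathcal{M},\tau))^n : \sum_{j=1}^n[T_j,JX_jJ]=0\Big\}}^{\mathrm{HS}},$$ where the closure is in Hilbert–Schmidt norm and $\dim$ is the Murray–von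 Neumann dimension for the action $(a\otimes b^{\mathrm{op}})\cdot T=aTb$ of $\mathcal{M}\overline{\otimes}\mathcal{M}^{\mathrm{op}}$ on Hilbert–Schmidt operators (normalized so that the space of all Hilbert–Schmidt operators on $L^2(\mathcal{M},\tau)$ has dimension $1$). *)

theory Defs
  imports "HOL-Analysis.Analysis" "HOL-Library.Poly_Mapping"
begin

section \<open>Complex Hilbert spaces and their bounded operators\<close>

class complex_vector = ab_group_add +
  fixes scaleC :: "complex \<Rightarrow> 'a \<Rightarrow> 'a" (infixr "*\<^sub>C" 75)
  assumes scaleC_add_right: "c *\<^sub>C (x + y) = c *\<^sub>C x + c *\<^sub>C y"
    and scaleC_add_left: "(c + d) *\<^sub>C x = c *\<^sub>C x + d *\<^sub>C x"
    and scaleC_scaleC: "c *\<^sub>C d *\<^sub>C x = (c * d) *\<^sub>C x"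
    and scaleC_one: "1 *\<^sub>C x = x"

text \<open>The complex inner product is linear in the first argument; its real part is the inner
  product of the underlying real Hilbert space, so that norm, topology and completeness are the
  library's.\<close>

class complex_hilbert_space = complex_vector + real_inner + complete_space +
  fixes cinner :: "'a \<Rightarrow> 'a \<Rightarrow> complex"
  assumes scaleR_scaleC: "r *\<^sub>R x = complex_of_real r *\<^sub>C x"
    and cinner_add_left: "cinner (x + y) z = cinner x z + cinner y z"
    and cinner_scaleC_left: "cinner (c *\<^sub>C x) y = c * cinner x y"
    and cinner_commute: "cinner x y = cnj (cinner y x)"
    and inner_eq_Re_cinner: "inner x y = Re (cinner x y)"

instantiation complex :: complex_hilbert_space
begin

definition scaleC_complex :: "complex \<Rightarrow> complex \<Rightarrow> complex"
  where "scaleC_complex c x = c * x"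

definition cinner_complex :: "complex \<Rightarrow> complex \<Rightarrow> complex"
  where "cinner_complex x y = x * cnj y"

instance
  by standard
    (auto simp: scaleC_complex_def cinner_complex_def algebra_simps scaleR_conv_of_real
      inner_complex_def)

end

lemma scaleC_zero_right [simp]: "c *\<^sub>C (0 :: 'a :: complex_vector) = 0"
  using scaleC_add_right[of c "0 :: 'a" 0] by simp

lemma scaleC_minus_right: "c *\<^sub>C (- x) = - (c *\<^sub>C (x :: 'a :: complex_vector))"
  using scaleC_add_right[of c x "- x"] by (simp add: eq_neg_iff_add_eq_0 add.commute)

lemma scaleC_diff_right: "c *\<^sub>C (x - y) = c *\<^sub>C x - c *\<^sub>C (y :: 'a :: complex_vector)"
  using scaleC_add_right[of c x "- y"] by (simp add: scaleC_minus_right)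

lemma norm_scaleC: "norm (c *\<^sub>C x) = cmod c * norm (x :: 'a :: complex_hilbert_space)"
proof -
  have im: "Im (cinner x x) = 0"
    using arg_cong[OF cinner_commute[of x x], of Im] by simp
  have "cinner (c *\<^sub>C x) (c *\<^sub>C x) = c * cnj c * cinner x x"
    using cinner_commute[of x "c *\<^sub>C x"] cinner_commute[of x x]
    by (simp add: cinner_scaleC_left)
  then have "(norm (c *\<^sub>C x))\<^sup>2 = Re (c * cnj c * cinner x x)"
    by (simp add: power2_norm_eq_inner inner_eq_Re_cinner)
  also have "\<dots> = (cmod c * norm x)\<^sup>2"
    using im by (simp add: complex_mult_cnj cmod_power2 power_mult_distrib power2_norm_eq_inner
        inner_eq_Re_cinner)
  finally show ?thesis
    by (simp add: power2_eq_iff_nonneg)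
qed

typedef (overloaded) 'a cbop =
  "{f :: 'a :: complex_hilbert_space \<Rightarrow> 'a. bounded_linear f \<and> (\<forall>c x. f (c *\<^sub>C x) = c *\<^sub>C f x)}"
  morphisms app Cbop
  by (rule exI[of _ "\<lambda>x. 0"]) simp

setup_lifting type_definition_cbop

instantiation cbop :: (complex_hilbert_space) "{ring, monoid_mult, complex_vector}"
begin

lift_definition zero_cbop :: "'a cbop" is "\<lambda>x. 0" by simp

lift_definition plus_cbop :: "'a cbop \<Rightarrow> 'a cbop \<Rightarrow> 'a cbop" is "\<lambda>f g x. f x + g x"
  by (simp add: bounded_linear_add scaleC_add_right)

lift_definition uminus_cbop :: "'a cbop \<Rightarrow> 'a cbop" is "\<lambda>f x. - f x"
  by (simp add: bounded_linear_minus scaleC_minus_right)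

lift_definition minus_cbop :: "'a cbop \<Rightarrow> 'a cbop \<Rightarrow> 'a cbop" is "\<lambda>f g x. f x - g x"
  by (simp add: bounded_linear_sub scaleC_diff_right)

lift_definition one_cbop :: "'a cbop" is "\<lambda>x. x" by (simp add: bounded_linear_ident)

lift_definition times_cbop :: "'a cbop \<Rightarrow> 'a cbop \<Rightarrow> 'a cbop" is "\<lambda>f g x. f (g x)"
  by (simp add: bounded_linear_compose)

lift_definition scaleC_cbop :: "complex \<Rightarrow> 'a cbop \<Rightarrow> 'a cbop" is "\<lambda>c f x. c *\<^sub>C f x"
proof (intro conjI allI)
  fix c d :: complex and f :: "'a \<Rightarrow> 'a" and x
  assume f: "bounded_linear f \<and> (\<forall>c x. f (c *\<^sub>C x) = c *\<^sub>C f x)"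
  then show "c *\<^sub>C f (d *\<^sub>C x) = d *\<^sub>C c *\<^sub>C f x"
    by (simp add: scaleC_scaleC mult.commute)
  have "bounded_linear (\<lambda>y :: 'a. c *\<^sub>C y)"
    by (rule bounded_linear_intro[of _ "cmod c"])
      (simp_all add: scaleC_add_right scaleR_scaleC scaleC_scaleC norm_scaleC mult.commute)
  then show "bounded_linear (\<lambda>x. c *\<^sub>C f x)"
    using f bounded_linear_compose by blast
qed

instance
proof
  fix a b c :: "'a cbop" and r s :: complex
  show "a + b + c = a + (b + c)" by transfer (simp add: add.assoc)
  show "a + b = b + a" by transfer (simp add: add.commute)
  show "0 + a = a" by transfer simp
  show "- a + a = 0" by transfer simp
  show "a - b = a + - b" by transfer simp
  show "a * b * c = a * (b * c)" by transfer simp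
  show "(a + b) * c = a * c + b * c" by transfer simp
  show "a * (b + c) = a * b + a * c" by transfer (simp add: bounded_linear.linear linear_add)
  show "1 * a = a" "a * 1 = a" by (transfer, simp)+
  show "r *\<^sub>C (a + b) = r *\<^sub>C a + r *\<^sub>C b" by transfer (simp add: scaleC_add_right)
  show "(r + s) *\<^sub>C a = r *\<^sub>C a + s *\<^sub>C a" by transfer (simp add: scaleC_add_left)
  show "r *\<^sub>C s *\<^sub>C a = (r * s) *\<^sub>C a" by transfer (simp add: scaleC_scaleC)
  show "1 *\<^sub>C a = a" by transfer (simp add: scaleC_one)
qed

end

definition adj :: "'a :: complex_hilbert_space cbop \<Rightarrow> 'a cbop"
  where "adj T = (THE S. \<forall>x y. cinner (app T x) y = cinner x (app S y))"

definition positive :: "'a :: complex_hilbert_space cbop \<Rightarrow> bool"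
  where "positive T \<longleftrightarrow> (\<forall>x. cinner (app T x) x \<in> \<real>\<^sub>\<ge>\<^sub>0)"

definition finite_rank :: "'a :: complex_hilbert_space cbop \<Rightarrow> bool"
  where "finite_rank T \<longleftrightarrow> (\<exists>B. finite B \<and> (\<forall>x. \<exists>c. app T x = (\<Sum>b\<in>B. c b *\<^sub>C b)))"


section \<open>Tracial \<open>W\<^sup>*\<close>-probability spaces\<close>

definition commutant :: "'a :: complex_hilbert_space cbop set \<Rightarrow> 'a cbop set"
  where "commutant S = {T. \<forall>s\<in>S. s * T = T * s}"

definition von_neumann_algebra :: "'a :: complex_hilbert_space cbop set \<Rightarrow> bool"
  where "von_neumann_algebra M \<longleftrightarrow> (\<forall>x\<in>M. adj x \<in> M) \<and> commutant (commutant M) = M"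

text \<open>Normality: the supremum of an increasing net of positive elements is preserved.\<close>

definition normal_on :: "'a :: complex_hilbert_space cbop set \<Rightarrow> ('a cbop \<Rightarrow> complex) \<Rightarrow> bool"
  where "normal_on M \<tau> \<longleftrightarrow>
    (\<forall>D s. D \<subseteq> M \<and> D \<noteq> {} \<and> (\<forall>d\<in>D. positive d) \<and>
      (\<forall>d\<in>D. \<forall>e\<in>D. \<exists>f\<in>D. positive (f - d) \<and> positive (f - e)) \<and>
      s \<in> M \<and> (\<forall>d\<in>D. positive (s - d)) \<and>
      (\<forall>u\<in>M. (\<forall>d\<in>D. positive (u - d)) \<longrightarrow> positive (u - s))
      \<longrightarrow> Re (\<tau> s) = (SUP d\<in>D. Re (\<tau> d)))"

definition tracial_wstar_space :: "'a :: complex_hilbert_space cbop set \<Rightarrow> ('a cbop \<Rightarrow> complex) \<Rightarrow> bool"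
  where "tracial_wstar_space M \<tau> \<longleftrightarrow>
    von_neumann_algebra M \<and>
    (\<forall>x\<in>M. \<forall>y\<in>M. \<tau> (x + y) = \<tau> x + \<tau> y) \<and>
    (\<forall>c. \<forall>x\<in>M. \<tau> (c *\<^sub>C x) = c * \<tau> x) \<and>
    \<tau> 1 = 1 \<and>
    (\<forall>x\<in>M. \<tau> (adj x * x) \<in> \<real>\<^sub>\<ge>\<^sub>0) \<and>
    (\<forall>x\<in>M. \<forall>y\<in>M. \<tau> (x * y) = \<tau> (y * x)) \<and>
    (\<forall>x\<in>M. \<tau> (adj x * x) = 0 \<longrightarrow> x = 0) \<and>
    normal_on M \<tau>"

text \<open>\<open>L\<^sup>2(M,\<tau>)\<close> depends on \<open>M\<close> and \<open>\<tau>\<close> and hence cannot be a type of its own. It is given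
  by a Hilbert space \<open>'l\<close> together with an isometric embedding \<open>\<Lambda>\<close> of \<open>M\<close>, equipped with the
  inner product \<open>\<tau>(y\<^sup>* x)\<close>, as a dense subspace; this is the Hilbert space completion
  of \<open>M\<close>, unique up to a unique unitary.\<close>

definition is_L2 :: "'a :: complex_hilbert_space cbop set \<Rightarrow> ('a cbop \<Rightarrow> complex) \<Rightarrow>
    ('a cbop \<Rightarrow> 'l :: complex_hilbert_space) \<Rightarrow> bool"
  where "is_L2 M \<tau> \<Lambda> \<longleftrightarrow>
    (\<forall>x\<in>M. \<forall>y\<in>M. \<Lambda> (x + y) = \<Lambda> x + \<Lambda> y) \<and>
    (\<forall>c. \<forall>x\<in>M. \<Lambda> (c *\<^sub>C x) = c *\<^sub>C \<Lambda> x) \<and>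
    (\<forall>x\<in>M. \<forall>y\<in>M. cinner (\<Lambda> x) (\<Lambda> y) = \<tau> (adj y * x)) \<and>
    closure (\<Lambda> ` M) = UNIV"

definition left_mult :: "'a :: complex_hilbert_space cbop set \<Rightarrow>
    ('a cbop \<Rightarrow> 'l :: complex_hilbert_space) \<Rightarrow> 'a cbop \<Rightarrow> 'l cbop"
  where "left_mult M \<Lambda> a = (THE T. \<forall>x\<in>M. app T (\<Lambda> x) = \<Lambda> (a * x))"

definition modular_conj :: "'a :: complex_hilbert_space cbop set \<Rightarrow>
    ('a cbop \<Rightarrow> 'l :: complex_hilbert_space) \<Rightarrow> 'l \<Rightarrow> 'l"
  where "modular_conj M \<Lambda> =
    (THE J. (\<forall>\<xi> \<eta>. J (\<xi> + \<eta>) = J \<xi> + J \<eta>) \<and> (\<forall>c \<xi>. J (c *\<^sub>C \<xi>) = cnj c *\<^sub>C J \<xi>) \<and>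
      (\<forall>\<xi>. norm (J \<xi>) = norm \<xi>) \<and> (\<forall>x\<in>M. J (\<Lambda> x) = \<Lambda> (adj x)))"


section \<open>Finite direct sums, closures and orthogonal projections\<close>

text \<open>The Hilbert spaces \<open>H\<^sup>N\<close> and \<open>HS(H)\<^sup>n\<close> are carriers \<open>V\<close> of functions on \<open>nat\<close>
  with an explicit inner product \<open>ip\<close>; an \<open>n\<close>-tuple is padded by \<open>0\<close>.\<close>

definition tuples :: "nat \<Rightarrow> 'v :: zero set \<Rightarrow> (nat \<Rightarrow> 'v) set"
  where "tuples n V = {v. (\<forall>i<n. v i \<in> V) \<and> (\<forall>i\<ge>n. v i = 0)}"

definition tuple_ip :: "('v \<Rightarrow> 'v \<Rightarrow> complex) \<Rightarrow> nat \<Rightarrow> (nat \<Rightarrow> 'v) \<Rightarrow> (nat \<Rightarrow> 'v) \<Rightarrow> complex"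
  where "tuple_ip ip n v w = (\<Sum>i<n. ip (v i) (w i))"

definition ip_closure :: "('v \<Rightarrow> 'v \<Rightarrow> complex) \<Rightarrow> 'v set \<Rightarrow> 'v :: minus set \<Rightarrow> 'v set"
  where "ip_closure ip V A = {v\<in>V. \<forall>\<epsilon>>0. \<exists>w\<in>A. sqrt (Re (ip (v - w) (v - w))) < \<epsilon>}"

definition orth_proj :: "('v \<Rightarrow> 'v \<Rightarrow> complex) \<Rightarrow> 'v :: minus set \<Rightarrow> 'v \<Rightarrow> 'v"
  where "orth_proj ip K v = (THE w. w \<in> K \<and> (\<forall>u\<in>K. ip (v - w) u = 0))"


section \<open>Rank and the strong Atiyah property\<close>

text \<open>Only the entries with both indices below \<open>N\<close> of \<open>Q\<close> matter.\<close>

definition mat_app :: "nat \<Rightarrow> (nat \<Rightarrow> nat \<Rightarrow> 'a :: complex_hilbert_space cbop) \<Rightarrow> (nat \<Rightarrow> 'a) \<Rightarrow> nat \<Rightarrow> 'a"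
  where "mat_app N Q v = (\<lambda>i. if i < N then \<Sum>j<N. app (Q i j) (v j) else 0)"

definition range_proj :: "nat \<Rightarrow> (nat \<Rightarrow> nat \<Rightarrow> 'a :: complex_hilbert_space cbop) \<Rightarrow> nat \<Rightarrow> nat \<Rightarrow> 'a cbop"
  where "range_proj N Q = (THE p. (\<forall>i j. \<not> (i < N \<and> j < N) \<longrightarrow> p i j = 0) \<and>
    (\<forall>v\<in>tuples N UNIV. mat_app N p v =
      orth_proj (tuple_ip cinner N)
        (ip_closure (tuple_ip cinner N) (tuples N UNIV) (mat_app N Q ` tuples N UNIV)) v))"

definition vn_rank :: "('a :: complex_hilbert_space cbop \<Rightarrow> complex) \<Rightarrow> nat \<Rightarrow>
    (nat \<Rightarrow> nat \<Rightarrow> 'a cbop) \<Rightarrow> complex"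
  where "vn_rank \<tau> N Q = (\<Sum>i<N. \<tau> (range_proj N Q i i))"

text \<open>Elements of the free algebra on \<open>x\<^sub>0, \<dots>, x\<^sub>n\<^sub>-\<^sub>1\<close> are finitely supported complex functions
  on the words over \<open>{..<n}\<close>.\<close>

definition free_algebra :: "nat \<Rightarrow> (nat list \<Rightarrow>\<^sub>0 complex) set"
  where "free_algebra n = {P. Poly_Mapping.keys P \<subseteq> lists {..<n}}"

definition nc_eval :: "(nat \<Rightarrow> 'a :: complex_hilbert_space cbop) \<Rightarrow> (nat list \<Rightarrow>\<^sub>0 complex) \<Rightarrow> 'a cbop"
  where "nc_eval X P =
    (\<Sum>w\<in>Poly_Mapping.keys P. Poly_Mapping.lookup P w *\<^sub>C prod_list (map X w))"

definition strong_atiyah :: "('a :: complex_hilbert_space cbop \<Rightarrow> complex) \<Rightarrow> nat \<Rightarrow>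
    (nat \<Rightarrow> 'a cbop) \<Rightarrow> bool"
  where "strong_atiyah \<tau> n X \<longleftrightarrow>
    (\<forall>N\<ge>1. \<forall>P. (\<forall>i<N. \<forall>j<N. P i j \<in> free_algebra n) \<longrightarrow>
      vn_rank \<tau> N (\<lambda>i j. nc_eval X (P i j)) \<in> \<nat>)"


section \<open>Hilbert--Schmidt operators\<close>

definition is_onb :: "'l :: complex_hilbert_space set \<Rightarrow> bool"
  where "is_onb B \<longleftrightarrow> (\<forall>e\<in>B. \<forall>f\<in>B. cinner e f = (if e = f then 1 else 0)) \<and>
    (\<forall>x. (\<forall>e\<in>B. cinner x e = 0) \<longrightarrow> x = 0)"

text \<open>Neither of the next two notions depends on the choice of the basis.\<close>

definition onb :: "'l :: complex_hilbert_space set"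
  where "onb = (SOME B. is_onb B)"

definition hilbert_schmidt :: "'l :: complex_hilbert_space cbop set"
  where "hilbert_schmidt = {T. (\<lambda>e. (norm (app T e))\<^sup>2) summable_on onb}"

definition hs_inner :: "'l :: complex_hilbert_space cbop \<Rightarrow> 'l cbop \<Rightarrow> complex"
  where "hs_inner S T = (\<Sum>\<^sub>\<infinity>e\<in>onb. cinner (app S e) (app T e))"


section \<open>Murray--von Neumann dimension over \<open>M \<otimes> M\<^sup>o\<^sup>p\<close>, and \<open>\<Delta>\<close>\<close>

text \<open>A vector \<open>\<omega>\<close> that is cyclic for the action \<open>(a \<otimes> b\<^sup>o\<^sup>p) \<cdot> T = a T b\<close> on the
  Hilbert--Schmidt operators and whose vector state is the trace \<open>\<tau> \<otimes> \<tau>\<^sup>o\<^sup>p\<close>. It identifies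
  the Hilbert--Schmidt operators with \<open>L\<^sup>2(M \<otimes> M\<^sup>o\<^sup>p, \<tau> \<otimes> \<tau>\<^sup>o\<^sup>p)\<close>, \<open>\<omega>\<close> corresponding
  to \<open>1\<close>; an example is the orthogonal projection onto the line spanned by \<open>\<Lambda> 1\<close>.\<close>

definition trace_vector :: "'a :: complex_hilbert_space cbop set \<Rightarrow> ('a cbop \<Rightarrow> complex) \<Rightarrow>
    ('a cbop \<Rightarrow> 'l :: complex_hilbert_space) \<Rightarrow> 'l cbop \<Rightarrow> bool"
  where "trace_vector M \<tau> \<Lambda> \<omega> \<longleftrightarrow>
    \<omega> \<in> hilbert_schmidt \<and>
    (\<forall>a\<in>M. \<forall>b\<in>M. hs_inner (left_mult M \<Lambda> a * \<omega> * left_mult M \<Lambda> b) \<omega> = \<tau> a * \<tau> b) \<and>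
    ip_closure hs_inner hilbert_schmidt
      {\<Sum>i<m. left_mult M \<Lambda> (a i) * \<omega> * left_mult M \<Lambda> (b i) | (m :: nat) a b.
        \<forall>i<m. a i \<in> M \<and> b i \<in> M} = hilbert_schmidt"

text \<open>For a closed submodule \<open>K\<close> of the \<open>n\<close>-fold direct sum of \<open>L\<^sup>2(M \<otimes> M\<^sup>o\<^sup>p)\<close>, the orthogonal
  projection onto \<open>K\<close> is an \<open>n \<times> n\<close> matrix over the commutant of \<open>M \<otimes> M\<^sup>o\<^sup>p\<close>, and the dimension
  of \<open>K\<close> is its trace, i.e. the sum of the values of its diagonal entries under the canonical
  trace of the commutant. That trace is the vector state of \<open>\<omega>\<close>, independently of the choice
  of the trace vector \<open>\<omega>\<close>.\<close>

definition bimod_dim :: "'a :: complex_hilbert_space cbop set \<Rightarrow> ('a cbop \<Rightarrow> complex) \<Rightarrow>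
    ('a cbop \<Rightarrow> 'l :: complex_hilbert_space) \<Rightarrow> nat \<Rightarrow> (nat \<Rightarrow> 'l cbop) set \<Rightarrow> real"
  where "bimod_dim M \<tau> \<Lambda> n K =
    (let \<omega> = (SOME \<omega>. trace_vector M \<tau> \<Lambda> \<omega>);
         \<omega>\<^sub>n = (\<lambda>j i. if i = j then \<omega> else 0)
     in \<Sum>j<n. Re (hs_inner (orth_proj (tuple_ip hs_inner n) K (\<omega>\<^sub>n j) j) \<omega>))"

definition commuting_tuples :: "'a :: complex_hilbert_space cbop set \<Rightarrow>
    ('a cbop \<Rightarrow> 'l :: complex_hilbert_space) \<Rightarrow> nat \<Rightarrow> (nat \<Rightarrow> 'a cbop) \<Rightarrow> (nat \<Rightarrow> 'l cbop) set"
  where "commuting_tuples M \<Lambda> n X =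
    (let J = modular_conj M \<Lambda>;
         JXJ = (\<lambda>j \<xi>. J (app (left_mult M \<Lambda> (X j)) (J \<xi>)))
     in {T \<in> tuples n {S. finite_rank S}.
          \<forall>\<xi>. (\<Sum>j<n. app (T j) (JXJ j \<xi>) - JXJ j (app (T j) \<xi>)) = 0})"

definition Delta :: "'a :: complex_hilbert_space cbop set \<Rightarrow> ('a cbop \<Rightarrow> complex) \<Rightarrow>
    ('a cbop \<Rightarrow> 'l :: complex_hilbert_space) \<Rightarrow> nat \<Rightarrow> (nat \<Rightarrow> 'a cbop) \<Rightarrow> real"
  where "Delta M \<tau> \<Lambda> n X = real n -
    bimod_dim M \<tau> \<Lambda> n
      (ip_closure (tuple_ip hs_inner n) (tuples n hilbert_schmidt) (commuting_tuples M \<Lambda> n X))"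

end

theory Submission
  imports Defs "HOL-Library.Function_Algebras"
begin

text \<open>
  The hypothesis \<open>\<Delta>(X) = n\<close> says that the closure of the space of commuting tuples, that is of the finite
  rank tuples with \<open>\<Sum>\<^sub>j [T\<^sub>j, J X\<^sub>j J] = 0\<close>, has dimension \<open>0\<close>. For a trace vector \<open>\<omega>\<close> this dimension is the sum
  over \<open>j\<close> of the squared norms of the projections of \<open>\<omega> e\<^sub>j\<close> to the closure. So all \<open>\<omega> e\<^sub>j\<close> are orthogonal
  to the commuting tuples, and since these form an \<open>M\<close>-bimodule and \<open>\<omega>\<close> is cyclic, the only commuting tuple
  is \<open>0\<close> (\<open>commuting_tuples_trivial\<close>).

  Such tuples arise from linear pencils. Let \<open>A = a0 + \<Sum>\<^sub>j a\<^sub>j X\<^sub>j\<close> with scalar \<open>K \<times> K\<close> matrices \<open>a0\<close> and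
  \<open>a\<^sub>j\<close>, let the column \<open>f\<close> over \<open>M\<close> lie in the kernel of \<open>A\<close> and the column \<open>g\<close> in the kernel of \<open>A\<^sup>*\<close>. An
  explicit commuting tuple built from \<open>f\<close> and \<open>g\<close> must vanish, which says that the scalar vectors \<open>\<tau>(f)\<close> and
  \<open>\<tau>(g)\<close> satisfy \<open>\<langle>a\<^sub>j \<tau>(f), \<tau>(g)\<rangle> = 0\<close> for all \<open>j\<close> (\<open>pencil_pairing\<close>).

  Let \<open>V\<close> be the space of all \<open>\<tau>(f)\<close>; replacing \<open>f\<close> by \<open>f y\<close> with \<open>y\<close> in \<open>M\<close> shows that the kernel of \<open>A\<close> is
  contained in \<open>V \<otimes> H\<close>. Let \<open>U\<close> be the span of \<open>a0 V\<close> and of all \<open>a\<^sub>j V\<close>. Apply the pairing to the restriction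
  of \<open>A\<close> to \<open>V\<close>: if \<open>g\<close> is a column over \<open>U\<close> in the kernel of the adjoint of the restriction, then \<open>\<tau>(g)\<close> is
  orthogonal to all \<open>a\<^sub>j V\<close>, by the equation for \<open>g\<close> also to \<open>a0 V\<close>, and therefore it is \<open>0\<close>. Hence \<open>A\<close> maps
  \<open>V \<otimes> H\<close> onto a dense subspace of \<open>U \<otimes> H\<close>, and rank-nullity gives \<open>dim ker A = dim V - dim U\<close>, an integer
  (\<open>pencil_kernel_trace\<close>).

  A matrix \<open>P\<close> over the free algebra reduces to a pencil by taking the values \<open>w(X) f\<^sub>l\<close> of the words that
  occur as new unknowns: the kernels of \<open>P(X)\<close> and of the pencil correspond to each other through matrices
  over \<open>M\<close>, so their projections have equal trace (\<open>linearization\<close>).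

  Rank-nullity rests on the equality of the ranks of \<open>Q\<close> and \<open>Q\<^sup>*\<close> (\<open>vn_rank_madj\<close>). The range projection of
  \<open>Q\<close> is the limit of the increasing sequence \<open>1 - (1 - c Q Q\<^sup>*)\<^sup>k\<close>, normality carries the trace to the limit,
  and the trace property makes the trace of the \<open>k\<close>-th term symmetric in \<open>Q\<close> and \<open>Q\<^sup>*\<close>.
\<close>


section \<open>Complex Hilbert spaces\<close>

instance complex_hilbert_space \<subseteq> banach ..

lemma cinner_add_right: "cinner x (y + z) = cinner x y + cinner x (z :: 'a :: complex_hilbert_space)"
  using cinner_commute[of x "y + z"] cinner_commute[of x y] cinner_commute[of x z]
  by (simp add: cinner_add_left)

lemma cinner_scaleC_right: "cinner x (c *\<^sub>C y) = cnj c * cinner x (y :: 'a :: complex_hilbert_space)"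
  using cinner_commute[of x "c *\<^sub>C y"] cinner_commute[of x y]
  by (simp add: cinner_scaleC_left)

lemma cinner_scaleR_left: "cinner (r *\<^sub>R x) y = of_real r * cinner x (y :: 'a :: complex_hilbert_space)"
  by (simp add: scaleR_scaleC cinner_scaleC_left)

lemma cinner_scaleR_right: "cinner x (r *\<^sub>R y) = of_real r * cinner x (y :: 'a :: complex_hilbert_space)"
  by (simp add: scaleR_scaleC cinner_scaleC_right)

lemma cinner_zero_left [simp]: "cinner 0 (y :: 'a :: complex_hilbert_space) = 0"
  using cinner_add_left[of 0 0 y] by simp

lemma cinner_zero_right [simp]: "cinner (y :: 'a :: complex_hilbert_space) 0 = 0"
  using cinner_add_right[of y 0 0] by simp

lemma cinner_minus_left: "cinner (- x) y = - cinner x (y :: 'a :: complex_hilbert_space)"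
  using cinner_add_left[of x "- x" y] by (simp add: eq_neg_iff_add_eq_0 add.commute)

lemma cinner_minus_right: "cinner x (- y) = - cinner x (y :: 'a :: complex_hilbert_space)"
  using cinner_add_right[of x y "- y"] by (simp add: eq_neg_iff_add_eq_0 add.commute)

lemma cinner_diff_left: "cinner (x - y) z = cinner x z - cinner y (z :: 'a :: complex_hilbert_space)"
  using cinner_add_left[of x "- y" z] by (simp add: cinner_minus_left)

lemma cinner_diff_right: "cinner x (y - z) = cinner x y - cinner x (z :: 'a :: complex_hilbert_space)"
  using cinner_add_right[of x y "- z"] by (simp add: cinner_minus_right)

lemma cinner_sum_left: "cinner (\<Sum>i\<in>A. f i) y = (\<Sum>i\<in>A. cinner (f i) (y :: 'a :: complex_hilbert_space))"
  by (induction A rule: infinite_finite_induct) (auto simp: cinner_add_left)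

lemma cinner_sum_right: "cinner y (\<Sum>i\<in>A. f i) = (\<Sum>i\<in>A. cinner (y :: 'a :: complex_hilbert_space) (f i))"
  by (induction A rule: infinite_finite_induct) (auto simp: cinner_add_right)

lemma cinner_self: "cinner x x = of_real ((norm (x :: 'a :: complex_hilbert_space))\<^sup>2)"
proof -
  have "Im (cinner x x) = 0"
    using arg_cong[OF cinner_commute[of x x], of Im] by simp
  then show ?thesis
    by (simp add: complex_eq_iff power2_norm_eq_inner inner_eq_Re_cinner)
qed

lemma norm_cinner_le: "cmod (cinner x y) \<le> norm x * norm (y :: 'a :: complex_hilbert_space)"
proof (cases "cinner x y = 0")
  case False
  \<comment> \<open>Rotate \<open>x\<close> so that the inner product becomes real.\<close>
  define c where "c = cnj (cinner x y) / cmod (cinner x y)"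
  have c: "cmod c = 1" using False by (simp add: c_def norm_divide)
  have "cinner (c *\<^sub>C x) y = of_real (cmod (cinner x y))"
    using False by (simp add: cinner_scaleC_left c_def complex_norm_square[symmetric] 
        power2_eq_square mult.commute)
  then have "cmod (cinner x y) = inner (c *\<^sub>C x) y"
    by (simp add: inner_eq_Re_cinner)
  also have "\<dots> \<le> norm (c *\<^sub>C x) * norm y"
    by (rule norm_cauchy_schwarz)
  finally show ?thesis by (simp add: norm_scaleC c)
qed simp

lemma cinner_eqI: "x = y" if "\<And>z. cinner x z = cinner y (z :: 'a :: complex_hilbert_space)"
proof -
  have "cinner (x - y) (x - y) = 0" using that by (simp add: cinner_diff_left)
  then show ?thesis by (simp add: cinner_self)
qed

lemma bounded_linear_cinner_left: "bounded_linear (\<lambda>x. cinner x (y :: 'a :: complex_hilbert_space))"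
  by (rule bounded_linear_intro[of _ "norm y"])
    (simp_all add: cinner_add_left cinner_scaleR_left scaleR_conv_of_real norm_cinner_le)

lemma bounded_linear_cinner_right: "bounded_linear (\<lambda>y. cinner x (y :: 'a :: complex_hilbert_space))"
  by (rule bounded_linear_intro[of _ "norm x"])
    (use norm_cinner_le[of x] in \<open>simp_all add: cinner_add_right cinner_scaleR_right scaleR_conv_of_real
        mult.commute[of _ "norm x"]\<close>)

instantiation "fun" :: (type, complex_vector) complex_vector
begin
definition scaleC_fun :: "complex \<Rightarrow> ('a \<Rightarrow> 'b) \<Rightarrow> 'a \<Rightarrow> 'b"
  where "scaleC_fun c f = (\<lambda>x. c *\<^sub>C f x)"
instance
  by standard (auto simp: scaleC_fun_def fun_eq_iff scaleC_add_right scaleC_add_left scaleC_scaleC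
      scaleC_one)
end

lemma scaleC_fun_apply [simp]: "(c *\<^sub>C f) x = c *\<^sub>C f x"
  by (simp add: scaleC_fun_def)

lemma scaleC_zero_left [simp]: "0 *\<^sub>C (x :: 'a :: complex_vector) = 0"
  using scaleC_add_left[of 0 0 x] by simp

lemma scaleC_minus_left: "(- c) *\<^sub>C (x :: 'a :: complex_vector) = - (c *\<^sub>C x)"
  using scaleC_add_left[of c "- c" x] by (simp add: eq_neg_iff_add_eq_0 add.commute)

lemma scaleC_minus1 [simp]: "(-1) *\<^sub>C (x :: 'a :: complex_vector) = - x"
  by (simp add: scaleC_minus_left scaleC_one)

lemma scaleC_sum_right: "c *\<^sub>C (\<Sum>i\<in>A. f i) = (\<Sum>i\<in>A. c *\<^sub>C (f i :: 'a :: complex_vector))"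
  by (induction A rule: infinite_finite_induct) (auto simp: scaleC_add_right)

lemma scaleC_sum_left: "(\<Sum>i\<in>A. f i) *\<^sub>C (x :: 'a :: complex_vector) = (\<Sum>i\<in>A. f i *\<^sub>C x)"
  by (induction A rule: infinite_finite_induct) (auto simp: scaleC_add_left)


section \<open>Orthogonal projections in a Hilbert space given by a carrier\<close>

definition csubspace :: "'v :: complex_vector set \<Rightarrow> bool"
  where "csubspace K \<longleftrightarrow> 0 \<in> K \<and> (\<forall>v\<in>K. \<forall>w\<in>K. v + w \<in> K) \<and> (\<forall>c. \<forall>v\<in>K. c *\<^sub>C v \<in> K)"

lemma csubspace_0: "csubspace K \<Longrightarrow> 0 \<in> K"
  and csubspace_add: "csubspace K \<Longrightarrow> v \<in> K \<Longrightarrow> w \<in> K \<Longrightarrow> v + w \<in> K"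
  and csubspace_scale: "csubspace K \<Longrightarrow> v \<in> K \<Longrightarrow> c *\<^sub>C v \<in> K"
  by (auto simp: csubspace_def)

lemma csubspace_diff: "csubspace K \<Longrightarrow> v \<in> K \<Longrightarrow> w \<in> K \<Longrightarrow> v - w \<in> K"
  using csubspace_add[of K v "(-1) *\<^sub>C w"] csubspace_scale[of K w "-1"] by simp

lemma csubspace_sum: "csubspace K \<Longrightarrow> (\<And>i. i \<in> A \<Longrightarrow> f i \<in> K) \<Longrightarrow> (\<Sum>i\<in>A. f i) \<in> K"
  by (induction A rule: infinite_finite_induct) (auto simp: csubspace_0 csubspace_add)

text \<open>The spaces in question, \<open>H\<^sup>N\<close>, the Hilbert--Schmidt operators and \<open>n\<close>-tuples of these, are carriers
  inside larger types. Completeness is a separate assumption because for Hilbert--Schmidt operators its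
  proof uses the Cauchy--Schwarz inequality.\<close>

locale pre_hilbert_carrier =
  fixes V :: "'v :: complex_vector set" and ip :: "'v \<Rightarrow> 'v \<Rightarrow> complex"
  assumes sub: "csubspace V"
    and ip_add_left: "u \<in> V \<Longrightarrow> v \<in> V \<Longrightarrow> w \<in> V \<Longrightarrow> ip (u + v) w = ip u w + ip v w"
    and ip_scale_left: "v \<in> V \<Longrightarrow> w \<in> V \<Longrightarrow> ip (c *\<^sub>C v) w = c * ip v w"
    and ip_commute: "v \<in> V \<Longrightarrow> w \<in> V \<Longrightarrow> ip v w = cnj (ip w v)"
    and ip_nonneg: "v \<in> V \<Longrightarrow> 0 \<le> Re (ip v v)"
    and ip_definite: "v \<in> V \<Longrightarrow> ip v v = 0 \<Longrightarrow> v = 0"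
begin

lemmas add_mem = csubspace_add[OF sub]
lemmas scale_mem = csubspace_scale[OF sub]
lemmas diff_mem = csubspace_diff[OF sub]
lemmas zero_mem = csubspace_0[OF sub]

lemma ip_add_right: "u \<in> V \<Longrightarrow> v \<in> V \<Longrightarrow> w \<in> V \<Longrightarrow> ip w (u + v) = ip w u + ip w v"
  using ip_commute[of w "u + v"] ip_commute[of w u] ip_commute[of w v]
  by (simp add: ip_add_left add_mem)

lemma ip_scale_right: "v \<in> V \<Longrightarrow> w \<in> V \<Longrightarrow> ip w (c *\<^sub>C v) = cnj c * ip w v"
  using ip_commute[of w "c *\<^sub>C v"] ip_commute[of w v] by (simp add: ip_scale_left scale_mem)

lemma ip_diff_left: "u \<in> V \<Longrightarrow> v \<in> V \<Longrightarrow> w \<in> V \<Longrightarrow> ip (u - v) w = ip u w - ip v w"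
  using ip_add_left[of u "(-1) *\<^sub>C v" w] ip_scale_left[of v w "-1"] scale_mem[of v "-1"] by simp

lemma ip_diff_right: "u \<in> V \<Longrightarrow> v \<in> V \<Longrightarrow> w \<in> V \<Longrightarrow> ip w (u - v) = ip w u - ip w v"
  using ip_add_right[of u "(-1) *\<^sub>C v" w] ip_scale_right[of v w "-1"] scale_mem[of v "-1"] by simp

lemma ip_zero_left: "v \<in> V \<Longrightarrow> ip 0 v = 0"
  using ip_scale_left[of v v 0] by simp

lemma ip_zero_right: "v \<in> V \<Longrightarrow> ip v 0 = 0"
  using ip_scale_right[of v v 0] by simp

lemma ip_self: "v \<in> V \<Longrightarrow> ip v v = of_real (Re (ip v v))"
  using arg_cong[OF ip_commute[of v v], of Im] by (simp add: complex_eq_iff)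

lemma norm_diff_scale:
  assumes "v \<in> V" "w \<in> V"
  shows "Re (ip (v - c *\<^sub>C w) (v - c *\<^sub>C w)) =
    Re (ip v v) - 2 * Re (cnj c * ip v w) + (cmod c)\<^sup>2 * Re (ip w w)"
proof -
  have 1: "ip (v - c *\<^sub>C w) (v - c *\<^sub>C w) = ip v v - cnj c * ip v w - (c * ip w v - c * cnj c * ip w w)"
    using assms by (simp add: ip_diff_left ip_diff_right ip_scale_left ip_scale_right scale_mem diff_mem
       algebra_simps)
  have 2: "c * ip w v = cnj (cnj c * ip v w)" using assms ip_commute[of w v] by simp
  have 3: "c * cnj c * ip w w = of_real ((cmod c)\<^sup>2 * Re (ip w w))"
    using ip_self[OF assms(2)] by (metis complex_norm_square of_real_mult)
  show ?thesis unfolding 1 2 3 by simp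
qed

text \<open>Minimality of \<open>Re (ip v v)\<close> up to \<open>d\<close> along the line through \<open>w\<close> forces \<open>v\<close> to be almost
  orthogonal to \<open>w\<close>; with \<open>d = Re (ip v v)\<close> this is the Cauchy--Schwarz inequality.\<close>

lemma near_minimal:
  assumes v: "v \<in> V" and w: "w \<in> V"
    and min: "\<And>c. Re (ip v v) - d \<le> Re (ip (v - c *\<^sub>C w) (v - c *\<^sub>C w))"
  shows "(cmod (ip v w))\<^sup>2 \<le> d * Re (ip w w)"
proof (cases "w = 0")
  case True
  then show ?thesis using v w by (simp add: ip_zero_right ip_zero_left)
next
  case False
  let ?W = "Re (ip w w)"
  have W: "?W > 0"
  proof -
    have "?W \<noteq> 0" using ip_definite[OF w] ip_self[OF w] False by (metis of_real_0)
    then show ?thesis using ip_nonneg[OF w] by linarith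
  qed
  define c where "c = ip v w / of_real ?W"
  have "cnj c * ip v w = of_real ((cmod (ip v w))\<^sup>2 / ?W)"
    using complex_norm_square[of "ip v w"] by (simp add: c_def mult.commute)
  moreover have "(cmod c)\<^sup>2 * ?W = (cmod (ip v w))\<^sup>2 / ?W"
    using W by (simp add: c_def norm_divide power_divide power2_eq_square)
  ultimately have "- d \<le> - ((cmod (ip v w))\<^sup>2 / ?W)"
    using min[of c] norm_diff_scale[OF v w, of c] by simp
  then show ?thesis using W by (simp add: field_simps)
qed

lemma cauchy_schwarz:
  assumes "v \<in> V" "w \<in> V"
  shows "(cmod (ip v w))\<^sup>2 \<le> Re (ip v v) * Re (ip w w)"
  using near_minimal[OF assms, of "Re (ip v v)"] ip_nonneg diff_mem scale_mem assms by simp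

lemma parallelogram:
  assumes "u \<in> V" "v \<in> V"
  shows "Re (ip (u + v) (u + v)) + Re (ip (u - v) (u - v)) = 2 * Re (ip u u) + 2 * Re (ip v v)"
  using assms by (simp add: ip_add_left ip_add_right ip_diff_left ip_diff_right add_mem diff_mem)

definition orthonormal :: "'v set \<Rightarrow> bool"
  where "orthonormal U \<longleftrightarrow> U \<subseteq> V \<and> (\<forall>u\<in>U. \<forall>v\<in>U. ip u v = (if u = v then 1 else 0))"

lemma ip_sum_left: "(\<And>i. i \<in> A \<Longrightarrow> f i \<in> V) \<Longrightarrow> w \<in> V \<Longrightarrow> ip (\<Sum>i\<in>A. f i) w = (\<Sum>i\<in>A. ip (f i) w)"
proof (induction A rule: infinite_finite_induct)
  case (insert a A)
  then show ?case using ip_add_left[of "f a" "sum f A" w] csubspace_sum[OF sub, of A f] by simp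
qed (simp_all add: ip_zero_left)

lemma ip_orthonormal_sum:
  assumes U: "finite U" "orthonormal U" and v: "v \<in> U"
  shows "ip (\<Sum>u\<in>U. c u *\<^sub>C u) v = c v"
proof -
  have "ip (\<Sum>u\<in>U. c u *\<^sub>C u) v = (\<Sum>u\<in>U. ip (c u *\<^sub>C u) v)"
    by (rule ip_sum_left) (use U v in \<open>auto simp: orthonormal_def intro!: scale_mem\<close>)
  also have "\<dots> = (\<Sum>u\<in>U. if v = u then c v else 0)"
    by (rule sum.cong) (use U v in \<open>auto simp: orthonormal_def ip_scale_left subset_eq\<close>)
  also have "\<dots> = c v" using U v by (simp add: sum.delta)
  finally show ?thesis .
qed

lemma orthonormal_expansion:
  assumes U: "finite U" "orthonormal U" and w: "w = (\<Sum>u\<in>U. c u *\<^sub>C u)"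
  shows "w = (\<Sum>u\<in>U. ip w u *\<^sub>C u)"
proof -
  have "ip w u = c u" if "u \<in> U" for u unfolding w by (rule ip_orthonormal_sum[OF U that])
  then show ?thesis using w by (simp cong: sum.cong)
qed

text \<open>The new vector is the normalized remainder of \<open>w\<close>.\<close>

lemma gram_schmidt_step:
  assumes W: "csubspace W" "W \<subseteq> V" and U: "finite U" "orthonormal U" "U \<subseteq> W"
    and w: "w \<in> W" "w \<noteq> (\<Sum>u\<in>U. ip w u *\<^sub>C u)"
  shows "\<exists>e\<in>W. e \<notin> U \<and> orthonormal (insert e U) \<and> w = (\<Sum>u\<in>insert e U. ip w u *\<^sub>C u)"
proof -
  define s where "s = (\<Sum>u\<in>U. ip w u *\<^sub>C u)"
  have sW: "s \<in> W" unfolding s_def by (rule csubspace_sum[OF W(1)]) (use U W in \<open>auto intro: csubspace_scale\<close>)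
  define r where "r = w - s"
  have rW: "r \<in> W" unfolding r_def by (rule csubspace_diff[OF W(1) w(1) sW])
  have V: "w \<in> V" "s \<in> V" "r \<in> V" using w sW rW W by blast+
  have ru: "ip r u = 0" if "u \<in> U" for u
  proof -
    have "u \<in> V" using U that W by blast
    then show ?thesis using ip_orthonormal_sum[OF U(1,2) that, of "ip w"] V
      by (simp add: r_def ip_diff_left s_def[symmetric])
  qed
  have "r \<noteq> 0" using w by (simp add: r_def s_def)
  define q where "q = Re (ip r r)"
  have q: "q > 0" and rr: "ip r r = of_real q"
    using \<open>r \<noteq> 0\<close> ip_definite[OF V(3)] ip_self[OF V(3)] ip_nonneg[OF V(3)] unfolding q_def
    by (metis less_eq_real_def of_real_0)+
  define e where "e = of_real (1 / sqrt q) *\<^sub>C r"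
  have eW: "e \<in> W" unfolding e_def by (rule csubspace_scale[OF W(1) rW])
  have "of_real (1 / sqrt q) * (of_real (1 / sqrt q) * (of_real q :: complex)) = of_real ((1 / sqrt q) * ((1 / sqrt q) * q))"
    by (simp only: of_real_mult)
  also have "(1 / sqrt q) * ((1 / sqrt q) * q) = 1" using q by (simp add: real_div_sqrt)
  finally have ee: "ip e e = 1"
    using V by (simp add: e_def ip_scale_left ip_scale_right scale_mem rr)
  have eu: "ip e u = 0" "ip u e = 0" if "u \<in> U" for u
  proof -
    have uV: "u \<in> V" using U that W by blast
    show 1: "ip e u = 0" using V uV ru[OF that] by (simp add: e_def ip_scale_left)
    show "ip u e = 0" using ip_commute[OF uV, of e] eW W 1 by auto
  qed
  have "e \<notin> U" using eu ee by fastforce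
  have on: "orthonormal (insert e U)"
    using U(2) eu ee eW W \<open>e \<notin> U\<close> unfolding orthonormal_def by auto
  have "w = (\<Sum>u\<in>insert e U. (if u = e then of_real (sqrt q) else ip w u) *\<^sub>C u)"
  proof -
    have "of_real (sqrt q) * of_real (1 / sqrt q) = (of_real (sqrt q * (1 / sqrt q)) :: complex)"
      by (simp only: of_real_mult)
    then have "of_real (sqrt q) *\<^sub>C e = r" using q by (simp add: e_def scaleC_scaleC scaleC_one)
    moreover have "(\<Sum>u\<in>U. (if u = e then of_real (sqrt q) else ip w u) *\<^sub>C u) = s"
      unfolding s_def using \<open>e \<notin> U\<close> by (intro sum.cong) auto
    ultimately show ?thesis using U(1) \<open>e \<notin> U\<close> by (simp add: r_def)
  qed
  from orthonormal_expansion[OF _ on this] show ?thesis using eW on \<open>e \<notin> U\<close> U(1) by blast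
qed

lemma finite_orthonormal_span:
  assumes "finite B" "B \<subseteq> V"
  shows "\<exists>U. finite U \<and> orthonormal U \<and> (\<forall>b\<in>B. b = (\<Sum>u\<in>U. ip b u *\<^sub>C u))"
  using assms
proof induction
  case empty
  then show ?case by (intro exI[of _ "{}"]) (simp add: orthonormal_def)
next
  case (insert b B)
  obtain U where U: "finite U" "orthonormal U" and B: "\<forall>b\<in>B. b = (\<Sum>u\<in>U. ip b u *\<^sub>C u)"
    using insert by auto
  show ?case
  proof (cases "b = (\<Sum>u\<in>U. ip b u *\<^sub>C u)")
    case True
    then show ?thesis using U B by blast
  next
    case False
    have "U \<subseteq> V" "b \<in> V" using U(2) insert by (auto simp: orthonormal_def)
    from gram_schmidt_step[OF sub subset_refl U this False]
    obtain e where e: "e \<notin> U" "orthonormal (insert e U)" "b = (\<Sum>u\<in>insert e U. ip b u *\<^sub>C u)" by blast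
    have "a = (\<Sum>u\<in>insert e U. ip a u *\<^sub>C u)" if a: "a \<in> B" for a
    proof (rule orthonormal_expansion[OF _ e(2)])
      have "(\<Sum>u\<in>U. (if u = e then 0 else ip a u) *\<^sub>C u) = (\<Sum>u\<in>U. ip a u *\<^sub>C u)"
        using e(1) by (intro sum.cong) auto
      then show "a = (\<Sum>u\<in>insert e U. (if u = e then 0 else ip a u) *\<^sub>C u)"
        using U(1) e(1) B[rule_format, OF a] by simp
    qed (use U in simp)
    then show ?thesis using e U(1) by (intro exI[of _ "insert e U"]) auto
  qed
qed

end

locale hilbert_carrier = pre_hilbert_carrier V ip for V :: "'v :: complex_vector set" and ip +
  assumes complete: "(\<And>k :: nat. s k \<in> V) \<Longrightarrow>
      (\<And>e. e > 0 \<Longrightarrow> \<exists>k0. \<forall>k\<ge>k0. \<forall>m\<ge>k0. Re (ip (s k - s m) (s k - s m)) < e) \<Longrightarrow>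
      \<exists>v\<in>V. \<forall>e>0. \<exists>k0. \<forall>k\<ge>k0. Re (ip (v - s k) (v - s k)) < e"
begin

text \<open>The projection theorem: a sequence in \<open>K\<close> whose distances to \<open>v\<close> tend to the infimum is
  Cauchy by the parallelogram law, and its limit is the projection of \<open>v\<close>.\<close>

lemma projection_exists:
  assumes K: "csubspace K" "K \<subseteq> V" "ip_closure ip V K \<subseteq> K" and v: "v \<in> V"
  shows "\<exists>w\<in>K. \<forall>u\<in>K. ip (v - w) u = 0"
proof -
  let ?q = "\<lambda>u. Re (ip u u)"
  define d where "d = (INF u\<in>K. ?q (v - u))"
  have KV: "u \<in> K \<Longrightarrow> u \<in> V" for u using K(2) by blast
  have bdd: "bdd_below ((\<lambda>u. ?q (v - u)) ` K)"
    by (rule bdd_belowI[of _ 0]) (use KV v in \<open>auto intro!: ip_nonneg diff_mem\<close>)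
  have dle: "d \<le> ?q (v - u)" if "u \<in> K" for u
    unfolding d_def by (rule cINF_lower[OF bdd that])
  have "\<exists>u\<in>K. ?q (v - u) < d + e" if "e > 0" for e
  proof -
    have "Inf ((\<lambda>u. ?q (v - u)) ` K) < d + e" using that by (simp add: d_def)
    then have "\<exists>y\<in>(\<lambda>u. ?q (v - u)) ` K. y < d + e"
      using csubspace_0[OF K(1)] bdd by (subst (asm) cInf_less_iff) auto
    then show ?thesis by blast
  qed
  then have "\<forall>k :: nat. \<exists>u\<in>K. ?q (v - u) < d + 1 / real (Suc k)" by simp
  then obtain s where sK: "\<And>k :: nat. s k \<in> K" and s: "\<And>k. ?q (v - s k) < d + 1 / real (Suc k)"
    by metis
  have sV: "s k \<in> V" for k using KV sK by blast
  have vs: "v - s k \<in> V" for k by (rule diff_mem[OF v sV])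
  have cau: "?q (s k - s m) \<le> 2 / real (Suc k) + 2 / real (Suc m)" for k m
  proof -
    let ?h = "(1/2) *\<^sub>C (s k + s m)"
    have hK: "?h \<in> K" by (intro csubspace_scale csubspace_add K sK)
    have e: "(v - s k) + (v - s m) = 2 *\<^sub>C (v - ?h)"
    proof -
      have "2 *\<^sub>C v = v + v" using scaleC_add_left[of 1 1 v] by (simp add: scaleC_one)
      then show ?thesis by (simp add: scaleC_diff_right scaleC_scaleC scaleC_one)
    qed
    have "?q ((v - s k) + (v - s m)) = 4 * ?q (v - ?h)"
      unfolding e using diff_mem[OF v KV[OF hK]] 
      by (simp add: ip_scale_left ip_scale_right scale_mem)
    moreover have "(v - s k) - (v - s m) = s m - s k" by simp
    moreover have "?q (s m - s k) = ?q (s k - s m)"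
      using sV by (simp add: ip_diff_left ip_diff_right diff_mem)
    ultimately have "?q (s k - s m) = 2 * ?q (v - s k) + 2 * ?q (v - s m) - 4 * ?q (v - ?h)"
      using parallelogram[OF vs[of k] vs[of m]] by simp
    then show ?thesis using s[of k] s[of m] dle[OF hK] by simp
  qed
  have "\<exists>w\<in>V. \<forall>e>0. \<exists>k0. \<forall>k\<ge>k0. ?q (w - s k) < e"
  proof (rule complete[OF sV])
    fix e :: real assume e: "e > 0"
    obtain k0 :: nat where k0: "4 / e < real k0" using reals_Archimedean2 by blast
    have "?q (s k - s m) < e" if "k \<ge> k0" "m \<ge> k0" for k m
    proof -
      have t: "2 / real (Suc j) < e / 2" if "j \<ge> k0" for j
      proof -
        have "4 / e < real (Suc j)" using k0 that by simp
        then show ?thesis using e by (simp add: field_simps)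
      qed
      show ?thesis using cau[of k m] t[OF that(1)] t[OF that(2)] by linarith
    qed
    then show "\<exists>k0. \<forall>k\<ge>k0. \<forall>m\<ge>k0. ?q (s k - s m) < e" by blast
  qed
  then obtain w where wV: "w \<in> V" and w: "\<And>e. e > 0 \<Longrightarrow> \<exists>k0. \<forall>k\<ge>k0. ?q (w - s k) < e"
    by blast
  have "w \<in> ip_closure ip V K"
    unfolding ip_closure_def
  proof (intro CollectI conjI allI impI wV)
    fix e :: real assume "e > 0"
    then obtain k0 where "?q (w - s k0) < e\<^sup>2" using w[of "e\<^sup>2"] by auto
    then have "sqrt (?q (w - s k0)) < e" using \<open>e > 0\<close> by (simp add: real_less_lsqrt)
    then show "\<exists>u\<in>K. sqrt (?q (w - u)) < e" using sK by blast
  qed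
  then have wK: "w \<in> K" using K(3) by blast
  have "ip (v - w) u = 0" if u: "u \<in> K" for u
  proof (rule ccontr)
    assume ne: "ip (v - w) u \<noteq> 0"
    have uV: "u \<in> V" using KV u by blast
    define A where "A = Re (ip u u)"
    have A0: "A \<ge> 0" using ip_nonneg uV A_def by blast
    define e where "e = (cmod (ip (v - w) u) / 2)\<^sup>2"
    have e0: "e > 0" using ne by (simp add: e_def)
    obtain k1 where k1: "\<And>k. k \<ge> k1 \<Longrightarrow> ?q (w - s k) < e / (A + 1)"
      using w[of "e / (A + 1)"] e0 A0 by auto
    obtain k2 :: nat where k2: "(A + 1) / e < real k2" using reals_Archimedean2 by blast
    define k where "k = max k1 k2"
    \<comment> \<open>\<open>v - w\<close> is the sum of \<open>v - s k\<close>, which is almost orthogonal to \<open>u\<close>, and of the small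
      vector \<open>s k - w\<close>.\<close>
    have "(cmod (ip (v - s k) u))\<^sup>2 \<le> (1 / real (Suc k)) * A" unfolding A_def
    proof (rule near_minimal[OF vs uV])
      fix c
      have "d \<le> ?q (v - (s k + c *\<^sub>C u))"
        by (intro dle csubspace_add csubspace_scale K sK u)
      then show "?q (v - s k) - 1 / real (Suc k) \<le> ?q (v - s k - c *\<^sub>C u)"
        using s[of k] by (simp add: algebra_simps)
    qed
    also have "\<dots> < e"
    proof -
      have "(A + 1) / e < real (Suc k)" using k2 by (simp add: k_def)
      then show ?thesis using e0 A0 by (simp add: field_simps)
    qed
    finally have 1: "cmod (ip (v - s k) u) < cmod (ip (v - w) u) / 2"
      unfolding e_def by (rule power_less_imp_less_base) simp
    have "(cmod (ip (w - s k) u))\<^sup>2 \<le> ?q (w - s k) * A"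
      unfolding A_def by (rule cauchy_schwarz) (auto intro!: diff_mem wV sV uV)
    also have "\<dots> \<le> (e / (A + 1)) * A" 
      using k1[of k] A0 by (intro mult_right_mono) (auto simp: k_def)
    also have "\<dots> < e" using A0 e0 by (simp add: field_simps)
    finally have 2: "cmod (ip (w - s k) u) < cmod (ip (v - w) u) / 2"
      unfolding e_def by (rule power_less_imp_less_base) simp
    have "ip (v - w) u = ip (v - s k) u - ip (w - s k) u"
      using v wV sV uV by (simp add: ip_diff_left)
    then show False using 1 2 norm_triangle_ineq4[of "ip (v - s k) u" "ip (w - s k) u"] by simp
  qed
  then show ?thesis using wK by blast
qed

lemma orth_proj_unique:
  assumes "csubspace K" "K \<subseteq> V" "v \<in> V" "w \<in> K" "\<And>u. u \<in> K \<Longrightarrow> ip (v - w) u = 0"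
  shows "orth_proj ip K v = w"
  unfolding orth_proj_def
proof (rule the_equality)
  show "w \<in> K \<and> (\<forall>u\<in>K. ip (v - w) u = 0)" using assms by blast
  fix w' assume w': "w' \<in> K \<and> (\<forall>u\<in>K. ip (v - w') u = 0)"
  have V: "w \<in> V" "w' \<in> V" using assms w' by blast+
  have "w - w' \<in> K" using csubspace_diff assms w' by blast
  then have "ip (v - w) (w - w') = 0" "ip (v - w') (w - w') = 0" using assms w' by blast+
  then have "ip (w - w') (w - w') = 0"
    using V assms by (simp add: ip_diff_left diff_mem)
  then show "w' = w" using ip_definite[OF diff_mem[OF V]] by simp
qed

lemma orth_proj_props:
  assumes K: "csubspace K" "K \<subseteq> V" "ip_closure ip V K \<subseteq> K" and v: "v \<in> V"
  shows orth_proj_mem: "orth_proj ip K v \<in> K"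
    and orth_proj_orth: "\<And>u. u \<in> K \<Longrightarrow> ip (v - orth_proj ip K v) u = 0"
proof -
  obtain w where w: "w \<in> K" "\<And>u. u \<in> K \<Longrightarrow> ip (v - w) u = 0"
    using projection_exists[OF assms] by blast
  then have "orth_proj ip K v = w" by (rule orth_proj_unique[OF K(1,2) v])
  then show "orth_proj ip K v \<in> K" "\<And>u. u \<in> K \<Longrightarrow> ip (v - orth_proj ip K v) u = 0"
    using w by auto
qed

lemma norm_triangle_sq:
  assumes "u \<in> V" "v \<in> V"
  shows "Re (ip (u + v) (u + v)) \<le> 2 * Re (ip u u) + 2 * Re (ip v v)"
  using parallelogram[OF assms] ip_nonneg[OF diff_mem[OF assms]] by linarith

lemma ip_closure_alt:
  "ip_closure ip V A = {v\<in>V. \<forall>e>0. \<exists>w\<in>A. Re (ip (v - w) (v - w)) < e}" if "A \<subseteq> V" for A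
proof -
  have "(\<forall>e>0. \<exists>w\<in>A. sqrt (Re (ip (v - w) (v - w))) < e) \<longleftrightarrow> (\<forall>e>0. \<exists>w\<in>A. Re (ip (v - w) (v - w)) < e)"
    (is "?l v \<longleftrightarrow> ?r v") for v
  proof
    assume l: "?l v"
    show "?r v"
    proof (intro allI impI)
      fix e :: real assume "e > 0"
      then have "sqrt e > 0" by simp
      with l obtain w where "w \<in> A" "sqrt (Re (ip (v - w) (v - w))) < sqrt e" by blast
      then show "\<exists>w\<in>A. Re (ip (v - w) (v - w)) < e" by auto
    qed
  next
    assume r: "?r v"
    show "?l v"
    proof (intro allI impI)
      fix e :: real assume "e > 0"
      then have "e\<^sup>2 > 0" by simp
      with r obtain w where "w \<in> A" "Re (ip (v - w) (v - w)) < e\<^sup>2" by blast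
      then show "\<exists>w\<in>A. sqrt (Re (ip (v - w) (v - w))) < e"
        using \<open>e > 0\<close> real_less_lsqrt by (metis less_imp_le)
    qed
  qed
  then show ?thesis by (auto simp: ip_closure_def)
qed

lemma subset_closure: "A \<subseteq> V \<Longrightarrow> A \<subseteq> ip_closure ip V A"
  by (auto simp: ip_closure_def intro!: bexI simp: ip_zero_left zero_mem)

lemma closure_subset_carrier: "ip_closure ip V A \<subseteq> V"
  by (auto simp: ip_closure_def)

lemma closure_closed:
  assumes A: "A \<subseteq> V"
  shows "ip_closure ip V (ip_closure ip V A) \<subseteq> ip_closure ip V A"
proof
  fix v assume v: "v \<in> ip_closure ip V (ip_closure ip V A)"
  then have vV: "v \<in> V" by (simp add: ip_closure_def)
  have "\<exists>w\<in>A. Re (ip (v - w) (v - w)) < e" if "e > 0" for e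
  proof -
    have "e / 4 > 0" using that by simp
    obtain u where u: "u \<in> ip_closure ip V A" and "Re (ip (v - u) (v - u)) < e / 4"
      using v \<open>e / 4 > 0\<close> unfolding ip_closure_alt[OF closure_subset_carrier] by blast
    moreover obtain w where w: "w \<in> A" and "Re (ip (u - w) (u - w)) < e / 4"
      using u \<open>e / 4 > 0\<close> unfolding ip_closure_alt[OF A] by blast
    moreover have "u \<in> V" "w \<in> V" using u w A by (auto simp: ip_closure_def)
    ultimately have "Re (ip (v - w) (v - w)) < e"
      using norm_triangle_sq[of "v - u" "u - w"] vV by (simp add: diff_mem)
    then show ?thesis using w by blast
  qed
  then show "v \<in> ip_closure ip V A" using vV by (simp add: ip_closure_alt[OF A])
qed

lemma closure_csubspace:
  assumes A: "csubspace A" "A \<subseteq> V"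
  shows "csubspace (ip_closure ip V A)"
  unfolding csubspace_def
proof (intro conjI ballI allI)
  show "0 \<in> ip_closure ip V A" using subset_closure[OF A(2)] csubspace_0[OF A(1)] by blast
  fix v assume v: "v \<in> ip_closure ip V A"
  then have vV: "v \<in> V" by (simp add: ip_closure_def)
  {
    fix w assume w: "w \<in> ip_closure ip V A"
    then have wV: "w \<in> V" by (simp add: ip_closure_def)
    have "\<exists>u\<in>A. Re (ip (v + w - u) (v + w - u)) < e" if "e > 0" for e
    proof -
      have "e / 4 > 0" using that by simp
      obtain a where a: "a \<in> A" "Re (ip (v - a) (v - a)) < e / 4"
        using v \<open>e / 4 > 0\<close> unfolding ip_closure_alt[OF A(2)] by blast
      obtain b where b: "b \<in> A" "Re (ip (w - b) (w - b)) < e / 4"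
        using w \<open>e / 4 > 0\<close> unfolding ip_closure_alt[OF A(2)] by blast
      have va: "v - a \<in> V" and wb: "w - b \<in> V" using a b A(2) vV wV by (auto intro!: diff_mem)
      have eq: "v + w - (a + b) = (v - a) + (w - b)" by simp
      have "Re (ip (v + w - (a + b)) (v + w - (a + b))) < e"
        using norm_triangle_sq[OF va wb] a(2) b(2) unfolding eq by linarith
      then show ?thesis using csubspace_add[OF A(1) a(1) b(1)] by blast
    qed
    then show "v + w \<in> ip_closure ip V A"
      using add_mem[OF vV wV] by (simp add: ip_closure_alt[OF A(2)])
  }
  fix c
  have "\<exists>u\<in>A. Re (ip (c *\<^sub>C v - u) (c *\<^sub>C v - u)) < e" if "e > 0" for e
  proof -
    let ?C = "(cmod c)\<^sup>2 + 1"
    have C: "?C > 0" by (simp add: add_nonneg_pos)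
    then have "e / ?C > 0" using that by simp
    then obtain a where a: "a \<in> A" "Re (ip (v - a) (v - a)) < e / ?C"
      using v unfolding ip_closure_alt[OF A(2)] by blast
    have va: "v - a \<in> V" using a A(2) vV by (auto intro!: diff_mem)
    have "ip (c *\<^sub>C (v - a)) (c *\<^sub>C (v - a)) = c * cnj c * ip (v - a) (v - a)"
      using va by (simp add: ip_scale_left ip_scale_right scale_mem)
    also have "\<dots> = of_real ((cmod c)\<^sup>2 * Re (ip (v - a) (v - a)))"
      using ip_self[OF va] by (metis complex_norm_square of_real_mult)
    finally have "Re (ip (c *\<^sub>C v - c *\<^sub>C a) (c *\<^sub>C v - c *\<^sub>C a)) = (cmod c)\<^sup>2 * Re (ip (v - a) (v - a))"
      by (simp add: scaleC_diff_right)
    also have "\<dots> \<le> ?C * Re (ip (v - a) (v - a))"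
      by (intro mult_right_mono ip_nonneg va) simp
    also have "\<dots> < e" using a(2) C by (simp add: field_simps)
    finally show ?thesis using csubspace_scale[OF A(1) a(1)] by blast
  qed
  then show "c *\<^sub>C v \<in> ip_closure ip V A"
    using scale_mem[OF vV] by (simp add: ip_closure_alt[OF A(2)])
qed

text \<open>Continuity of the inner product.\<close>

lemma orth_closure:
  assumes A: "A \<subseteq> V" and v: "v \<in> V" and o: "\<And>u. u \<in> A \<Longrightarrow> ip v u = 0" and w: "w \<in> ip_closure ip V A"
  shows "ip v w = 0"
proof (rule ccontr)
  assume ne: "ip v w \<noteq> 0"
  have wV: "w \<in> V" using w by (simp add: ip_closure_def)
  define a where "a = Re (ip v v) + 1"
  have a: "a > 0" using ip_nonneg[OF v] by (simp add: a_def)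
  have "(cmod (ip v w))\<^sup>2 / a > 0" using a ne by simp
  then obtain u where u: "u \<in> A" "Re (ip (w - u) (w - u)) < (cmod (ip v w))\<^sup>2 / a"
    using w unfolding ip_closure_alt[OF A] by blast
  have uV: "u \<in> V" using u A by blast
  have wu: "w - u \<in> V" using wV uV by (rule diff_mem)
  have "(cmod (ip v w))\<^sup>2 = (cmod (ip v (w - u)))\<^sup>2"
    using o[OF u(1)] v wV uV by (simp add: ip_diff_right)
  also have "\<dots> \<le> Re (ip v v) * Re (ip (w - u) (w - u))"
    by (rule cauchy_schwarz[OF v wu])
  also have "\<dots> \<le> a * Re (ip (w - u) (w - u))"
    by (intro mult_right_mono ip_nonneg wu) (simp add: a_def)
  also have "\<dots> < (cmod (ip v w))\<^sup>2" using u(2) a by (simp add: field_simps)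
  finally show False by simp
qed

end

context hilbert_carrier
begin

lemma orth_proj_add:
  assumes K: "csubspace K" "K \<subseteq> V" "ip_closure ip V K \<subseteq> K" and "v \<in> V" "w \<in> V"
  shows "orth_proj ip K (v + w) = orth_proj ip K v + orth_proj ip K w"
proof (rule orth_proj_unique[OF K(1,2)])
  show "v + w \<in> V" using assms by (simp add: add_mem)
  show "orth_proj ip K v + orth_proj ip K w \<in> K"
    using assms by (intro csubspace_add orth_proj_mem)
  fix u assume u: "u \<in> K"
  have m: "orth_proj ip K v \<in> V" "orth_proj ip K w \<in> V" "u \<in> V"
    using orth_proj_mem[OF K] assms u by blast+
  have "v + w - (orth_proj ip K v + orth_proj ip K w) = (v - orth_proj ip K v) + (w - orth_proj ip K w)"
    by simp
  then show "ip (v + w - (orth_proj ip K v + orth_proj ip K w)) u = 0"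
    using orth_proj_orth[OF K _ u] assms m by (simp only: ip_add_left diff_mem) simp
qed

lemma orth_proj_scale:
  assumes K: "csubspace K" "K \<subseteq> V" "ip_closure ip V K \<subseteq> K" and "v \<in> V"
  shows "orth_proj ip K (c *\<^sub>C v) = c *\<^sub>C orth_proj ip K v"
proof (rule orth_proj_unique[OF K(1,2)])
  show "c *\<^sub>C v \<in> V" using assms by (simp add: scale_mem)
  show "c *\<^sub>C orth_proj ip K v \<in> K"
    using assms by (intro csubspace_scale orth_proj_mem)
  fix u assume u: "u \<in> K"
  have m: "orth_proj ip K v \<in> V" "u \<in> V"
    using orth_proj_mem[OF K] assms u by blast+
  then show "ip (c *\<^sub>C v - c *\<^sub>C orth_proj ip K v) u = 0"
    using orth_proj_orth[OF K _ u] assms m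
    by (simp add: scaleC_diff_right[symmetric] ip_scale_left diff_mem)
qed

lemma orth_proj_self_adjoint:
  assumes K: "csubspace K" "K \<subseteq> V" "ip_closure ip V K \<subseteq> K" and v: "v \<in> V" and w: "w \<in> V"
  shows "ip (orth_proj ip K v) w = ip v (orth_proj ip K w)"
proof -
  let ?P = "orth_proj ip K"
  have m: "?P v \<in> K" "?P w \<in> K" using orth_proj_mem[OF K] v w by blast+
  then have mV: "?P v \<in> V" "?P w \<in> V" using K by blast+
  have "ip (v - ?P v) (?P w) = 0" by (rule orth_proj_orth[OF K v m(2)])
  then have 1: "ip v (?P w) = ip (?P v) (?P w)" using mV v by (simp add: ip_diff_left)
  have "ip (w - ?P w) (?P v) = 0" by (rule orth_proj_orth[OF K w m(1)])
  then have "ip w (?P v) = ip (?P w) (?P v)" using mV w by (simp add: ip_diff_left)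
  then have "ip (?P v) w = ip (?P v) (?P w)"
    using ip_commute[OF mV(1) w] ip_commute[OF mV(1) mV(2)] by simp
  then show ?thesis using 1 by simp
qed

lemma orth_proj_fix:
  assumes K: "csubspace K" "K \<subseteq> V" and "v \<in> K"
  shows "orth_proj ip K v = v"
  by (rule orth_proj_unique[OF K]) (use assms in \<open>auto simp: ip_zero_left\<close>)

lemma orth_proj_contraction:
  assumes K: "csubspace K" "K \<subseteq> V" "ip_closure ip V K \<subseteq> K" and v: "v \<in> V"
  shows "Re (ip (orth_proj ip K v) (orth_proj ip K v)) \<le> Re (ip v v)"
proof -
  let ?P = "orth_proj ip K"
  have m: "?P v \<in> V" using orth_proj_mem[OF K v] K by blast
  have "ip (v - ?P v) (?P v) = 0" by (rule orth_proj_orth[OF K v orth_proj_mem[OF K v]])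
  moreover from this have "ip (?P v) (v - ?P v) = 0"
    using ip_commute[OF m diff_mem[OF v m]] by simp
  moreover have "0 \<le> Re (ip (v - ?P v) (v - ?P v))" by (intro ip_nonneg diff_mem v m)
  ultimately show ?thesis using v m by (simp add: ip_diff_left ip_diff_right diff_mem)
qed

end

lemma hilbert_carrier_UNIV: "hilbert_carrier UNIV (cinner :: 'a :: complex_hilbert_space \<Rightarrow> 'a \<Rightarrow> complex)"
proof
  fix s :: "nat \<Rightarrow> 'a"
  assume c: "\<And>e. e > 0 \<Longrightarrow> \<exists>k0. \<forall>k\<ge>k0. \<forall>m\<ge>k0. Re (cinner (s k - s m) (s k - s m)) < e"
  have "Cauchy s"
  proof (rule metric_CauchyI)
    fix e :: real assume e: "0 < e"
    then obtain k0 where "\<forall>k\<ge>k0. \<forall>m\<ge>k0. (norm (s k - s m))\<^sup>2 < e\<^sup>2"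
      using c[of "e\<^sup>2"] by (auto simp: cinner_self)
    then have "\<forall>k\<ge>k0. \<forall>m\<ge>k0. dist (s k) (s m) < e"
      using e power_less_imp_less_base[of _ 2 e] unfolding dist_norm by (meson less_imp_le)
    then show "\<exists>M. \<forall>m\<ge>M. \<forall>n\<ge>M. dist (s m) (s n) < e" by blast
  qed
  then obtain l where l: "s \<longlonglongrightarrow> l"
    using Cauchy_convergent convergent_def by blast
  have "\<exists>k0. \<forall>k\<ge>k0. Re (cinner (l - s k) (l - s k)) < e" if e: "e > 0" for e
  proof -
    have "sqrt e > 0" using e by simp
    then obtain k0 where k0: "\<forall>k\<ge>k0. dist (s k) l < sqrt e" using l metric_LIMSEQ_D by blast
    have "(norm (l - s k))\<^sup>2 < e" if "k \<ge> k0" for k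
    proof -
      have "norm (l - s k) < sqrt e" using k0 that by (simp add: dist_norm norm_minus_commute)
      then have "(norm (l - s k))\<^sup>2 < (sqrt e)\<^sup>2" by (rule power_strict_mono) auto
      then show ?thesis using e by simp
    qed
    then show ?thesis by (auto simp: cinner_self)
  qed
  then show "\<exists>v\<in>UNIV. \<forall>e>0. \<exists>k0. \<forall>k\<ge>k0. Re (cinner (v - s k) (v - s k)) < e" by blast
next
  fix v :: 'a assume "cinner v v = 0" then show "v = 0" by (simp add: cinner_self)
next
  show "cinner v w = cnj (cinner w v)" for v w :: 'a by (rule cinner_commute)
qed (auto simp: csubspace_def cinner_add_left cinner_scaleC_left cinner_self)

lemma csubspace_tuples: "csubspace V \<Longrightarrow> csubspace (tuples n V)"
  by (auto simp: csubspace_def tuples_def)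

lemma hilbert_carrier_tuples:
  assumes "hilbert_carrier V ip"
  shows "hilbert_carrier (tuples n V) (tuple_ip ip n)"
proof -
  interpret hilbert_carrier V ip by fact
  have mem: "v i \<in> V" if "v \<in> tuples n V" "i < n" for v i
    using that by (simp add: tuples_def)
  have le: "Re (ip (v i) (v i)) \<le> Re (tuple_ip ip n v v)" if "v \<in> tuples n V" "i < n" for v i
  proof -
    have "(\<Sum>i\<in>{i}. Re (ip (v i) (v i))) \<le> (\<Sum>i<n. Re (ip (v i) (v i)))"
      by (rule sum_mono2) (use that mem in \<open>auto intro!: ip_nonneg\<close>)
    then show ?thesis by (simp add: tuple_ip_def)
  qed
  show ?thesis
  proof
    show "csubspace (tuples n V)" by (rule csubspace_tuples[OF sub])
    fix v assume v: "v \<in> tuples n V"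
    show "0 \<le> Re (tuple_ip ip n v v)"
      by (auto simp: tuple_ip_def intro!: sum_nonneg ip_nonneg mem[OF v])
    assume z: "tuple_ip ip n v v = 0"
    have "v i = 0" if "i < n" for i
    proof -
      have "Re (ip (v i) (v i)) = 0"
        using le[OF v that] ip_nonneg[OF mem[OF v that]] z by simp
      then show "v i = 0" 
        using ip_self[OF mem[OF v that]] ip_definite[OF mem[OF v that]] by (metis of_real_0)
    qed
    then have "v i = 0" for i
      using v by (cases "i < n") (auto simp: tuples_def)
    then show "v = 0" by (simp add: fun_eq_iff)
  next
    fix s :: "nat \<Rightarrow> nat \<Rightarrow> 'a"
    assume s: "\<And>k. s k \<in> tuples n V"
      and c: "\<And>e. e > 0 \<Longrightarrow> \<exists>k0. \<forall>k\<ge>k0. \<forall>m\<ge>k0. Re (tuple_ip ip n (s k - s m) (s k - s m)) < e"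
    have sd: "s k - s m \<in> tuples n V" for k m
      using csubspace_diff[OF csubspace_tuples[OF sub] s s] .
    have "\<exists>v\<in>V. \<forall>e>0. \<exists>k0. \<forall>k\<ge>k0. Re (ip (v - s k i) (v - s k i)) < e" if i: "i < n" for i
    proof (rule complete)
      show "s k i \<in> V" for k using mem[OF s i] .
      fix e :: real assume "e > 0"
      then obtain k0 where "\<forall>k\<ge>k0. \<forall>m\<ge>k0. Re (tuple_ip ip n (s k - s m) (s k - s m)) < e"
        using c by blast
      then show "\<exists>k0. \<forall>k\<ge>k0. \<forall>m\<ge>k0. Re (ip (s k i - s m i) (s k i - s m i)) < e"
        using le_less_trans[OF le[OF sd i]] by (intro exI[of _ k0]) simp
    qed
    then have "\<forall>i. \<exists>v. i < n \<longrightarrow> v \<in> V \<and> (\<forall>e>0. \<exists>k0. \<forall>k\<ge>k0. Re (ip (v - s k i) (v - s k i)) < e)"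
      by blast
    then obtain l where l: "\<And>i. i < n \<Longrightarrow> l i \<in> V"
      "\<And>i e. i < n \<Longrightarrow> e > 0 \<Longrightarrow> \<exists>k0. \<forall>k\<ge>k0. Re (ip (l i - s k i) (l i - s k i)) < e"
      by metis
    define v where "v = (\<lambda>i. if i < n then l i else 0)"
    show "\<exists>v\<in>tuples n V. \<forall>e>0. \<exists>k0. \<forall>k\<ge>k0. Re (tuple_ip ip n (v - s k) (v - s k)) < e"
    proof (intro bexI allI impI)
      show "v \<in> tuples n V" using l by (auto simp: v_def tuples_def)
      fix e :: real assume e: "e > 0"
      have "\<forall>i<n. eventually (\<lambda>k. Re (ip (l i - s k i) (l i - s k i)) < e / (n + 1)) sequentially"
        using l(2)[of _ "e / (n + 1)"] e unfolding eventually_sequentially by auto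
      then have "eventually (\<lambda>k. \<forall>i\<in>{..<n}. Re (ip (l i - s k i) (l i - s k i)) < e / (n + 1)) sequentially"
        by (subst eventually_ball_finite_distrib) auto
      then obtain k0 where k0: "\<And>k i. k \<ge> k0 \<Longrightarrow> i < n \<Longrightarrow> Re (ip (l i - s k i) (l i - s k i)) < e / (n + 1)"
        unfolding eventually_sequentially by blast
      have "Re (tuple_ip ip n (v - s k) (v - s k)) < e" if "k \<ge> k0" for k
      proof -
        have "Re (tuple_ip ip n (v - s k) (v - s k)) = (\<Sum>i<n. Re (ip (l i - s k i) (l i - s k i)))"
          by (simp add: tuple_ip_def v_def)
        also have "\<dots> \<le> (\<Sum>i<n. e / (n + 1))"
          using k0[OF that] by (intro sum_mono) (auto intro: less_imp_le)
        also have "\<dots> < e" using e by (simp add: field_simps)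
        finally show ?thesis .
      qed
      then show "\<exists>k0. \<forall>k\<ge>k0. Re (tuple_ip ip n (v - s k) (v - s k)) < e" by blast
    qed
  next
    fix u v w assume m: "u \<in> tuples n V" "v \<in> tuples n V" "w \<in> tuples n V"
    show "tuple_ip ip n (u + v) w = tuple_ip ip n u w + tuple_ip ip n v w"
      unfolding tuple_ip_def sum.distrib[symmetric]
      by (rule sum.cong) (simp_all add: ip_add_left[OF mem[OF m(1)] mem[OF m(2)] mem[OF m(3)]])
  next
    fix c v w assume m: "v \<in> tuples n V" "w \<in> tuples n V"
    show "tuple_ip ip n (c *\<^sub>C v) w = c * tuple_ip ip n v w"
      unfolding tuple_ip_def sum_distrib_left
      by (rule sum.cong) (simp_all add: ip_scale_left[OF mem[OF m(1)] mem[OF m(2)]])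
    show "tuple_ip ip n v w = cnj (tuple_ip ip n w v)"
      unfolding tuple_ip_def cnj_sum
      by (rule sum.cong) (simp_all add: ip_commute[OF mem[OF m(1)] mem[OF m(2)], symmetric])
  qed
qed


section \<open>Adjoints\<close>

lemma bounded_linear_app: "bounded_linear (app T)"
  using app[of T] by simp

lemma app_scaleC: "app T (c *\<^sub>C x) = c *\<^sub>C app T x"
  using app[of T] by simp

lemma app_add: "app T (x + y) = app T x + app T y"
  by (rule linear_add[OF bounded_linear.linear[OF bounded_linear_app]])

lemma app_diff: "app T (x - y) = app T x - app T y"
  by (rule linear_diff[OF bounded_linear.linear[OF bounded_linear_app]])

lemma app_0 [simp]: "app T 0 = 0"
  by (rule linear_0[OF bounded_linear.linear[OF bounded_linear_app]])

lemma app_sum: "app T (\<Sum>i\<in>A. f i) = (\<Sum>i\<in>A. app T (f i))"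
  by (rule linear_sum[OF bounded_linear.linear[OF bounded_linear_app]])

lemma app_plus [simp]: "app (S + T) x = app S x + app T x" by transfer simp
lemma app_minus [simp]: "app (S - T) x = app S x - app T x" by transfer simp
lemma app_times [simp]: "app (S * T) x = app S (app T x)" by transfer simp
lemma app_zero [simp]: "app 0 x = 0" by transfer simp
lemma app_one [simp]: "app 1 x = x" by transfer simp
lemma app_scale [simp]: "app (c *\<^sub>C T) x = c *\<^sub>C app T x" by transfer simp

lemma app_sum_left: "app (\<Sum>i\<in>A. F i) x = (\<Sum>i\<in>A. app (F i) x)"
  by (induction A rule: infinite_finite_induct) auto

lemma cbop_eqI: "(\<And>x. app S x = app T x) \<Longrightarrow> S = T"
  by (simp add: app_inject[symmetric] fun_eq_iff)

lemma app_Cbop: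
  assumes "\<And>x y. f (x + y) = f x + f y" "\<And>c x. f (c *\<^sub>C x) = c *\<^sub>C f x" "\<And>x. norm (f x) \<le> B * norm x"
  shows "app (Cbop f) = f"
proof (rule Cbop_inverse, safe)
  show "bounded_linear f"
    by (rule bounded_linear_intro[of _ B]) (use assms in \<open>auto simp: scaleR_scaleC mult.commute\<close>)
qed (use assms in auto)

lemma app_bound: "\<exists>B>0. \<forall>x. norm (app T x) \<le> B * norm x"
  using bounded_linear.pos_bounded[OF bounded_linear_app[of T]] by (auto simp: mult.commute)

text \<open>The Riesz representation theorem: the kernel of \<open>\<phi>\<close> is a closed subspace, and \<open>\<phi>\<close> is
  represented by a multiple of any nonzero vector orthogonal to it.\<close>

lemma riesz:
  fixes \<phi> :: "'a :: complex_hilbert_space \<Rightarrow> complex"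
  assumes add: "\<And>x y. \<phi> (x + y) = \<phi> x + \<phi> y" and scale: "\<And>c x. \<phi> (c *\<^sub>C x) = c * \<phi> x"
    and bd: "\<And>x. cmod (\<phi> x) \<le> B * norm x"
  shows "\<exists>z. \<forall>x. \<phi> x = cinner x z"
proof (cases "\<forall>x. \<phi> x = 0")
  case True
  then show ?thesis by (intro exI[of _ 0]) simp
next
  case False
  then obtain v where v: "\<phi> v \<noteq> 0" by blast
  interpret hilbert_carrier UNIV "cinner :: 'a \<Rightarrow> 'a \<Rightarrow> complex" by (rule hilbert_carrier_UNIV)
  define K where "K = {x. \<phi> x = 0}"
  have diff: "\<phi> (x - y) = \<phi> x - \<phi> y" for x y
    using add[of x "(-1) *\<^sub>C y"] scale[of "-1" y] by simp
  have K: "csubspace K" using scale[of 0 0] by (auto simp: csubspace_def K_def add scale)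
  have "ip_closure cinner UNIV K \<subseteq> K"
  proof
    fix x assume x: "x \<in> ip_closure cinner UNIV K"
    have "0 < cmod (\<phi> v)" using v by simp
    also have "\<dots> \<le> B * norm v" by (rule bd)
    finally have B: "B \<ge> 0" by (simp add: zero_less_mult_iff)
    have "cmod (\<phi> x) \<le> e" if e: "e > 0" for e
    proof -
      have "e / (B + 1) > 0" using e B by simp
      then obtain w where w: "w \<in> K" "norm (x - w) < e / (B + 1)"
        using x by (auto simp: ip_closure_def cinner_self)
      have "cmod (\<phi> x) = cmod (\<phi> (x - w))" using w by (simp add: diff K_def)
      also have "\<dots> \<le> B * norm (x - w)" by (rule bd)
      also have "\<dots> \<le> B * (e / (B + 1))" using w B by (intro mult_left_mono) auto
      also have "\<dots> \<le> e" using B e by (simp add: field_simps)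
      finally show ?thesis .
    qed
    then have "cmod (\<phi> x) \<le> 0" using field_le_epsilon[of "cmod (\<phi> x)" 0] by simp
    then show "x \<in> K" by (simp add: K_def)
  qed
  note K = K subset_UNIV[of K] this
  define z where "z = v - orth_proj cinner K v"
  have "\<phi> (orth_proj cinner K v) = 0" using orth_proj_mem[OF K, of v] by (simp add: K_def)
  then have pz: "\<phi> z \<noteq> 0" using v by (simp add: z_def diff)
  have oz: "cinner z u = 0" if "u \<in> K" for u
    unfolding z_def using orth_proj_orth[OF K UNIV_I that] .
  have z0: "z \<noteq> 0" using pz scale[of 0 z] by auto
  have "\<phi> x = cinner x ((cnj (\<phi> z) / of_real ((norm z)\<^sup>2)) *\<^sub>C z)" for x
  proof -
    have "x - (\<phi> x / \<phi> z) *\<^sub>C z \<in> K" using pz by (simp add: K_def diff scale)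
    then have "cinner (x - (\<phi> x / \<phi> z) *\<^sub>C z) z = 0"
      using oz cinner_commute[of _ z] by simp
    then have "cinner x z = (\<phi> x / \<phi> z) * of_real ((norm z)\<^sup>2)"
      by (simp add: cinner_diff_left cinner_scaleC_left cinner_self)
    then show ?thesis using pz z0 by (simp add: cinner_scaleC_right)
  qed
  then show ?thesis by blast
qed

lemma adjoint_exists: "\<exists>S. \<forall>x y. cinner (app T x) y = cinner x (app S y)"
proof -
  obtain B where B: "B > 0" "\<And>x. norm (app T x) \<le> B * norm x" using app_bound by blast
  have "\<exists>z. \<forall>x. cinner (app T x) y = cinner x z" for y
  proof (rule riesz)
    show "cmod (cinner (app T x) y) \<le> (B * norm y) * norm x" for x
      using norm_cinner_le[of "app T x" y] mult_right_mono[OF B(2)[of x], of "norm y"]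
      by (simp add: mult_ac)
  qed (simp_all add: app_add app_scaleC cinner_add_left cinner_scaleC_left)
  then obtain f where f: "\<And>x y. cinner (app T x) y = cinner x (f y)" by metis
  have ext: "a = b" if "\<And>x. cinner x a = cinner x b" for a b :: 'a
  proof (rule cinner_eqI)
    show "cinner a z = cinner b z" for z
      by (subst (1 2) cinner_commute) (simp add: that)
  qed
  have "app (Cbop f) = f"
  proof (rule app_Cbop)
    show "f (x + y) = f x + f y" for x y
      by (rule ext) (simp add: f[symmetric] cinner_add_right)
    show "f (c *\<^sub>C x) = c *\<^sub>C f x" for c x
      by (rule ext) (simp add: f[symmetric] cinner_scaleC_right)
    show "norm (f x) \<le> B * norm x" for x
    proof (cases "f x = 0")
      case False
      have "(norm (f x))\<^sup>2 = cmod (cinner (app T (f x)) x)"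
        by (simp add: f cinner_self norm_power)
      also have "\<dots> \<le> (B * norm (f x)) * norm x"
        using norm_cinner_le[of "app T (f x)" x] mult_right_mono[OF B(2)[of "f x"], of "norm x"] by simp
      finally show ?thesis using False by (simp add: power2_eq_square)
    qed (use B in simp)
  qed
  then show ?thesis using f by metis
qed

lemma cinner_adj_right: "cinner x (app (adj T) y) = cinner (app T x) y"
proof -
  have "\<exists>!S. \<forall>x y. cinner (app T x) y = cinner x (app S y)"
  proof (rule ex_ex1I[OF adjoint_exists])
    fix S S' assume "\<forall>x y. cinner (app T x) y = cinner x (app S y)"
      "\<forall>x y. cinner (app T x) y = cinner x (app S' y)"
    then have "cinner (app S y) x = cinner (app S' y) x" for x y
      by (subst (1 2) cinner_commute) simp
    then show "S = S'" by (rule cbop_eqI[OF cinner_eqI])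
  qed
  then have "\<forall>x y. cinner (app T x) y = cinner x (app (adj T) y)"
    unfolding adj_def by (rule theI')
  then show ?thesis by (blast intro: sym)
qed

lemma cinner_adj_left: "cinner (app (adj T) x) y = cinner x (app T y)"
  by (subst (1 2) cinner_commute) (simp add: cinner_adj_right)

lemma adj_eqI: "(\<And>x y. cinner (app T x) y = cinner x (app S y)) \<Longrightarrow> adj T = S"
  by (rule cbop_eqI, rule cinner_eqI, subst (1 2) cinner_commute) (simp add: cinner_adj_right)

lemma adj_adj [simp]: "adj (adj T) = T"
  by (rule adj_eqI) (simp add: cinner_adj_left)
lemma adj_times: "adj (S * T) = adj T * adj S"
  by (rule adj_eqI) (simp add: cinner_adj_right)
lemma adj_plus: "adj (S + T) = adj S + adj T"
  by (rule adj_eqI) (simp add: cinner_add_left cinner_add_right cinner_adj_right)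
lemma adj_minus: "adj (S - T) = adj S - adj T"
  by (rule adj_eqI) (simp add: cinner_diff_left cinner_diff_right cinner_adj_right)
lemma adj_scaleC: "adj (c *\<^sub>C T) = cnj c *\<^sub>C adj T"
  by (rule adj_eqI) (simp add: cinner_scaleC_left cinner_scaleC_right cinner_adj_right)
lemma adj_one [simp]: "adj 1 = 1" by (rule adj_eqI) simp
lemma adj_zero [simp]: "adj 0 = 0" by (rule adj_eqI) simp
lemma adj_sum: "adj (\<Sum>i\<in>A. f i) = (\<Sum>i\<in>A. adj (f i))"
  by (induction A rule: infinite_finite_induct) (auto simp: adj_plus)
lemma scaleC_mult_left: "(c *\<^sub>C S) * T = c *\<^sub>C (S * (T :: 'a :: complex_hilbert_space cbop))"
  by (rule cbop_eqI) simp
lemma scaleC_mult_right: "S * (c *\<^sub>C T) = c *\<^sub>C (S * (T :: 'a :: complex_hilbert_space cbop))"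
  by (rule cbop_eqI) (simp add: app_scaleC)

section \<open>Matrices of operators\<close>

text \<open>Entries outside the \<open>N \<times> N\<close> block are \<open>0\<close>. This makes equality of matrices equality of functions, and
  an \<open>N \<times> N\<close> matrix is also a \<open>K \<times> K\<close> matrix for every \<open>K \<ge> N\<close>.\<close>

definition mats :: "nat \<Rightarrow> 'a :: zero set \<Rightarrow> (nat \<Rightarrow> nat \<Rightarrow> 'a) set"
  where "mats N S = {A. (\<forall>i<N. \<forall>j<N. A i j \<in> S) \<and> (\<forall>i j. \<not> (i < N \<and> j < N) \<longrightarrow> A i j = 0)}"

definition mm :: "nat \<Rightarrow> (nat \<Rightarrow> nat \<Rightarrow> 'a :: ring) \<Rightarrow> (nat \<Rightarrow> nat \<Rightarrow> 'a) \<Rightarrow> nat \<Rightarrow> nat \<Rightarrow> 'a"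
  where "mm N A B = (\<lambda>i j. \<Sum>k<N. A i k * B k j)"

definition mone :: "nat \<Rightarrow> nat \<Rightarrow> nat \<Rightarrow> 'a :: complex_hilbert_space cbop"
  where "mone N = (\<lambda>i j. if i = j \<and> i < N then 1 else 0)"

definition madj :: "(nat \<Rightarrow> nat \<Rightarrow> 'a :: complex_hilbert_space cbop) \<Rightarrow> nat \<Rightarrow> nat \<Rightarrow> 'a cbop"
  where "madj A = (\<lambda>i j. adj (A j i))"

lemma mats_entry: "A \<in> mats N S \<Longrightarrow> i < N \<Longrightarrow> j < N \<Longrightarrow> A i j \<in> S"
  and mats_zero: "A \<in> mats N S \<Longrightarrow> \<not> (i < N \<and> j < N) \<Longrightarrow> A i j = 0"
  by (auto simp: mats_def)

lemma mats_eqI: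
  "A \<in> mats N S \<Longrightarrow> B \<in> mats N T \<Longrightarrow> (\<And>i j. i < N \<Longrightarrow> j < N \<Longrightarrow> A i j = B i j) \<Longrightarrow> A = B"
  by (intro ext) (metis mats_zero)

lemma mm_assoc: "mm N (mm N A B) C = mm N A (mm N B C)"
proof (intro ext)
  fix i j
  have "mm N (mm N A B) C i j = (\<Sum>k<N. \<Sum>l<N. A i l * B l k * C k j)"
    by (simp add: mm_def sum_distrib_right)
  also have "\<dots> = (\<Sum>l<N. \<Sum>k<N. A i l * B l k * C k j)" by (rule sum.swap)
  also have "\<dots> = mm N A (mm N B C) i j"
    by (simp add: mm_def sum_distrib_left mult.assoc)
  finally show "mm N (mm N A B) C i j = mm N A (mm N B C) i j" .
qed

lemma mm_diff_left: "mm N (A - B) C = mm N A C - mm N B C"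
  by (simp add: mm_def fun_eq_iff left_diff_distrib sum_subtractf)
lemma mm_diff_right: "mm N A (B - C) = mm N A B - mm N A C"
  by (simp add: mm_def fun_eq_iff right_diff_distrib sum_subtractf)
lemma mm_add_left: "mm N (A + B) C = mm N A C + mm N B C"
  by (simp add: mm_def fun_eq_iff distrib_right sum.distrib)
lemma mm_add_right: "mm N A (B + C) = mm N A B + mm N A C"
  by (simp add: mm_def fun_eq_iff distrib_left sum.distrib)
lemma mm_zero_left [simp]: "mm N 0 A = 0" by (simp add: mm_def fun_eq_iff)
lemma mm_zero_right [simp]: "mm N A 0 = 0" by (simp add: mm_def fun_eq_iff)
lemma mm_scale_left: "mm N (c *\<^sub>C A) B = c *\<^sub>C mm N A (B :: nat \<Rightarrow> nat \<Rightarrow> 'a :: complex_hilbert_space cbop)"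
  by (simp add: mm_def fun_eq_iff scaleC_mult_left scaleC_sum_right)
lemma mm_scale_right: "mm N A (c *\<^sub>C B) = c *\<^sub>C mm N A (B :: nat \<Rightarrow> nat \<Rightarrow> 'a :: complex_hilbert_space cbop)"
  by (simp add: mm_def fun_eq_iff scaleC_mult_right scaleC_sum_right)

lemma mm_one_left: "A \<in> mats N S \<Longrightarrow> mm N (mone N) A = A"
proof (intro ext)
  fix i j assume A: "A \<in> mats N S"
  have "mm N (mone N) A i j = (\<Sum>k<N. if i = k then (if i < N then A i j else 0) else 0)"
    unfolding mm_def mone_def by (rule sum.cong) auto
  then show "mm N (mone N) A i j = A i j" using mats_zero[OF A, of i j] by (simp add: sum.delta)
qed

lemma mm_one_right: "A \<in> mats N S \<Longrightarrow> mm N A (mone N) = A"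
proof (intro ext)
  fix i j assume A: "A \<in> mats N S"
  have "mm N A (mone N) i j = (\<Sum>k<N. if j = k then A i k else 0)"
    unfolding mm_def mone_def by (rule sum.cong) auto
  then show "mm N A (mone N) i j = A i j" using mats_zero[OF A, of i j] by (simp add: sum.delta)
qed

lemma madj_madj [simp]: "madj (madj A) = A" by (simp add: madj_def)
lemma madj_mm: "madj (mm N A B) = mm N (madj B) (madj A)"
  by (simp add: madj_def mm_def adj_sum adj_times)
lemma madj_diff: "madj (A - B) = madj A - madj B"
  by (simp add: madj_def fun_eq_iff adj_minus)
lemma madj_add: "madj (A + B) = madj A + madj B"
  by (simp add: madj_def fun_eq_iff adj_plus)
lemma madj_mone [simp]: "madj (mone N) = mone N"
  by (auto simp: madj_def mone_def fun_eq_iff)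
lemma madj_scale: "madj (c *\<^sub>C A) = cnj c *\<^sub>C madj A"
  by (simp add: madj_def fun_eq_iff adj_scaleC)

lemma mat_app_tuples: "mat_app N A v \<in> tuples N UNIV"
  by (simp add: mat_app_def tuples_def)

lemma mat_app_mm: "mat_app N (mm N A B) v = mat_app N A (mat_app N B v)"
proof
  fix i
  have "(\<Sum>j<N. app (mm N A B i j) (v j)) = (\<Sum>j<N. \<Sum>k<N. app (A i k) (app (B k j) (v j)))"
    by (simp add: mm_def app_sum_left)
  also have "\<dots> = (\<Sum>k<N. \<Sum>j<N. app (A i k) (app (B k j) (v j)))" by (rule sum.swap)
  also have "\<dots> = (\<Sum>k<N. app (A i k) (mat_app N B v k))"
    by (rule sum.cong) (simp_all add: mat_app_def app_sum)
  finally show "mat_app N (mm N A B) v i = mat_app N A (mat_app N B v) i"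
    by (simp add: mat_app_def)
qed

lemma mat_app_diff_mat: "mat_app N (A - B) v = mat_app N A v - mat_app N B v"
  by (simp add: mat_app_def fun_eq_iff sum_subtractf)
lemma mat_app_scale_mat: "mat_app N (c *\<^sub>C A) v = c *\<^sub>C mat_app N A v"
  by (simp add: mat_app_def fun_eq_iff scaleC_sum_right)
lemma mat_app_add: "mat_app N A (v + w) = mat_app N A v + mat_app N A w"
  by (simp add: mat_app_def fun_eq_iff app_add sum.distrib)
lemma mat_app_diff: "mat_app N A (v - w) = mat_app N A v - mat_app N A w"
  by (simp add: mat_app_def fun_eq_iff app_diff sum_subtractf)
lemma mat_app_scale: "mat_app N A (c *\<^sub>C v) = c *\<^sub>C mat_app N A v"
  by (simp add: mat_app_def fun_eq_iff app_scaleC scaleC_sum_right)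
lemma mat_app_0 [simp]: "mat_app N A 0 = 0"
  by (simp add: mat_app_def fun_eq_iff)
lemma mat_app_mone: "v \<in> tuples N UNIV \<Longrightarrow> mat_app N (mone N) v = v"
proof
  fix i assume v: "v \<in> tuples N UNIV"
  have "(\<Sum>j<N. app (mone N i j) (v j)) = (\<Sum>j<N. if i = j then (if i < N then v j else 0) else 0)"
    by (rule sum.cong) (auto simp: mone_def)
  then show "mat_app N (mone N) v i = v i" using v by (auto simp: mat_app_def tuples_def sum.delta)
qed

abbreviation vip :: "nat \<Rightarrow> (nat \<Rightarrow> 'a :: complex_hilbert_space) \<Rightarrow> (nat \<Rightarrow> 'a) \<Rightarrow> complex"
  where "vip N \<equiv> tuple_ip cinner N"

lemma vip_madj: "vip N (mat_app N A v) w = vip N v (mat_app N (madj A) w)"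
proof -
  have "vip N (mat_app N A v) w = (\<Sum>i<N. \<Sum>j<N. cinner (app (A i j) (v j)) (w i))"
    by (simp add: tuple_ip_def mat_app_def cinner_sum_left)
  also have "\<dots> = (\<Sum>j<N. \<Sum>i<N. cinner (app (A i j) (v j)) (w i))" by (rule sum.swap)
  also have "\<dots> = vip N v (mat_app N (madj A) w)"
    by (simp add: tuple_ip_def mat_app_def cinner_sum_right madj_def cinner_adj_right)
  finally show ?thesis .
qed

definition single :: "nat \<Rightarrow> 'a :: zero \<Rightarrow> nat \<Rightarrow> 'a"
  where "single j x = (\<lambda>i. if i = j then x else 0)"

lemma single_tuples: "j < N \<Longrightarrow> single j x \<in> tuples N UNIV"
  by (simp add: single_def tuples_def)

lemma mat_app_single: "j < N \<Longrightarrow> i < N \<Longrightarrow> mat_app N A (single j x) i = app (A i j) x"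
proof -
  assume a: "j < N" "i < N"
  have "(\<Sum>k<N. app (A i k) (single j x k)) = (\<Sum>k<N. if j = k then app (A i k) x else 0)"
    by (rule sum.cong) (auto simp: single_def)
  then show ?thesis using a by (simp add: mat_app_def sum.delta)
qed

lemma vip_single_right: "i < N \<Longrightarrow> vip N v (single i y) = cinner (v i) y"
proof -
  assume a: "i < N"
  have "vip N v (single i y) = (\<Sum>k<N. if i = k then cinner (v k) y else 0)"
    unfolding tuple_ip_def by (rule sum.cong) (auto simp: single_def)
  then show ?thesis using a by (simp add: sum.delta)
qed

lemma vip_single_left: "i < N \<Longrightarrow> vip N (single i y) v = cinner y (v i)"
proof -
  assume a: "i < N"
  have "vip N (single i y) v = (\<Sum>k<N. if i = k then cinner y (v k) else 0)"
    unfolding tuple_ip_def by (rule sum.cong) (auto simp: single_def)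
  then show ?thesis using a by (simp add: sum.delta)
qed

lemma tuple_as_sum: "v \<in> tuples N UNIV \<Longrightarrow> v = (\<Sum>j<N. single j (v j))"
proof
  fix i assume v: "v \<in> tuples N UNIV"
  have "(\<Sum>j<N. single j (v j)) i = (\<Sum>j<N. single j (v j) i)"
    by (induction N) auto
  also have "\<dots> = (\<Sum>j<N. if i = j then v j else 0)"
    by (rule sum.cong) (auto simp: single_def)
  finally show "v i = (\<Sum>j<N. single j (v j)) i" using v by (simp add: sum.delta tuples_def)
qed

lemma mats_eqI_app:
  assumes "A \<in> mats N S" "B \<in> mats N T" "\<And>v. v \<in> tuples N UNIV \<Longrightarrow> mat_app N A v = mat_app N B v"
  shows "A = B"
proof (rule mats_eqI[OF assms(1,2)])
  fix i j assume ij: "i < N" "j < N"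
  show "A i j = B i j"
  proof (rule cbop_eqI)
    fix x
    have "mat_app N A (single j x) i = mat_app N B (single j x) i"
      by (simp add: assms(3)[OF single_tuples[OF ij(2)]])
    then show "app (A i j) x = app (B i j) x" by (simp add: mat_app_single ij)
  qed
qed

lemma vip_bound: "\<exists>C>0. \<forall>v\<in>tuples N UNIV. Re (vip N (mat_app N A v) (mat_app N A v)) \<le> C * Re (vip N v v)"
proof -
  have "\<forall>i j. \<exists>B>0. \<forall>x. norm (app (A i j) x) \<le> B * norm x" using app_bound by blast
  then obtain B where B: "\<And>i j. B i j > 0" "\<And>i j x. norm (app (A i j) x) \<le> B i j * norm x" by metis
  define b where "b = (\<Sum>i<N. \<Sum>j<N. B i j)"
  have Re_vip: "Re (vip N v v) = (\<Sum>i<N. (norm (v i))\<^sup>2)" for v :: "nat \<Rightarrow> 'a"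
    by (simp add: tuple_ip_def cinner_self)
  have "Re (vip N (mat_app N A v) (mat_app N A v)) \<le> (N * b\<^sup>2 + 1) * Re (vip N v v)"
    if v: "v \<in> tuples N UNIV" for v
  proof -
    let ?n = "sqrt (Re (vip N v v))"
    have n0: "0 \<le> Re (vip N v v)" by (simp add: Re_vip sum_nonneg)
    have vj: "norm (v j) \<le> ?n" if "j < N" for j
    proof -
      have "(\<Sum>j\<in>{j}. (norm (v j))\<^sup>2) \<le> (\<Sum>i<N. (norm (v i))\<^sup>2)"
        by (rule sum_mono2) (use that in auto)
      then show ?thesis by (simp add: Re_vip real_le_rsqrt)
    qed
    have "norm (mat_app N A v i) \<le> b * ?n" if i: "i < N" for i
    proof -
      have "norm (mat_app N A v i) \<le> (\<Sum>j<N. norm (app (A i j) (v j)))"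
        using i by (simp add: mat_app_def norm_sum)
      also have "\<dots> \<le> (\<Sum>j<N. B i j * ?n)"
      proof (rule sum_mono)
        fix j assume "j \<in> {..<N}"
        then have "B i j * norm (v j) \<le> B i j * ?n"
          using vj B(1)[of i j] by (intro mult_left_mono) auto
        then show "norm (app (A i j) (v j)) \<le> B i j * ?n" using B(2)[of i j "v j"] by simp
      qed
      also have "\<dots> = (\<Sum>i\<in>{i}. \<Sum>j<N. B i j) * ?n" by (simp add: sum_distrib_right)
      also have "\<dots> \<le> b * ?n" unfolding b_def
        by (intro mult_right_mono sum_mono2 sum_nonneg) (use i B(1) n0 in \<open>auto intro: less_imp_le\<close>)
      finally show ?thesis .
    qed
    then have "(\<Sum>i<N. (norm (mat_app N A v i))\<^sup>2) \<le> (\<Sum>i<N. (b * ?n)\<^sup>2)"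
      by (intro sum_mono power_mono) auto
    also have "\<dots> = (N * b\<^sup>2) * Re (vip N v v)" using n0 by (simp add: power_mult_distrib)
    also have "\<dots> \<le> (N * b\<^sup>2 + 1) * Re (vip N v v)" using n0 by (intro mult_right_mono) auto
    finally show ?thesis by (simp only: Re_vip[symmetric])
  qed
  moreover have "N * b\<^sup>2 + 1 > 0" by (simp add: add_nonneg_pos)
  ultimately show ?thesis by blast
qed


section \<open>Range projections over a von Neumann algebra\<close>

lemma von_neumann_closed:
  assumes "von_neumann_algebra M"
  shows vn_adj: "x \<in> M \<Longrightarrow> adj x \<in> M"
    and vn_one: "1 \<in> M" and vn_zero: "0 \<in> M"
    and vn_times: "x \<in> M \<Longrightarrow> y \<in> M \<Longrightarrow> x * y \<in> M"
    and vn_plus: "x \<in> M \<Longrightarrow> y \<in> M \<Longrightarrow> x + y \<in> M"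
    and vn_minus: "x \<in> M \<Longrightarrow> y \<in> M \<Longrightarrow> x - y \<in> M"
    and vn_scale: "x \<in> M \<Longrightarrow> c *\<^sub>C x \<in> M"
proof -
  have M: "x \<in> M \<longleftrightarrow> (\<forall>s\<in>commutant M. s * x = x * s)" for x
    using assms unfolding von_neumann_algebra_def commutant_def by blast
  show "x \<in> M \<Longrightarrow> adj x \<in> M" using assms by (simp add: von_neumann_algebra_def)
  show "1 \<in> M" "0 \<in> M" by (simp_all add: M)
  show "x \<in> M \<Longrightarrow> y \<in> M \<Longrightarrow> x * y \<in> M" by (simp add: M) (metis mult.assoc)
  show "x \<in> M \<Longrightarrow> y \<in> M \<Longrightarrow> x + y \<in> M" "x \<in> M \<Longrightarrow> y \<in> M \<Longrightarrow> x - y \<in> M"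
    by (simp_all add: M algebra_simps)
  show "x \<in> M \<Longrightarrow> c *\<^sub>C x \<in> M" by (simp add: M scaleC_mult_left scaleC_mult_right)
qed

locale von_neumann =
  fixes M :: "'h :: complex_hilbert_space cbop set"
  assumes vN: "von_neumann_algebra M"
begin

lemmas adj_M = vn_adj[OF vN] and one_M = vn_one[OF vN] and zero_M = vn_zero[OF vN]
  and times_M = vn_times[OF vN] and plus_M = vn_plus[OF vN] and minus_M = vn_minus[OF vN]
  and scale_M = vn_scale[OF vN]

lemma sum_M: "(\<And>i. i \<in> A \<Longrightarrow> f i \<in> M) \<Longrightarrow> (\<Sum>i\<in>A. f i) \<in> M"
  by (induction A rule: infinite_finite_induct) (auto simp: zero_M plus_M)

lemma mm_mats: "A \<in> mats N M \<Longrightarrow> B \<in> mats N M \<Longrightarrow> mm N A B \<in> mats N M"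
  unfolding mats_def mm_def by (auto intro!: sum_M times_M sum.neutral)
lemma madj_mats: "A \<in> mats N M \<Longrightarrow> madj A \<in> mats N M"
  by (auto simp: mats_def madj_def adj_M)
lemma mone_mats: "mone N \<in> mats N M"
  by (auto simp: mats_def mone_def one_M zero_M)
lemma diff_mats: "A \<in> mats N M \<Longrightarrow> B \<in> mats N M \<Longrightarrow> A - B \<in> mats N M"
  by (auto simp: mats_def minus_M)
lemma add_mats: "A \<in> mats N M \<Longrightarrow> B \<in> mats N M \<Longrightarrow> A + B \<in> mats N M"
  by (auto simp: mats_def plus_M)
lemma scale_mats: "A \<in> mats N M \<Longrightarrow> c *\<^sub>C A \<in> mats N M"
  by (auto simp: mats_def scale_M)

abbreviation range_closure :: "nat \<Rightarrow> (nat \<Rightarrow> nat \<Rightarrow> 'h cbop) \<Rightarrow> (nat \<Rightarrow> 'h) set"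
  where "range_closure N Q \<equiv> ip_closure (vip N) (tuples N UNIV) (mat_app N Q ` tuples N UNIV)"

lemma hilbert_tuples: "hilbert_carrier (tuples N (UNIV :: 'h set)) (vip N)"
  by (rule hilbert_carrier_tuples[OF hilbert_carrier_UNIV])

lemma range_closure_props:
  shows "csubspace (range_closure N Q)" "range_closure N Q \<subseteq> tuples N UNIV"
    "ip_closure (vip N) (tuples N UNIV) (range_closure N Q) \<subseteq> range_closure N Q"
proof -
  interpret hilbert_carrier "tuples N (UNIV :: 'h set)" "vip N" by (rule hilbert_tuples)
  let ?R = "mat_app N Q ` tuples N UNIV"
  have R: "?R \<subseteq> tuples N UNIV" using mat_app_tuples by blast
  have "csubspace ?R" unfolding csubspace_def
  proof (intro conjI ballI allI)
    show "0 \<in> ?R" by (rule image_eqI[of _ _ 0]) (use zero_mem in auto)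
    fix v assume "v \<in> ?R"
    then obtain a where a: "v = mat_app N Q a" "a \<in> tuples N UNIV" by blast
    show "c *\<^sub>C v \<in> ?R" for c
      by (rule image_eqI[of _ _ "c *\<^sub>C a"]) (use a in \<open>auto simp: mat_app_scale scale_mem\<close>)
    fix w assume "w \<in> ?R"
    then obtain b where b: "w = mat_app N Q b" "b \<in> tuples N UNIV" by blast
    show "v + w \<in> ?R"
      by (rule image_eqI[of _ _ "a + b"]) (use a b in \<open>auto simp: mat_app_add add_mem\<close>)
  qed
  then show "csubspace (range_closure N Q)" by (rule closure_csubspace[OF _ R])
  show "range_closure N Q \<subseteq> tuples N UNIV" by (rule closure_subset_carrier)
  show "ip_closure (vip N) (tuples N UNIV) (range_closure N Q) \<subseteq> range_closure N Q"
    by (rule closure_closed[OF R])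
qed

lemma commutant_adj: "s \<in> commutant M \<Longrightarrow> adj s \<in> commutant M"
  using adj_M by (auto simp: commutant_def) (metis adj_adj adj_times)

lemma mat_app_commute:
  assumes "Q \<in> mats N M" "s \<in> commutant M"
  shows "mat_app N Q (\<lambda>i. app s (v i)) = (\<lambda>i. app s (mat_app N Q v i))"
proof
  fix i
  have "app (Q i j) (app s (v j)) = app s (app (Q i j) (v j))" if "i < N" "j < N" for j
    using mats_entry[OF assms(1) that] assms(2) unfolding commutant_def 
    by (metis (mono_tags, lifting) app_times mem_Collect_eq)
  then show "mat_app N Q (\<lambda>i. app s (v i)) i = app s (mat_app N Q v i)"
    by (auto simp: mat_app_def app_sum intro!: sum.cong)
qed

text \<open>The closure of the range of \<open>Q\<close> is invariant under the diagonal action of the commutant of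
  \<open>M\<close>, so the projection onto it commutes with that action; by the double commutant property its
  entries lie in \<open>M\<close>.\<close>

lemma range_proj_spec:
  assumes Q: "Q \<in> mats N M"
  shows range_proj_mats: "range_proj N Q \<in> mats N M"
    and range_proj_app: "v \<in> tuples N UNIV \<Longrightarrow>
      mat_app N (range_proj N Q) v = orth_proj (vip N) (range_closure N Q) v"
proof -
  interpret hilbert_carrier "tuples N (UNIV :: 'h set)" "vip N" by (rule hilbert_tuples)
  let ?K = "range_closure N Q" and ?R = "mat_app N Q ` tuples N UNIV"
  let ?P = "orth_proj (vip N) ?K"
  note K = range_closure_props[of N Q]
  have R: "?R \<subseteq> tuples N UNIV" using mat_app_tuples by blast
  have Pm: "?P v \<in> tuples N UNIV" if "v \<in> tuples N UNIV" for v
    using orth_proj_mem[OF K that] K(2) by blast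
  define p where "p = (\<lambda>i j. if i < N \<and> j < N then Cbop (\<lambda>x. ?P (single j x) i) else 0)"
  have single_add: "single j (x + y) = single j x + single j y"
    and single_scale: "single j (c *\<^sub>C x) = c *\<^sub>C single j x" for j c and x y :: 'h
    by (auto simp: single_def fun_eq_iff)
  have papp: "app (p i j) x = ?P (single j x) i" if ij: "i < N" "j < N" for i j x
  proof -
    have "app (Cbop (\<lambda>x. ?P (single j x) i)) = (\<lambda>x. ?P (single j x) i)"
    proof (rule app_Cbop[of _ 1])
      show "?P (single j (x + y)) i = ?P (single j x) i + ?P (single j y) i" for x y
        by (simp add: single_add orth_proj_add[OF K single_tuples[OF ij(2)] single_tuples[OF ij(2)]])
      show "?P (single j (c *\<^sub>C x)) i = c *\<^sub>C ?P (single j x) i" for c x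
        by (simp add: single_scale orth_proj_scale[OF K single_tuples[OF ij(2)]])
      fix x
      have "(\<Sum>i\<in>{i}. (norm (?P (single j x) i))\<^sup>2) \<le> (\<Sum>k<N. (norm (?P (single j x) k))\<^sup>2)"
        by (rule sum_mono2) (use ij in auto)
      also have "\<dots> = Re (vip N (?P (single j x)) (?P (single j x)))"
        by (simp add: tuple_ip_def cinner_self)
      also have "\<dots> \<le> Re (vip N (single j x) (single j x))"
        by (rule orth_proj_contraction[OF K single_tuples[OF ij(2)]])
      also have "\<dots> = (norm x)\<^sup>2"
        unfolding vip_single_right[OF ij(2)] by (simp add: single_def cinner_self)
      finally show "norm (?P (single j x) i) \<le> 1 * norm x" by (simp add: power2_le_iff_abs_le)
    qed
    then show ?thesis using ij by (simp add: p_def)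
  qed
  have P_sum: "?P (\<Sum>j<m. single j (v j)) = (\<Sum>j<m. ?P (single j (v j)))" if "m \<le> N" for m v
    using that
  proof (induction m)
    case 0
    have "?P 0 = 0" using orth_proj_fix[OF K(1,2)] csubspace_0[OF K(1)] by blast
    then show ?case by (simp add: zero_fun_def)
  next
    case (Suc m)
    have "(\<Sum>j<m. single j (v j)) \<in> tuples N UNIV"
      by (rule csubspace_sum[OF sub]) (use Suc in \<open>auto intro!: single_tuples\<close>)
    then show ?case
      using Suc single_tuples[of m N "v m"]
      by (simp only: sum.lessThan_Suc orth_proj_add[OF K] Suc_leD Suc_le_lessD)
  qed
  have sum_fun: "(\<Sum>j<m. f j) i = (\<Sum>j<m. f j i)" for m i and f :: "nat \<Rightarrow> nat \<Rightarrow> 'h"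
    by (induction m) auto
  have pP: "mat_app N p v = ?P v" if v: "v \<in> tuples N UNIV" for v
  proof
    fix i
    show "mat_app N p v i = ?P v i"
    proof (cases "i < N")
      case True
      have "?P v i = ?P (\<Sum>j<N. single j (v j)) i" using tuple_as_sum[OF v] by simp
      also have "\<dots> = (\<Sum>j<N. ?P (single j (v j)) i)" by (simp add: P_sum sum_fun)
      finally show ?thesis using True by (simp add: mat_app_def papp)
    next
      case False
      then show ?thesis using Pm[OF v] by (simp add: mat_app_def tuples_def)
    qed
  qed
  have pM: "p i j \<in> M" if ij: "i < N" "j < N" for i j
  proof -
    have "p i j \<in> commutant (commutant M)" unfolding commutant_def[of "commutant M"]
    proof (intro CollectI ballI cbop_eqI)
      fix s x assume s: "s \<in> commutant M"
      let ?S = "\<lambda>s (v :: nat \<Rightarrow> 'h) i. app s (v i)"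
      have St: "?S s v \<in> tuples N UNIV" if "v \<in> tuples N UNIV" for s v
        using that by (simp add: tuples_def)
      have Sdiff: "?S s (v - w) = ?S s v - ?S s w" for s v w
        by (simp add: fun_eq_iff app_diff)
      have SK: "?S s v \<in> ?K" if s: "s \<in> commutant M" and v: "v \<in> ?K" for s v
      proof -
        obtain B where B: "B > 0" "\<And>x. norm (app s x) \<le> B * norm x" using app_bound by blast
        have vt: "v \<in> tuples N UNIV" using v K by blast
        have "\<exists>w\<in>?R. Re (vip N (?S s v - w) (?S s v - w)) < e" if e: "e > 0" for e
        proof -
          have "e / B\<^sup>2 > 0" using e B by simp
          then obtain w where w: "w \<in> ?R" "Re (vip N (v - w) (v - w)) < e / B\<^sup>2"
            using v unfolding ip_closure_alt[OF R] by blast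
          obtain a where a: "w = mat_app N Q a" "a \<in> tuples N UNIV" using w by blast
          have "?S s w = mat_app N Q (?S s a)" using mat_app_commute[OF Q s] a by simp
          then have "?S s w \<in> ?R" using St[OF a(2)] by blast
          moreover have "Re (vip N (?S s v - ?S s w) (?S s v - ?S s w)) = (\<Sum>i<N. (norm (app s ((v - w) i)))\<^sup>2)"
            by (simp add: tuple_ip_def cinner_self app_diff)
          moreover have "\<dots> \<le> (\<Sum>i<N. (B * norm ((v - w) i))\<^sup>2)"
            by (intro sum_mono power_mono B) auto
          moreover have "\<dots> = B\<^sup>2 * Re (vip N (v - w) (v - w))"
            by (simp add: tuple_ip_def cinner_self sum_distrib_left power_mult_distrib)
          moreover have "\<dots> < e" using w B by (simp add: field_simps)
          ultimately show ?thesis by (intro bexI[of _ "?S s w"]) linarith+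
        qed
        then show ?thesis using St[OF vt] by (simp add: ip_closure_alt[OF R])
      qed
      have "?P (?S s (single j x)) = ?S s (?P (single j x))"
      proof (rule orth_proj_unique[OF K(1,2)])
        have t: "single j x \<in> tuples N UNIV" by (rule single_tuples[OF ij(2)])
        show "?S s (single j x) \<in> tuples N UNIV" by (rule St[OF t])
        show "?S s (?P (single j x)) \<in> ?K" by (rule SK[OF s orth_proj_mem[OF K t]])
        fix u assume u: "u \<in> ?K"
        have "vip N (?S s (single j x) - ?S s (?P (single j x))) u = vip N (single j x - ?P (single j x)) (?S (adj s) u)"
          unfolding tuple_ip_def 
          by (rule sum.cong) (simp_all add: cinner_adj_right app_diff)
        also have "\<dots> = 0" by (rule orth_proj_orth[OF K t SK[OF commutant_adj[OF s] u]])
        finally show "vip N (?S s (single j x) - ?S s (?P (single j x))) u = 0" .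
      qed
      moreover have "?S s (single j x) = single j (app s x)" by (simp add: single_def fun_eq_iff)
      ultimately have "?P (single j (app s x)) i = app s (?P (single j x) i)" by metis
      then show "app (s * p i j) x = app (p i j * s) x" by (simp add: papp[OF ij])
    qed
    then show ?thesis using vN by (simp add: von_neumann_algebra_def)
  qed
  have pmats: "p \<in> mats N M" using pM by (auto simp: mats_def p_def)
  have "range_proj N Q = p"
    unfolding range_proj_def
  proof (rule the_equality)
    show "(\<forall>i j. \<not> (i < N \<and> j < N) \<longrightarrow> p i j = 0) \<and> (\<forall>v\<in>tuples N UNIV. mat_app N p v = ?P v)"
      using pP by (auto simp: p_def)
    fix p' assume p': "(\<forall>i j. \<not> (i < N \<and> j < N) \<longrightarrow> p' i j = 0) \<and> (\<forall>v\<in>tuples N UNIV. mat_app N p' v = ?P v)"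
    then have "p' \<in> mats N UNIV" by (auto simp: mats_def)
    then show "p' = p" by (rule mats_eqI_app[OF _ pmats]) (use p' pP in auto)
  qed
  then show "range_proj N Q \<in> mats N M" 
    "v \<in> tuples N UNIV \<Longrightarrow> mat_app N (range_proj N Q) v = orth_proj (vip N) (range_closure N Q) v"
    using pmats pP by auto
qed

lemma range_proj_self_adjoint:
  assumes Q: "Q \<in> mats N M"
  shows "madj (range_proj N Q) = range_proj N Q"
proof -
  interpret hilbert_carrier "tuples N (UNIV :: 'h set)" "vip N" by (rule hilbert_tuples)
  note K = range_closure_props[of N Q]
  let ?p = "range_proj N Q"
  show ?thesis
  proof (rule mats_eqI[OF madj_mats range_proj_mats, OF range_proj_mats, OF Q Q])
    fix i j assume ij: "i < N" "j < N"
    show "madj ?p i j = ?p i j" unfolding madj_def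
    proof (rule adj_eqI)
      fix x y
      have "vip N (mat_app N ?p (single i x)) (single j y) = vip N (single i x) (mat_app N ?p (single j y))"
        using ij by (simp add: range_proj_app[OF Q] single_tuples orth_proj_self_adjoint[OF K])
      then show "cinner (app (?p j i) x) y = cinner x (app (?p i j) y)"
        using ij by (simp add: vip_single_left vip_single_right mat_app_single)
    qed
  qed
qed

lemma range_proj_idem:
  assumes Q: "Q \<in> mats N M"
  shows "mm N (range_proj N Q) (range_proj N Q) = range_proj N Q"
proof (rule mats_eqI_app[OF mm_mats range_proj_mats, OF range_proj_mats range_proj_mats, OF Q Q Q])
  interpret hilbert_carrier "tuples N (UNIV :: 'h set)" "vip N" by (rule hilbert_tuples)
  note K = range_closure_props[of N Q]
  fix v :: "nat \<Rightarrow> 'h" assume v: "v \<in> tuples N UNIV"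
  have "orth_proj (vip N) (range_closure N Q) v \<in> tuples N UNIV" using orth_proj_mem[OF K v] K by blast
  then show "mat_app N (mm N (range_proj N Q) (range_proj N Q)) v = mat_app N (range_proj N Q) v"
    using v by (simp add: mat_app_mm range_proj_app[OF Q] orth_proj_fix[OF K(1,2) orth_proj_mem[OF K]])
qed

lemma range_proj_mult:
  assumes Q: "Q \<in> mats N M"
  shows "mm N (range_proj N Q) Q = Q"
proof (rule mats_eqI_app[OF mm_mats, OF range_proj_mats, OF Q Q Q])
  interpret hilbert_carrier "tuples N (UNIV :: 'h set)" "vip N" by (rule hilbert_tuples)
  note K = range_closure_props[of N Q]
  fix v :: "nat \<Rightarrow> 'h" assume v: "v \<in> tuples N UNIV"
  have "mat_app N Q v \<in> range_closure N Q"
    using subset_closure[of "mat_app N Q ` tuples N UNIV"] mat_app_tuples v by blast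
  then show "mat_app N (mm N (range_proj N Q) Q) v = mat_app N Q v"
    by (simp add: mat_app_mm range_proj_app[OF Q] mat_app_tuples orth_proj_fix[OF K(1,2)])
qed

lemma range_proj_annihilates:
  assumes Q: "Q \<in> mats N M" and v: "v \<in> tuples N UNIV" and z: "mat_app N (madj Q) v = 0"
  shows "mat_app N (range_proj N Q) v = 0"
proof -
  interpret hilbert_carrier "tuples N (UNIV :: 'h set)" "vip N" by (rule hilbert_tuples)
  note K = range_closure_props[of N Q]
  have "vip N v w = 0" if "w \<in> mat_app N Q ` tuples N UNIV" for w
  proof -
    obtain a where a: "w = mat_app N Q a" "a \<in> tuples N UNIV" using \<open>w \<in> _\<close> by blast
    have "vip N v w = vip N (mat_app N (madj Q) v) a" using vip_madj[of N "madj Q" v a] a by simp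
    also have "\<dots> = 0" unfolding z using ip_zero_left[OF a(2)] .
    finally show ?thesis .
  qed
  then have o: "vip N v w = 0" if "w \<in> range_closure N Q" for w
    using orth_closure[OF _ v _ that] mat_app_tuples by blast
  show ?thesis unfolding range_proj_app[OF Q v]
    by (rule orth_proj_unique[OF K(1,2) v csubspace_0[OF K(1)]]) (simp add: o)
qed

text \<open>Applying the operators \<open>f\<^sub>i\<close> to a vector \<open>x\<close> turns the column \<open>f\<close> into a vector of \<open>H\<^sup>N\<close>.\<close>

lemma range_proj_annihilates_column:
  assumes Q: "Q \<in> mats N M" and z: "\<And>k. k < N \<Longrightarrow> (\<Sum>i<N. adj (Q i k) * f i) = 0" and i: "i < N"
  shows "(\<Sum>k<N. range_proj N Q i k * f k) = 0"
proof (rule cbop_eqI)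
  fix x
  define v where "v = (\<lambda>i. if i < N then app (f i) x else 0)"
  have v: "v \<in> tuples N UNIV" by (simp add: v_def tuples_def)
  have "mat_app N (madj Q) v = 0"
  proof
    fix k
    show "mat_app N (madj Q) v k = 0 k"
      using arg_cong[OF z[of k], of "\<lambda>T. app T x"]
      by (auto simp: mat_app_def madj_def v_def app_sum_left)
  qed
  from range_proj_annihilates[OF Q v this] have "mat_app N (range_proj N Q) v i = 0" by simp
  then show "app (\<Sum>k<N. range_proj N Q i k * f k) x = app 0 x"
    using i by (simp add: mat_app_def v_def app_sum_left)
qed

lemma range_proj_annihilates_mat:
  assumes Q: "Q \<in> mats N M" and R: "mm N (madj Q) R = 0"
  shows "mm N (range_proj N Q) R = 0"
proof (intro ext)
  fix i j
  show "mm N (range_proj N Q) R i j = 0 i j"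
  proof (cases "i < N")
    case True
    have "(\<Sum>i<N. adj (Q i k) * R i j) = 0" for k
      using fun_cong[OF fun_cong[OF R], of k j] by (simp add: mm_def madj_def)
    from range_proj_annihilates_column[OF Q this True] show ?thesis by (simp add: mm_def)
  next
    case False
    then show ?thesis using mats_zero[OF range_proj_mats[OF Q], of i] by (simp add: mm_def)
  qed
qed

end

section \<open>The trace of the range projection\<close>

lemma positive_iff: "positive T \<longleftrightarrow> (\<forall>x. 0 \<le> Re (cinner (app T x) x) \<and> Im (cinner (app T x) x) = 0)"
  by (simp add: positive_def complex_nonneg_Reals_iff)

lemma positive_diff_iff:
  assumes "adj S = S" "adj T = T"
  shows "positive (S - T) \<longleftrightarrow> (\<forall>x. Re (cinner (app T x) x) \<le> Re (cinner (app S x) x))"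
proof -
  have "Im (cinner (app (S - T) x) x) = 0" for x
  proof -
    have "cinner (app (S - T) x) x = cinner x (app (S - T) x)"
      using cinner_adj_right[of x "S - T" x] by (simp add: adj_minus assms)
    also have "\<dots> = cnj (cinner (app (S - T) x) x)" by (rule cinner_commute)
    finally show ?thesis by (simp add: complex_eq_iff)
  qed
  then show ?thesis by (simp add: positive_iff cinner_diff_left)
qed

definition trN :: "('a \<Rightarrow> complex) \<Rightarrow> nat \<Rightarrow> (nat \<Rightarrow> nat \<Rightarrow> 'a) \<Rightarrow> complex"
  where "trN \<tau> N A = (\<Sum>i<N. \<tau> (A i i))"

fun mpow :: "nat \<Rightarrow> (nat \<Rightarrow> nat \<Rightarrow> 'a :: complex_hilbert_space cbop) \<Rightarrow> nat \<Rightarrow> nat \<Rightarrow> nat \<Rightarrow> 'a cbop"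
  where "mpow N B 0 = mone N" | "mpow N B (Suc k) = mm N (mpow N B k) B"

locale tracial = 
  fixes M :: "'h :: complex_hilbert_space cbop set" and \<tau> :: "'h cbop \<Rightarrow> complex"
  assumes tracial: "tracial_wstar_space M \<tau>"

sublocale tracial \<subseteq> von_neumann M
  using tracial by unfold_locales (simp add: tracial_wstar_space_def)

context tracial
begin

lemma tau_add: "x \<in> M \<Longrightarrow> y \<in> M \<Longrightarrow> \<tau> (x + y) = \<tau> x + \<tau> y"
  and tau_scale: "x \<in> M \<Longrightarrow> \<tau> (c *\<^sub>C x) = c * \<tau> x"
  and tau_one: "\<tau> 1 = 1"
  and tau_nonneg: "x \<in> M \<Longrightarrow> \<tau> (adj x * x) \<in> \<real>\<^sub>\<ge>\<^sub>0"
  and tau_trace: "x \<in> M \<Longrightarrow> y \<in> M \<Longrightarrow> \<tau> (x * y) = \<tau> (y * x)"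
  and tau_faithful: "x \<in> M \<Longrightarrow> \<tau> (adj x * x) = 0 \<Longrightarrow> x = 0"
  and tau_normal: "normal_on M \<tau>"
  using tracial unfolding tracial_wstar_space_def by blast+

lemma tau_zero: "\<tau> 0 = 0" using tau_scale[OF zero_M, of 0] by simp
lemma tau_diff: "x \<in> M \<Longrightarrow> y \<in> M \<Longrightarrow> \<tau> (x - y) = \<tau> x - \<tau> y"
  using tau_add[of x "(-1) *\<^sub>C y"] tau_scale[of y "-1"] scale_M[of y "-1"] by simp
lemma tau_sum: "(\<And>i. i \<in> A \<Longrightarrow> f i \<in> M) \<Longrightarrow> \<tau> (\<Sum>i\<in>A. f i) = (\<Sum>i\<in>A. \<tau> (f i))"
proof (induction A rule: infinite_finite_induct)
  case (insert a A)
  then show ?case using tau_add[of "f a" "sum f A"] sum_M[of A f] by simp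
qed (simp_all add: tau_zero)

text \<open>Applied to a two-element chain, normality says that \<open>\<tau>\<close> is monotone for the operator
  order.\<close>

lemma tau_mono:
  assumes "d \<in> M" "s \<in> M" "positive d" "positive (s - d)"
  shows "Re (\<tau> d) \<le> Re (\<tau> s)"
proof -
  have p0: "positive (0 :: 'h cbop)" by (simp add: positive_iff)
  have ps: "positive s"
    using assms(3,4) by (simp add: positive_iff cinner_diff_left) (blast intro: order_trans)
  have "Re (\<tau> s) = (SUP d\<in>{d, s}. Re (\<tau> d))"
    by (rule tau_normal[unfolded normal_on_def, rule_format]) (use assms ps p0 in auto)
  also have "\<dots> = max (Re (\<tau> d)) (Re (\<tau> s))" by (simp add: cSup_insert sup_max)
  finally show ?thesis by simp
qed

lemma tau_positive: "s \<in> M \<Longrightarrow> positive s \<Longrightarrow> 0 \<le> Re (\<tau> s)"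
  using tau_mono[of 0 s] by (simp add: tau_zero zero_M positive_iff)

lemma trN_diff: "A \<in> mats N M \<Longrightarrow> B \<in> mats N M \<Longrightarrow> trN \<tau> N (A - B) = trN \<tau> N A - trN \<tau> N B"
  by (simp add: trN_def mats_entry tau_diff sum_subtractf)
lemma trN_add: "A \<in> mats N M \<Longrightarrow> B \<in> mats N M \<Longrightarrow> trN \<tau> N (A + B) = trN \<tau> N A + trN \<tau> N B"
  by (simp add: trN_def mats_entry tau_add sum.distrib)
lemma trN_scale: "A \<in> mats N M \<Longrightarrow> trN \<tau> N (c *\<^sub>C A) = c * trN \<tau> N A"
  by (simp add: trN_def mats_entry tau_scale sum_distrib_left)
lemma trN_mone: "trN \<tau> N (mone N) = of_nat N"
  by (simp add: trN_def mone_def tau_one)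

lemma trN_comm:
  assumes "A \<in> mats N M" "B \<in> mats N M"
  shows "trN \<tau> N (mm N A B) = trN \<tau> N (mm N B A)"
proof -
  have "trN \<tau> N (mm N A B) = (\<Sum>i<N. \<Sum>k<N. \<tau> (A i k * B k i))"
    unfolding trN_def mm_def
    by (intro sum.cong refl tau_sum) (auto intro!: times_M mats_entry[OF assms(1)] mats_entry[OF assms(2)])
  also have "\<dots> = (\<Sum>i<N. \<Sum>k<N. \<tau> (B k i * A i k))"
    by (intro sum.cong refl tau_trace) (auto intro!: mats_entry[OF assms(1)] mats_entry[OF assms(2)])
  also have "\<dots> = (\<Sum>k<N. \<Sum>i<N. \<tau> (B k i * A i k))" by (rule sum.swap)
  also have "\<dots> = trN \<tau> N (mm N B A)"
    unfolding trN_def mm_def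
    by (intro sum.cong refl tau_sum[symmetric]) (auto intro!: times_M mats_entry[OF assms(1)] mats_entry[OF assms(2)])
  finally show ?thesis .
qed

lemma mpow_mats: "B \<in> mats N M \<Longrightarrow> mpow N B k \<in> mats N M"
  by (induction k) (auto intro: mone_mats mm_mats)

lemma mpow_commute: "B \<in> mats N M \<Longrightarrow> mm N B (mpow N B k) = mm N (mpow N B k) B"
proof (induction k)
  case 0
  then show ?case by (simp add: mm_one_left mm_one_right)
next
  case (Suc k)
  then show ?case by (simp add: mm_assoc[symmetric])
qed

lemma mpow_add: "B \<in> mats N M \<Longrightarrow> mm N (mpow N B j) (mpow N B k) = mpow N B (j + k)"
  by (induction k) (simp_all add: mm_one_right[OF mpow_mats] mm_assoc[symmetric])

lemma mpow_self_adjoint: "B \<in> mats N M \<Longrightarrow> madj B = B \<Longrightarrow> madj (mpow N B k) = mpow N B k"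
  by (induction k) (simp_all add: madj_mm mpow_commute)

text \<open>Von Neumann's approximation of the projection onto the kernel of \<open>Q\<^sup>*\<close> by powers of
  \<open>1 - c Q Q\<^sup>*\<close>, for \<open>c\<close> so small that this is a positive contraction.\<close>

lemma powers_converge:
  assumes Q: "Q \<in> mats N M" and c: "c > 0"
    and bd: "\<And>v. v \<in> tuples N UNIV \<Longrightarrow>
      c * Re (vip N (mat_app N Q v) (mat_app N Q v)) \<le> Re (vip N v v)"
    and B: "B = mone N - of_real c *\<^sub>C mm N Q (madj Q)"
    and p: "p = range_proj N Q" and v: "v \<in> tuples N UNIV"
  shows "decseq (\<lambda>k. Re (vip N (mat_app N (mpow N B k) v) v))"
    and "(\<lambda>k. Re (vip N (mat_app N (mpow N B k) v) v)) \<longlonglongrightarrow> Re (vip N (mat_app N (mone N - p) v) v)"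
proof -
  interpret hilbert_carrier "tuples N (UNIV :: 'h set)" "vip N" by (rule hilbert_tuples)
  let ?S = "of_real c *\<^sub>C mm N Q (madj Q)"
  let ?a = "\<lambda>A. mat_app N A"
  have SM: "?S \<in> mats N M" by (intro scale_mats mm_mats madj_mats Q)
  have BM: "B \<in> mats N M" unfolding B by (intro diff_mats mone_mats SM)
  have Ssa: "madj ?S = ?S" by (simp add: madj_scale madj_mm)
  have Bsa: "madj B = B" by (simp add: B madj_diff Ssa)
  note t = mat_app_tuples
  have S_nn: "Re (vip N (?a ?S u) u) = c * Re (vip N (?a (madj Q) u) (?a (madj Q) u))"
    and S_sq: "Re (vip N (?a ?S u) (?a ?S u)) \<le> Re (vip N (?a ?S u) u)" if u: "u \<in> tuples N UNIV" for u
  proof -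
    show 1: "Re (vip N (?a ?S u) u) = c * Re (vip N (?a (madj Q) u) (?a (madj Q) u))"
      by (simp add: mat_app_scale_mat mat_app_mm ip_scale_left t u vip_madj)
    have "Re (vip N (?a ?S u) (?a ?S u)) = c * (c * Re (vip N (?a Q (?a (madj Q) u)) (?a Q (?a (madj Q) u))))"
      by (simp add: mat_app_scale_mat mat_app_mm ip_scale_left ip_scale_right scale_mem t u)
    also have "\<dots> \<le> c * Re (vip N (?a (madj Q) u) (?a (madj Q) u))"
      by (intro mult_left_mono bd t) (use c in simp)
    finally show "Re (vip N (?a ?S u) (?a ?S u)) \<le> Re (vip N (?a ?S u) u)" using 1 by simp
  qed
  have Ba: "?a B u = u - ?a ?S u" if "u \<in> tuples N UNIV" for u
    by (simp add: B mat_app_diff_mat mat_app_mone[OF that])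
  define b where "b = (\<lambda>k. Re (vip N (?a (mpow N B k) v) v))"
  define s where "s = (\<lambda>k. ?a (mpow N B k) v)"
  have s_t: "s k \<in> tuples N UNIV" for k by (simp add: s_def t)
  have ss: "vip N (s j) (s k) = vip N (?a (mpow N B (j + k)) v) v" for j k
  proof -
    have "vip N (s j) (s k) = vip N (?a (mpow N B k) (?a (mpow N B j) v)) v"
      unfolding s_def by (subst vip_madj) (simp add: mpow_self_adjoint[OF BM Bsa])
    also have "\<dots> = vip N (?a (mpow N B (j + k)) v) v"
      by (simp add: mat_app_mm[symmetric] mpow_add[OF BM] add.commute)
    finally show ?thesis .
  qed
  have sSuc: "s (Suc k) = s k - ?a ?S (s k)" for k
    by (simp add: s_def mpow_commute[OF BM, symmetric] mat_app_mm Ba t)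
  \<comment> \<open>With \<open>S = 1 - B\<close>, the difference \<open>B\<^sup>k - B\<^sup>k\<^sup>+\<^sup>1\<close> is \<open>B\<^sup>m S B\<^sup>m\<close> for \<open>k = 2m\<close> and \<open>B\<^sup>m (S - S\<^sup>2) B\<^sup>m\<close> for
    \<open>k = 2m + 1\<close>; both \<open>S\<close> and \<open>S - S\<^sup>2\<close> are positive.\<close>
  have bs: "b (j + k) = Re (vip N (s j) (s k))" for j k by (simp add: b_def ss)
  have b_ev: "b (m + m) = Re (vip N (s m) (s m))" for m by (rule bs)
  have b_od: "b (Suc (m + m)) = Re (vip N (s m) (s m)) - Re (vip N (?a ?S (s m)) (s m))" for m
    using bs[of "Suc m" m] by (simp add: sSuc ip_diff_left t s_t)
  have b_ev2: "b (Suc (Suc (m + m))) = Re (vip N (s m) (s m)) - 2 * Re (vip N (?a ?S (s m)) (s m))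
      + Re (vip N (?a ?S (s m)) (?a ?S (s m)))" for m
  proof -
    have "Re (vip N (s m) (?a ?S (s m))) = Re (vip N (?a ?S (s m)) (s m))"
      using vip_madj[of N ?S "s m" "s m"] Ssa by simp
    then show ?thesis
      using bs[of "Suc m" "Suc m"] by (simp add: sSuc ip_diff_left ip_diff_right t s_t diff_mem)
  qed
  have dec: "b (Suc k) \<le> b k" for k
  proof (cases "even k")
    case True
    then obtain m where "k = m + m" by (metis evenE mult_2)
    moreover have "0 \<le> Re (vip N (?a ?S (s m)) (s m))"
      unfolding S_nn[OF s_t] using c by (intro mult_nonneg_nonneg ip_nonneg t) simp
    ultimately show ?thesis using b_od[of m] b_ev[of m] by simp
  next
    case False
    then obtain m where "k = Suc (m + m)" by (metis oddE mult_2 Suc_eq_plus1)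
    then show ?thesis using b_od[of m] b_ev2[of m] S_sq[OF s_t, of m] by simp
  qed
  then have decb: "decseq b" by (simp add: decseq_Suc_iff)
  then show "decseq (\<lambda>k. Re (vip N (mat_app N (mpow N B k) v) v))" by (simp add: b_def)
  have b0: "0 \<le> b k" for k
    using decseqD[OF decb, of k "k + k"] b_ev[of k] ip_nonneg[OF s_t, of k] by simp
  obtain L where L: "b \<longlonglongrightarrow> L"
    using decseq_convergent[OF decb, of 0] b0 by blast
  have sub_id: "Re (vip N (s j - s k) (s j - s k)) = b (j + j) - 2 * b (j + k) + b (k + k)" for j k
    using bs[of j k] bs[of k j] by (simp add: ip_diff_left ip_diff_right s_t diff_mem bs add.commute)
  have "\<exists>w\<in>tuples N UNIV. \<forall>e>0. \<exists>k0. \<forall>k\<ge>k0. Re (vip N (w - s k) (w - s k)) < e"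
  proof (rule complete[OF s_t])
    fix e :: real assume "e > 0"
    then obtain k0 where k0: "\<And>k. k \<ge> k0 \<Longrightarrow> \<bar>b k - L\<bar> < e / 4"
      using L[unfolded LIMSEQ_iff, rule_format, of "e / 4"] by auto
    have "Re (vip N (s j - s k) (s j - s k)) < e" if "j \<ge> k0" "k \<ge> k0" for j k
      unfolding sub_id using k0[of "j + j"] k0[of "j + k"] k0[of "k + k"] that by linarith
    then show "\<exists>k0. \<forall>k\<ge>k0. \<forall>m\<ge>k0. Re (vip N (s k - s m) (s k - s m)) < e" by blast
  qed
  then obtain w where w: "w \<in> tuples N UNIV"
    and wl: "\<And>e. e > 0 \<Longrightarrow> \<exists>k0. \<forall>k\<ge>k0. Re (vip N (w - s k) (w - s k)) < e" by blast
  \<comment> \<open>The limit lies in the kernel of \<open>Q\<^sup>*\<close> ...\<close>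
  have small: "\<exists>k0. \<forall>k\<ge>k0. Re (vip N (?a A w - ?a A (s k)) (?a A w - ?a A (s k))) < e" if e: "e > 0" for A e
  proof -
    obtain C where C: "C > 0"
      "\<And>v. v \<in> tuples N UNIV \<Longrightarrow> Re (vip N (?a A v) (?a A v)) \<le> C * Re (vip N v v)"
      using vip_bound[of N A] by blast
    obtain k0 where k0: "\<And>k. k \<ge> k0 \<Longrightarrow> Re (vip N (w - s k) (w - s k)) < e / C"
      using wl[of "e / C"] e C by auto
    have "Re (vip N (?a A w - ?a A (s k)) (?a A w - ?a A (s k))) < e" if "k \<ge> k0" for k
    proof -
      have "Re (vip N (?a A (w - s k)) (?a A (w - s k))) \<le> C * Re (vip N (w - s k) (w - s k))"
        by (intro C diff_mem w s_t)
      also have "\<dots> < e" using k0[OF that] C by (simp add: field_simps)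
      finally show ?thesis by (simp add: mat_app_diff)
    qed
    then show ?thesis by blast
  qed
  have zero: "u = 0" if u: "u \<in> tuples N UNIV" and le: "\<And>e. e > 0 \<Longrightarrow> Re (vip N u u) \<le> e" for u :: "nat \<Rightarrow> 'h"
  proof -
    have "Re (vip N u u) \<le> 0" using field_le_epsilon[of "Re (vip N u u)" 0] le by simp
    then have "Re (vip N u u) = 0" using ip_nonneg[OF u] by simp
    then show ?thesis using ip_self[OF u] ip_definite[OF u] by simp
  qed
  have "?a ?S w = 0"
  proof (rule zero[OF t])
    fix e :: real assume e: "e > 0"
    obtain k1 where k1: "\<And>k. k \<ge> k1 \<Longrightarrow> Re (vip N (?a ?S w - ?a ?S (s k)) (?a ?S w - ?a ?S (s k))) < e / 4"
      using small[of "e / 4" ?S] e by auto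
    obtain k2 where k2: "\<And>k. k \<ge> k2 \<Longrightarrow> \<bar>b k - L\<bar> < e / 16"
      using L[unfolded LIMSEQ_iff, rule_format, of "e / 16"] e by auto
    let ?k = "max k1 k2"
    have "?a ?S (s ?k) = s ?k - s (Suc ?k)" by (simp add: sSuc)
    then have "Re (vip N (?a ?S (s ?k)) (?a ?S (s ?k))) = b (?k + ?k) - 2 * b (?k + Suc ?k) + b (Suc ?k + Suc ?k)"
      by (simp only: sub_id)
    also have "\<dots> < e / 4" using k2[of "?k + ?k"] k2[of "?k + Suc ?k"] k2[of "Suc ?k + Suc ?k"] by linarith
    finally have "Re (vip N (?a ?S (s ?k)) (?a ?S (s ?k))) < e / 4" .
    then show "Re (vip N (?a ?S w) (?a ?S w)) \<le> e"
      using norm_triangle_sq[of "?a ?S w - ?a ?S (s ?k)" "?a ?S (s ?k)"] k1[of ?k]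
      by (simp add: t diff_mem)
  qed
  then have "Re (vip N (?a (madj Q) w) (?a (madj Q) w)) = 0"
    using S_nn[OF w] c by (simp add: ip_zero_left w)
  then have Qw: "?a (madj Q) w = 0" using zero[OF t] by simp
  then have pw: "?a p w = 0" unfolding p by (rule range_proj_annihilates[OF Q w])
  \<comment> \<open>... and differs from \<open>v\<close> by a limit of vectors in the range of \<open>Q\<close>.\<close>
  have pM: "p \<in> mats N M" unfolding p by (rule range_proj_mats[OF Q])
  have ps: "?a (mone N - p) (v - s k) = 0" for k
  proof (induction k)
    case 0
    have "v - s 0 = 0" using v by (simp add: s_def mat_app_mone)
    then show ?case by (simp only: mat_app_0)
  next
    case (Suc k)
    have "mm N p ?S = ?S" 
      by (simp add: mm_scale_right mm_assoc[symmetric] p range_proj_mult[OF Q])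
    then have "mm N (mone N - p) ?S = 0" by (simp only: mm_diff_left mm_one_left[OF SM]) simp
    then have "?a (mone N - p) (?a ?S (s k)) = ?a 0 (s k)"
      unfolding mat_app_mm[symmetric] by simp
    also have "\<dots> = 0" by (simp add: mat_app_def fun_eq_iff)
    finally have "?a (mone N - p) (?a ?S (s k)) = 0" .
    moreover have "v - s (Suc k) = (v - s k) + ?a ?S (s k)" by (simp add: sSuc)
    ultimately show ?case using Suc by (simp only: mat_app_add) simp
  qed
  have "?a (mone N - p) (v - w) = 0"
  proof (rule zero[OF t])
    fix e :: real assume e: "e > 0"
    then obtain k where k: "Re (vip N (?a (mone N - p) w - ?a (mone N - p) (s k)) (?a (mone N - p) w - ?a (mone N - p) (s k))) < e"
      using small[of e "mone N - p"] by auto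
    have eq: "?a (mone N - p) (s k) = ?a (mone N - p) v" using ps[of k] by (simp add: mat_app_diff)
    have sym: "vip N (x - y) (x - y) = vip N (y - x) (y - x)"
      if "x \<in> tuples N UNIV" "y \<in> tuples N UNIV" for x y :: "nat \<Rightarrow> 'h"
      using that by (simp add: ip_diff_left ip_diff_right diff_mem)
    show "Re (vip N (?a (mone N - p) (v - w)) (?a (mone N - p) (v - w))) \<le> e"
      using k[unfolded eq] sym[OF t t, of "mone N - p" w "mone N - p" v]
      unfolding mat_app_diff by (simp only: less_imp_le)
  qed
  then have wv: "?a (mone N - p) v = w"
    using pw w by (simp add: mat_app_diff mat_app_diff_mat mat_app_mone)
  show "(\<lambda>k. Re (vip N (mat_app N (mpow N B k) v) v)) \<longlonglongrightarrow> Re (vip N (mat_app N (mone N - p) v) v)"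
    unfolding wv LIMSEQ_iff
  proof (intro allI impI)
    fix r :: real assume r: "0 < r"
    define V where "V = Re (vip N v v) + 1"
    have V: "V > 0" using ip_nonneg[OF v] by (simp add: V_def)
    obtain k0 where k0: "\<And>k. k \<ge> k0 \<Longrightarrow> Re (vip N (w - s k) (w - s k)) < r\<^sup>2 / V"
      using wl[of "r\<^sup>2 / V"] r V by auto
    have "norm (Re (vip N (s k) v) - Re (vip N w v)) < r" if "k \<ge> k0" for k
    proof -
      have "(cmod (vip N (w - s k) v))\<^sup>2 \<le> Re (vip N (w - s k) (w - s k)) * Re (vip N v v)"
        by (intro cauchy_schwarz diff_mem w s_t v)
      also have "\<dots> \<le> Re (vip N (w - s k) (w - s k)) * V"
        by (intro mult_left_mono ip_nonneg diff_mem w s_t) (simp add: V_def)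
      also have "\<dots> < r\<^sup>2" using k0[OF that] V by (simp add: field_simps)
      finally have "cmod (vip N (w - s k) v) < r" using r power_less_imp_less_base[of _ 2 r] by simp
      then have "\<bar>Re (vip N (w - s k) v)\<bar> < r" using abs_Re_le_cmod[of "vip N (w - s k) v"] by simp
      then show ?thesis by (simp add: ip_diff_left w s_t v abs_minus_commute)
    qed
    then show "\<exists>k0. \<forall>k\<ge>k0. norm (Re (vip N (mat_app N (mpow N B k) v) v) - Re (vip N w v)) < r"
      by (auto simp: s_def)
  qed
qed

text \<open>The diagonal entries of \<open>1 - B\<^sup>k\<close> increase to those of the range projection, which are therefore
  their suprema in \<open>M\<close>, and \<open>\<tau>\<close> is normal.\<close>

lemma trace_powers_converge:
  assumes Q: "Q \<in> mats N M" and c: "c > 0"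
    and bd: "\<And>v. v \<in> tuples N UNIV \<Longrightarrow>
      c * Re (vip N (mat_app N Q v) (mat_app N Q v)) \<le> Re (vip N v v)"
    and B: "B = mone N - of_real c *\<^sub>C mm N Q (madj Q)"
  shows "(\<lambda>k. Re (trN \<tau> N (mone N - mpow N B k))) \<longlonglongrightarrow> Re (trN \<tau> N (range_proj N Q))"
proof -
  let ?p = "range_proj N Q"
  have BM: "B \<in> mats N M" unfolding B by (intro diff_mats mone_mats scale_mats mm_mats madj_mats Q)
  have Bsa: "madj B = B" by (simp add: B madj_diff madj_scale madj_mm)
  have pM: "?p \<in> mats N M" by (rule range_proj_mats[OF Q])
  have "(\<lambda>k. Re (\<tau> (1 - mpow N B k i i))) \<longlonglongrightarrow> Re (\<tau> (?p i i))" if i: "i < N" for i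
  proof -
    define d where "d = (\<lambda>k. 1 - mpow N B k i i)"
    have dM: "d k \<in> M" for k unfolding d_def by (intro minus_M one_M mats_entry[OF mpow_mats[OF BM]] i)
    have sM: "?p i i \<in> M" by (rule mats_entry[OF pM i i])
    have dsa: "adj (d k) = d k" for k
      using fun_cong[OF fun_cong[OF mpow_self_adjoint[OF BM Bsa, of k]], of i i]
      by (simp add: d_def adj_minus madj_def)
    have ssa: "adj (?p i i) = ?p i i"
      using fun_cong[OF fun_cong[OF range_proj_self_adjoint[OF Q]], of i i] by (simp add: madj_def)
    have e: "Re (cinner (app (A i i) x) x) = Re (vip N (mat_app N A (single i x)) (single i x))" for A and x :: 'h
      using i by (simp add: vip_single_right mat_app_single)
    note conv = powers_converge[OF Q c bd B refl single_tuples[OF i], unfolded e[symmetric]]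
    have lim: "(\<lambda>k. Re (cinner (app (d k) x) x)) \<longlonglongrightarrow> Re (cinner (app (?p i i) x) x)" for x
    proof -
      have "(\<lambda>k. Re (cinner x x) - Re (cinner (app (mpow N B k i i) x) x)) \<longlonglongrightarrow> 
          Re (cinner x x) - Re (cinner (app ((mone N - ?p) i i) x) x)"
        by (intro tendsto_diff tendsto_const conv)
      then show ?thesis using i by (simp add: d_def cinner_diff_left mone_def)
    qed
    have inc: "incseq (\<lambda>k. Re (cinner (app (d k) x) x))" for x
      using conv(1)[of x] by (simp add: d_def cinner_diff_left incseq_def decseq_def)
    have d0: "d 0 = 0" using i by (simp add: d_def mone_def)
    have mono: "positive (d l - d k)" if "k \<le> l" for k l
      using incseqD[OF inc that] by (simp add: positive_diff_iff dsa)
    have pos: "positive (d k)" for k using mono[of 0 k] by (simp add: d0)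
    have le: "positive (?p i i - d k)" for k
      using incseq_le[OF inc lim] by (simp add: positive_diff_iff dsa ssa)
    have least: "positive (u - ?p i i)" if u: "\<And>k. positive (u - d k)" for u
    proof -
      have "positive u" using u[of 0] by (simp add: d0)
      then have "Im (cinner (app u x) x) = 0" "Im (cinner (app (?p i i) x) x) = 0" for x
      proof -
        show "Im (cinner (app u x) x) = 0" using \<open>positive u\<close> by (simp add: positive_iff)
        show "Im (cinner (app (?p i i) x) x) = 0" using le[of 0] by (simp add: d0 positive_iff)
      qed
      moreover have "Re (cinner (app (?p i i) x) x) \<le> Re (cinner (app u x) x)" for x
        by (rule LIMSEQ_le_const2[OF lim]) (use u in \<open>simp add: positive_iff cinner_diff_left\<close>)
      ultimately show ?thesis by (simp add: positive_iff cinner_diff_left)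
    qed
    have "Re (\<tau> (?p i i)) = (SUP d\<in>range d. Re (\<tau> d))"
    proof (rule tau_normal[unfolded normal_on_def, rule_format], intro conjI ballI impI allI)
      fix x y assume "x \<in> range d" "y \<in> range d"
      then obtain k l where "x = d k" "y = d l" by blast
      then show "\<exists>f\<in>range d. positive (f - x) \<and> positive (f - y)"
        using mono[of k "max k l"] mono[of l "max k l"] by auto
    qed (use dM sM pos le least in auto)
    also have "\<dots> = (SUP k. Re (\<tau> (d k)))" by (simp add: image_image)
    finally have S: "Re (\<tau> (?p i i)) = (SUP k. Re (\<tau> (d k)))" .
    have "incseq (\<lambda>k. Re (\<tau> (d k)))"
      unfolding incseq_def by (intro allI impI tau_mono dM pos mono)
    moreover have "bdd_above (range (\<lambda>k. Re (\<tau> (d k))))"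
      by (rule bdd_aboveI[of _ "Re (\<tau> (?p i i))"]) (use tau_mono[OF dM sM pos le] in auto)
    ultimately have "(\<lambda>k. Re (\<tau> (d k))) \<longlonglongrightarrow> (SUP k. Re (\<tau> (d k)))" by (intro LIMSEQ_incseq_SUP)
    then show ?thesis unfolding S by (simp add: d_def)
  qed
  then have "(\<lambda>k. \<Sum>i<N. Re (\<tau> (1 - mpow N B k i i))) \<longlonglongrightarrow> (\<Sum>i<N. Re (\<tau> (?p i i)))"
    by (intro tendsto_sum) auto
  then show ?thesis by (simp add: trN_def mone_def)
qed

text \<open>Since \<open>B\<^sup>k Q = Q C\<^sup>k\<close>, the trace property gives equal traces to \<open>B\<^sup>k Q Q\<^sup>* = Q C\<^sup>k Q\<^sup>*\<close> and to
  \<open>C\<^sup>k Q\<^sup>* Q\<close>, by which the \<open>k\<close>-th and the next powers of \<open>B\<close> and of \<open>C\<close> differ, up to the factor \<open>c\<close>.\<close>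

lemma trace_powers_adj:
  assumes Q: "Q \<in> mats N M"
    and B: "B = mone N - c *\<^sub>C mm N Q (madj Q)" and C: "C = mone N - c *\<^sub>C mm N (madj Q) Q"
  shows "trN \<tau> N (mpow N B k) = trN \<tau> N (mpow N C k)"
proof -
  have Qa: "madj Q \<in> mats N M" by (rule madj_mats[OF Q])
  have BM: "B \<in> mats N M" unfolding B by (intro diff_mats mone_mats scale_mats mm_mats Q Qa)
  have CM: "C \<in> mats N M" unfolding C by (intro diff_mats mone_mats scale_mats mm_mats Q Qa)
  have BQ: "mm N B Q = mm N Q C"
    unfolding B C
    by (simp add: mm_diff_left mm_diff_right mm_one_left[OF Q] mm_one_right[OF Q] mm_scale_left
        mm_scale_right mm_assoc)
  have BkQ: "mm N (mpow N B k) Q = mm N Q (mpow N C k)" for k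
  proof (induction k)
    case 0
    then show ?case by (simp add: mm_one_left[OF Q] mm_one_right[OF Q])
  next
    case (Suc k)
    have "mm N (mpow N B (Suc k)) Q = mm N (mpow N B k) (mm N Q C)" by (simp add: mm_assoc BQ)
    also have "\<dots> = mm N Q (mpow N C (Suc k))" by (simp add: mm_assoc[symmetric] Suc)
    finally show ?case .
  qed
  show ?thesis
  proof (induction k)
    case (Suc k)
    note BkM = mpow_mats[OF BM, of k] and CkM = mpow_mats[OF CM, of k]
    have "trN \<tau> N (mpow N B (Suc k)) = trN \<tau> N (mpow N B k) - c * trN \<tau> N (mm N (mpow N B k) (mm N Q (madj Q)))"
      unfolding mpow.simps(2) by (subst (2) B)
        (simp add: mm_diff_right mm_one_right[OF BkM] mm_scale_right trN_diff trN_scale scale_mats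
          mm_mats BkM Q Qa)
    also have "mm N (mpow N B k) (mm N Q (madj Q)) = mm N Q (mm N (mpow N C k) (madj Q))"
      by (simp add: mm_assoc[symmetric] BkQ)
    also have "trN \<tau> N \<dots> = trN \<tau> N (mm N (mpow N C k) (mm N (madj Q) Q))"
      by (subst trN_comm) (simp_all add: mm_assoc mm_mats Q Qa CkM)
    also have "trN \<tau> N (mpow N B k) - c * \<dots> = trN \<tau> N (mpow N C (Suc k))"
      unfolding mpow.simps(2) by (subst (3) C)
        (simp add: mm_diff_right mm_one_right[OF CkM] mm_scale_right trN_diff trN_scale scale_mats
          mm_mats CkM Q Qa Suc)
    finally show ?case .
  qed simp
qed

lemma trN_projection:
  assumes p: "p \<in> mats N M" "madj p = p" "mm N p p = p"
  shows "Im (trN \<tau> N p) = 0" "0 \<le> Re (trN \<tau> N p)"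
proof -
  have "\<tau> (p i i) \<in> \<real>\<^sub>\<ge>\<^sub>0" if i: "i < N" for i
  proof -
    have e: "p i i = (\<Sum>k<N. adj (p k i) * p k i)"
      using fun_cong[OF fun_cong[OF p(3)], of i i] p(2)
      by (metis (no_types, lifting) madj_def mm_def sum.cong)
    have "\<tau> (p i i) = (\<Sum>k<N. \<tau> (adj (p k i) * p k i))"
      by (subst e, rule tau_sum) (auto intro!: times_M adj_M mats_entry[OF p(1)] i)
    also have "\<dots> \<in> \<real>\<^sub>\<ge>\<^sub>0"
    proof -
      have "(\<Sum>k\<in>A. \<tau> (adj (p k i) * p k i)) \<in> \<real>\<^sub>\<ge>\<^sub>0" if "A \<subseteq> {..<N}" for A
        using finite_subset[OF that finite_lessThan] that
      proof (induction A)
        case (insert a A)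
        then show ?case using tau_nonneg[of "p a i"] i by (auto intro!: nonneg_Reals_add_I mats_entry[OF p(1)])
      qed simp
      then show ?thesis by blast
    qed
    finally show ?thesis .
  qed
  then have "Im (\<tau> (p i i)) = 0" "0 \<le> Re (\<tau> (p i i))" if "i < N" for i
    using that by (auto simp: complex_nonneg_Reals_iff)
  then show "Im (trN \<tau> N p) = 0" "0 \<le> Re (trN \<tau> N p)"
    by (auto simp: trN_def intro!: sum.neutral sum_nonneg)
qed

lemma vn_rank_trN: "vn_rank \<tau> N Q = trN \<tau> N (range_proj N Q)"
  by (simp add: vn_rank_def trN_def)

text \<open>The range projections of \<open>Q\<close> and \<open>Q\<^sup>*\<close> are equivalent; comparing the approximations of their
  traces avoids the polar decomposition of \<open>Q\<close>.\<close>

lemma vn_rank_madj: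
  assumes Q: "Q \<in> mats N M"
  shows "vn_rank \<tau> N (madj Q) = vn_rank \<tau> N Q"
proof -
  have Qa: "madj Q \<in> mats N M" by (rule madj_mats[OF Q])
  obtain C where C: "C > 0" "\<And>v. v \<in> tuples N UNIV \<Longrightarrow> Re (vip N (mat_app N Q v) (mat_app N Q v)) \<le> C * Re (vip N v v)"
    using vip_bound[of N Q] by blast
  obtain D where D: "D > 0" "\<And>v. v \<in> tuples N UNIV \<Longrightarrow> Re (vip N (mat_app N (madj Q) v) (mat_app N (madj Q) v)) \<le> D * Re (vip N v v)"
    using vip_bound[of N "madj Q"] by blast
  define c where "c = 1 / (C + D)"
  have c: "c > 0" using C D by (simp add: c_def)
  interpret H: hilbert_carrier "tuples N (UNIV :: 'h set)" "vip N" by (rule hilbert_tuples)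
  have scale: "c * x \<le> y" if "x \<le> K * y" "K \<le> C + D" "0 \<le> y" for x y K
  proof -
    have "x \<le> (C + D) * y" using that mult_right_mono[of K "C + D" y] by simp
    then show ?thesis using C D by (simp add: c_def field_simps)
  qed
  have b1: "c * Re (vip N (mat_app N Q v) (mat_app N Q v)) \<le> Re (vip N v v)" if "v \<in> tuples N UNIV" for v
    using C(2)[OF that] H.ip_nonneg[OF that] D by (intro scale) auto
  have b2: "c * Re (vip N (mat_app N (madj Q) v) (mat_app N (madj Q) v)) \<le> Re (vip N v v)" if "v \<in> tuples N UNIV" for v
    using D(2)[OF that] H.ip_nonneg[OF that] C by (intro scale) auto
  let ?B = "mone N - of_real c *\<^sub>C mm N Q (madj Q)" and ?C = "mone N - of_real c *\<^sub>C mm N (madj Q) (madj (madj Q))"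
  have "(\<lambda>k. Re (trN \<tau> N (mone N - mpow N ?B k))) \<longlonglongrightarrow> Re (trN \<tau> N (range_proj N Q))"
    by (rule trace_powers_converge[OF Q c b1 refl])
  moreover have "(\<lambda>k. Re (trN \<tau> N (mone N - mpow N ?C k))) \<longlonglongrightarrow> Re (trN \<tau> N (range_proj N (madj Q)))"
    by (rule trace_powers_converge[OF Qa c b2 refl])
  moreover have "trN \<tau> N (mone N - mpow N ?B k) = trN \<tau> N (mone N - mpow N ?C k)" for k
    using trace_powers_adj[OF Q refl refl, of "of_real c" k]
    by (simp add: trN_diff mone_mats mpow_mats diff_mats scale_mats mm_mats Q Qa)
  ultimately have "Re (trN \<tau> N (range_proj N Q)) = Re (trN \<tau> N (range_proj N (madj Q)))"
    by (intro LIMSEQ_unique) simp_all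
  then show ?thesis
    using trN_projection(1)[OF range_proj_mats range_proj_self_adjoint range_proj_idem, OF Q Q Q]
      trN_projection(1)[OF range_proj_mats range_proj_self_adjoint range_proj_idem, OF Qa Qa Qa]
    by (simp add: vn_rank_trN complex_eq_iff)
qed

end

section \<open>Orthonormal bases and Hilbert--Schmidt operators\<close>

lemma onb_exists: "\<exists>B :: 'a :: complex_hilbert_space set. is_onb B"
proof -
  define Os where "Os = {B :: 'a set. \<forall>e\<in>B. \<forall>f\<in>B. cinner e f = (if e = f then 1 else 0)}"
  have "\<exists>B\<in>Os. \<forall>X\<in>Os. B \<subseteq> X \<longrightarrow> X = B"
  proof (rule subset_Zorn_nonempty)
    show "Os \<noteq> {}" by (auto simp: Os_def)
    fix C assume C: "C \<noteq> {}" "subset.chain Os C"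
    have "cinner e f = (if e = f then 1 else 0)" if ef: "e \<in> \<Union>C" "f \<in> \<Union>C" for e f
    proof -
      obtain X Y where "X \<in> C" "e \<in> X" "Y \<in> C" "f \<in> Y" using ef by blast
      then obtain Z where "Z \<in> C" "e \<in> Z" "f \<in> Z"
        using C(2) unfolding subset.chain_def by blast
      then show ?thesis using C(2) unfolding subset.chain_def Os_def by blast
    qed
    then show "\<Union>C \<in> Os" by (simp add: Os_def)
  qed
  then obtain B where B: "B \<in> Os" "\<And>X. X \<in> Os \<Longrightarrow> B \<subseteq> X \<Longrightarrow> X = B" by blast
  have "x = 0" if x: "\<forall>e\<in>B. cinner x e = 0" for x
  proof (rule ccontr)
    assume x0: "x \<noteq> 0"
    define y where "y = of_real (1 / norm x) *\<^sub>C x"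
    have y: "cinner y y = 1"
      using x0 by (simp add: y_def cinner_self norm_scaleC norm_divide)
    have ye: "cinner y e = 0" "cinner e y = 0" if "e \<in> B" for e
      using x that cinner_commute[of e x]
      by (simp_all add: y_def cinner_scaleC_left cinner_scaleC_right)
    have "insert y B \<in> Os" using B(1) y ye unfolding Os_def by fastforce
    then have "y \<in> B" using B(2) by blast
    then show False using ye y by force
  qed
  then show ?thesis using B(1) unfolding is_onb_def Os_def by blast
qed

lemma is_onb_onb: "is_onb (onb :: 'a :: complex_hilbert_space set)"
  unfolding onb_def by (rule someI_ex[OF onb_exists])

lemma onb_orth: "e \<in> onb \<Longrightarrow> f \<in> onb \<Longrightarrow> cinner e f = (if e = f then 1 else 0)"
  using is_onb_onb unfolding is_onb_def by blast

text \<open>By the projection theorem \<open>x\<close> lies in the closed span of the basis, and among the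
  elements of a finite-dimensional span the Fourier sum is closest to \<open>x\<close>.\<close>

lemma onb_expansion: "((\<lambda>e. cinner x e *\<^sub>C e) has_sum x) (onb :: 'a :: complex_hilbert_space set)"
proof -
  interpret hilbert_carrier UNIV "cinner :: 'a \<Rightarrow> 'a \<Rightarrow> complex" by (rule hilbert_carrier_UNIV)
  define S where "S = {v :: 'a. \<exists>F c. finite F \<and> F \<subseteq> onb \<and> v = (\<Sum>e\<in>F. c e *\<^sub>C e)}"
  have extend: "(\<Sum>e\<in>F. c e *\<^sub>C e) = (\<Sum>e\<in>G. (if e \<in> F then c e else 0) *\<^sub>C e)"
    if "finite G" "F \<subseteq> G" for F G :: "'a set" and c
  proof -
    have "(\<Sum>e\<in>F. c e *\<^sub>C e) = (\<Sum>e\<in>F. (if e \<in> F then c e else 0) *\<^sub>C e)" by (rule sum.cong) auto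
    also have "\<dots> = (\<Sum>e\<in>G. (if e \<in> F then c e else 0) *\<^sub>C e)"
      by (rule sum.mono_neutral_left) (use that in auto)
    finally show ?thesis .
  qed
  have S: "csubspace S" unfolding csubspace_def
  proof (intro conjI ballI allI)
    show "0 \<in> S" unfolding S_def by (auto intro!: exI[of _ "{}"])
    fix v assume "v \<in> S"
    then obtain F c where v: "finite F" "F \<subseteq> onb" "v = (\<Sum>e\<in>F. c e *\<^sub>C e)" unfolding S_def by blast
    show "a *\<^sub>C v \<in> S" for a
      unfolding S_def using v
      by (auto intro!: exI[of _ F] exI[of _ "\<lambda>e. a * c e"] simp: scaleC_sum_right scaleC_scaleC)
    fix w assume "w \<in> S"
    then obtain G d where w: "finite G" "G \<subseteq> onb" "w = (\<Sum>e\<in>G. d e *\<^sub>C e)" unfolding S_def by blast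
    have "v + w = (\<Sum>e\<in>F \<union> G. ((if e \<in> F then c e else 0) + (if e \<in> G then d e else 0)) *\<^sub>C e)"
      using v w by (simp only: extend[of "F \<union> G" F c] extend[of "F \<union> G" G d] finite_UnI Un_upper1
          Un_upper2 scaleC_add_left sum.distrib)
    then show "v + w \<in> S" unfolding S_def using v w
      by (intro CollectI exI[of _ "F \<union> G"] exI[of _ "\<lambda>e. (if e \<in> F then c e else 0) + (if e \<in> G then d e else 0)"]) auto
  qed
  let ?K = "ip_closure cinner UNIV S"
  note K = closure_csubspace[OF S subset_UNIV] closure_subset_carrier closure_closed[OF subset_UNIV]
  define z where "z = x - orth_proj cinner ?K x"
  have "cinner z e = 0" if e: "e \<in> onb" for e
  proof -
    have "e \<in> S" unfolding S_def using e
      by (auto intro!: exI[of _ "{e}"] exI[of _ "\<lambda>_. 1"] simp: scaleC_one)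
    then have "e \<in> ?K" using subset_closure[OF subset_UNIV] by blast
    then show ?thesis unfolding z_def by (intro orth_proj_orth[OF K]) auto
  qed
  then have "z = 0" using is_onb_onb unfolding is_onb_def by blast
  then have xK: "x \<in> ?K" using orth_proj_mem[OF K, of x] by (simp add: z_def)
  show ?thesis
    unfolding has_sum_def
  proof (rule tendstoI)
    fix r :: real assume r: "r > 0"
    obtain v where vS: "v \<in> S" and v: "sqrt (Re (cinner (x - v) (x - v))) < r"
      using xK r unfolding ip_closure_def by blast
    obtain F c where F: "finite F" "F \<subseteq> onb" "v = (\<Sum>e\<in>F. c e *\<^sub>C e)" using vS unfolding S_def by blast
    have "dist (\<Sum>e\<in>G. cinner x e *\<^sub>C e) x < r" if G: "finite G" "F \<subseteq> G" "G \<subseteq> onb" for G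
    proof -
      define f where "f = (\<Sum>e\<in>G. cinner x e *\<^sub>C e)"
      have vG: "v = (\<Sum>e\<in>G. (if e \<in> F then c e else 0) *\<^sub>C e)"
        unfolding F(3) by (rule extend[OF G(1,2)])
      have orth: "cinner (x - f) e = 0" if e: "e \<in> G" for e
      proof -
        have ge: "cinner g e = (if g = e then 1 else 0)" if "g \<in> G" for g
          using onb_orth[of g e] that e G(3) by blast
        have "cinner f e = (\<Sum>g\<in>G. if e = g then cinner x e else 0)"
          unfolding f_def cinner_sum_left
          by (rule sum.cong) (auto simp: cinner_scaleC_left ge)
        then show ?thesis using e G by (simp add: cinner_diff_left sum.delta)
      qed
      have "f - v = (\<Sum>e\<in>G. (cinner x e - (if e \<in> F then c e else 0)) *\<^sub>C e)"
        unfolding f_def vG sum_subtractf[symmetric]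
        by (rule sum.cong) (auto simp: scaleC_add_left[of _ "- _", simplified] scaleC_minus_left)
      then have o: "cinner (x - f) (f - v) = 0"
        by (simp only: cinner_sum_right cinner_scaleC_right) (simp add: orth)
      have "cinner (f - v) (x - f) = 0" using o cinner_commute[of "f - v" "x - f"] by simp
      then have "cinner (x - v) (x - v) = cinner (x - f) (x - f) + cinner (f - v) (f - v)"
        using o cinner_add_left[of "x - f" "f - v"] cinner_add_right[of _ "x - f" "f - v"] by simp
      then have "of_real ((norm (x - v))\<^sup>2) = (of_real ((norm (x - f))\<^sup>2 + (norm (f - v))\<^sup>2) :: complex)"
        by (simp only: cinner_self of_real_add)
      then have "(norm (x - v))\<^sup>2 = (norm (x - f))\<^sup>2 + (norm (f - v))\<^sup>2" by (simp only: of_real_eq_iff)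
      then have "(norm (x - f))\<^sup>2 \<le> (norm (x - v))\<^sup>2" by simp
      then have "norm (x - f) \<le> norm (x - v)" by (rule power2_le_imp_le) simp
      also have "\<dots> < r" using v by (simp add: cinner_self)
      finally show ?thesis by (simp add: f_def dist_norm norm_minus_commute)
    qed
    then show "\<forall>\<^sub>F G in finite_subsets_at_top onb. dist (\<Sum>e\<in>G. cinner x e *\<^sub>C e) x < r"
      unfolding eventually_finite_subsets_at_top using F by blast
  qed
qed

lemma onb_parseval: "((\<lambda>e. cinner x e * cinner e y) has_sum cinner x y) (onb :: 'a :: complex_hilbert_space set)"
  using has_sum_bounded_linear[OF bounded_linear_cinner_left onb_expansion[of x], of y]
  by (simp add: cinner_scaleC_left)

lemma onb_norm: "((\<lambda>e. (cmod (cinner e x))\<^sup>2) has_sum (norm x)\<^sup>2) (onb :: 'a :: complex_hilbert_space set)"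
proof -
  have "((\<lambda>e. Re (cinner x e * cinner e x)) has_sum Re (cinner x x)) onb"
    using has_sum_bounded_linear[OF bounded_linear_Re onb_parseval[of x x]] .
  moreover have "Re (cinner x e * cinner e x) = (cmod (cinner e x))\<^sup>2" for e
  proof -
    have "cinner x e * cinner e x = cinner e x * cnj (cinner e x)"
      by (subst cinner_commute[of x e]) (rule mult.commute)
    also have "\<dots> = of_real ((cmod (cinner e x))\<^sup>2)" by (rule complex_norm_square[symmetric])
    finally show ?thesis by (simp only: Re_complex_of_real)
  qed
  ultimately show ?thesis by (simp add: cinner_self)
qed

definition outer :: "'a :: complex_hilbert_space \<Rightarrow> 'a \<Rightarrow> 'a cbop"
  where "outer u v = Cbop (\<lambda>x. cinner x v *\<^sub>C u)"

lemma app_outer [simp]: "app (outer u v) x = cinner x v *\<^sub>C u"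
proof -
  have "app (Cbop (\<lambda>x. cinner x v *\<^sub>C u)) = (\<lambda>x. cinner x v *\<^sub>C u)"
  proof (rule app_Cbop)
    show "norm (cinner x v *\<^sub>C u) \<le> (norm v * norm u) * norm x" for x
      using mult_right_mono[OF norm_cinner_le[of x v], of "norm u"] by (simp add: norm_scaleC mult_ac)
  qed (simp_all add: cinner_add_left cinner_scaleC_left scaleC_add_left scaleC_scaleC)
  then show ?thesis by (simp add: outer_def)
qed

lemma mult_outer: "S * outer u v = outer (app S u) v"
  by (rule cbop_eqI) (simp add: app_scaleC)

lemma outer_mult: "outer u v * S = outer u (app (adj S) v)"
  by (rule cbop_eqI) (simp add: cinner_adj_right)

text \<open>This is the expansion of \<open>v\<close> in the basis, mapped by \<open>x \<mapsto> \<langle>S x, u\<rangle>\<close>.\<close>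

lemma hs_inner_outer: "hs_inner S (outer u v) = cinner (app S v) u"
proof -
  have bl: "bounded_linear (\<lambda>x. cinner (app S x) u)"
    by (rule bounded_linear_compose[OF bounded_linear_cinner_left bounded_linear_app])
  have "((\<lambda>e. cinner (app S (cinner v e *\<^sub>C e)) u) has_sum cinner (app S v) u) onb"
    by (rule has_sum_bounded_linear[OF bl onb_expansion])
  moreover have "cinner (app S (cinner v e *\<^sub>C e)) u = cinner (app S e) (app (outer u v) e)" for e
    using cinner_commute[of v e] by (simp add: app_scaleC cinner_scaleC_left cinner_scaleC_right)
  ultimately show ?thesis by (simp add: hs_inner_def infsumI)
qed

lemma hs_summable: "T \<in> hilbert_schmidt \<Longrightarrow> (\<lambda>e. (norm (app T e))\<^sup>2) summable_on onb"
  by (simp add: hilbert_schmidt_def)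

lemma hs_dominated:
  assumes "f summable_on (onb :: 'a :: complex_hilbert_space set)" "\<And>e. (norm (app T e))\<^sup>2 \<le> f e"
  shows "T \<in> hilbert_schmidt"
  unfolding hilbert_schmidt_def
  using summable_on_comparison_test[OF assms(1), of "\<lambda>e. (norm (app T e))\<^sup>2"] assms(2) by simp

lemma hs_inner_summable:
  assumes "S \<in> hilbert_schmidt" "T \<in> hilbert_schmidt"
  shows "(\<lambda>e. cinner (app S e) (app T e)) summable_on onb"
proof (rule abs_summable_summable)
  have "(\<lambda>e. (norm (app S e))\<^sup>2 + (norm (app T e))\<^sup>2) summable_on onb"
    by (intro summable_on_add hs_summable assms)
  then show "(\<lambda>e. norm (cinner (app S e) (app T e))) summable_on onb"
  proof (rule summable_on_comparison_test)
    fix e :: 'a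
    have "norm (cinner (app S e) (app T e)) \<le> norm (app S e) * norm (app T e)" by (rule norm_cinner_le)
    also have "\<dots> \<le> (norm (app S e))\<^sup>2 + (norm (app T e))\<^sup>2"
      using sum_squares_bound[of "norm (app S e)" "norm (app T e)"]
        mult_nonneg_nonneg[OF norm_ge_zero[of "app S e"] norm_ge_zero[of "app T e"]] by linarith
    finally show "norm (cinner (app S e) (app T e)) \<le> (norm (app S e))\<^sup>2 + (norm (app T e))\<^sup>2" .
  qed simp
qed

lemma hs_inner_self:
  "T \<in> hilbert_schmidt \<Longrightarrow> hs_inner T T = of_real (\<Sum>\<^sub>\<infinity>e\<in>onb. (norm (app T e))\<^sup>2)"
  unfolding hs_inner_def cinner_self
  by (intro infsumI has_sum_of_real has_sum_infsum hs_summable)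

lemma outer_hs: "outer u v \<in> hilbert_schmidt"
proof (rule hs_dominated)
  show "(\<lambda>e. (cmod (cinner e v))\<^sup>2 * (norm u)\<^sup>2) summable_on onb"
    by (intro summable_on_cmult_left has_sum_imp_summable[OF onb_norm])
qed (simp add: norm_scaleC power_mult_distrib)

lemma pre_hilbert_hs: "pre_hilbert_carrier (hilbert_schmidt :: 'a :: complex_hilbert_space cbop set) hs_inner"
proof
  show "csubspace (hilbert_schmidt :: 'a cbop set)" unfolding csubspace_def
  proof (intro conjI ballI allI)
    show "0 \<in> (hilbert_schmidt :: 'a cbop set)" by (simp add: hilbert_schmidt_def)
    fix S :: "'a cbop" assume S: "S \<in> hilbert_schmidt"
    show "c *\<^sub>C S \<in> hilbert_schmidt" for c
    proof (rule hs_dominated)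
      show "(\<lambda>e. (cmod c)\<^sup>2 * (norm (app S e))\<^sup>2) summable_on onb"
        by (intro summable_on_cmult_right hs_summable S)
    qed (simp add: norm_scaleC power_mult_distrib)
    fix T :: "'a cbop" assume T: "T \<in> hilbert_schmidt"
    show "S + T \<in> hilbert_schmidt"
    proof (rule hs_dominated)
      show "(\<lambda>e. 2 * (norm (app S e))\<^sup>2 + 2 * (norm (app T e))\<^sup>2) summable_on onb"
        by (intro summable_on_add summable_on_cmult_right hs_summable S T)
      fix e
      have "(norm (app (S + T) e))\<^sup>2 \<le> (norm (app S e) + norm (app T e))\<^sup>2"
        by (intro power_mono) (simp_all add: norm_triangle_ineq)
      also have "\<dots> \<le> 2 * (norm (app S e))\<^sup>2 + 2 * (norm (app T e))\<^sup>2"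
        using sum_squares_bound[of "norm (app S e)" "norm (app T e)"] by (simp add: power2_sum)
      finally show "(norm (app (S + T) e))\<^sup>2 \<le> 2 * (norm (app S e))\<^sup>2 + 2 * (norm (app T e))\<^sup>2" .
    qed
  qed
next
  fix S T R :: "'a cbop" assume h: "S \<in> hilbert_schmidt" "T \<in> hilbert_schmidt" "R \<in> hilbert_schmidt"
  show "hs_inner (S + T) R = hs_inner S R + hs_inner T R"
    unfolding hs_inner_def by (simp add: cinner_add_left infsum_add hs_inner_summable h)
next
  fix S T :: "'a cbop" and c
  show "hs_inner (c *\<^sub>C S) T = c * hs_inner S T"
    unfolding hs_inner_def by (simp add: cinner_scaleC_left infsum_cmult_right')
  show "hs_inner S T = cnj (hs_inner T S)"
    unfolding hs_inner_def infsum_cnj[symmetric] by (rule infsum_cong) (rule cinner_commute)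
next
  fix T :: "'a cbop"
  assume T: "T \<in> hilbert_schmidt"
  show "0 \<le> Re (hs_inner T T)"
    by (simp add: hs_inner_self[OF T] infsum_nonneg)
  assume z: "hs_inner T T = 0"
  have e0: "app T e = 0" if "e \<in> onb" for e
  proof -
    have "(norm (app T e))\<^sup>2 \<le> (\<Sum>\<^sub>\<infinity>e\<in>onb. (norm (app T e))\<^sup>2)"
      using finite_sum_le_infsum[OF hs_summable[OF T], of "{e}"] that by simp
    then show ?thesis using z by (simp add: hs_inner_self[OF T])
  qed
  show "T = 0"
  proof (rule cbop_eqI)
    fix x
    have "((\<lambda>e. app T (cinner x e *\<^sub>C e)) has_sum app T x) onb"
      by (rule has_sum_bounded_linear[OF bounded_linear_app onb_expansion])
    moreover have "((\<lambda>e. app T (cinner x e *\<^sub>C e)) has_sum 0) onb"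
      by (rule has_sum_0) (simp add: app_scaleC e0)
    ultimately show "app T x = app 0 x" by (simp add: has_sum_unique)
  qed
qed

text \<open>This is the Cauchy--Schwarz inequality for \<open>S\<close> and the rank one operator \<open>\<xi> \<mapsto> \<langle>\<xi>, x\<rangle> S x\<close>.\<close>

lemma norm_app_le_hs:
  assumes S: "S \<in> hilbert_schmidt"
  shows "(norm (app S x))\<^sup>2 \<le> Re (hs_inner S S) * (norm x)\<^sup>2"
proof (cases "app S x = 0")
  case True
  then show ?thesis by (simp add: hs_inner_self[OF S] infsum_nonneg)
next
  case False
  interpret pre_hilbert_carrier "hilbert_schmidt :: 'a cbop set" hs_inner by (rule pre_hilbert_hs)
  let ?O = "outer (app S x) x"
  have "(cmod (hs_inner S ?O))\<^sup>2 \<le> Re (hs_inner S S) * Re (hs_inner ?O ?O)"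
    by (rule cauchy_schwarz[OF S outer_hs])
  moreover have "(cmod (hs_inner S ?O))\<^sup>2 = (norm (app S x))\<^sup>2 * (norm (app S x))\<^sup>2"
    by (simp add: hs_inner_outer cinner_self norm_mult power2_eq_square)
  moreover have "Re (hs_inner ?O ?O) = (norm x)\<^sup>2 * (norm (app S x))\<^sup>2"
  proof -
    have "hs_inner ?O ?O = of_real ((norm x)\<^sup>2 * (norm (app S x))\<^sup>2)"
      by (simp only: hs_inner_outer app_outer cinner_scaleC_left cinner_self of_real_mult)
    then show ?thesis by simp
  qed
  ultimately have "(norm (app S x))\<^sup>2 * (norm (app S x))\<^sup>2 \<le> (Re (hs_inner S S) * (norm x)\<^sup>2) * (norm (app S x))\<^sup>2"
    by (simp add: mult_ac)
  then show ?thesis by (rule mult_right_le_imp_le) (use False in simp)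
qed

text \<open>A Cauchy sequence converges pointwise, by the previous bound; convergence in the Hilbert--Schmidt norm
  follows by letting the index tend to infinity in finite partial sums.\<close>

lemma hilbert_carrier_hs: "hilbert_carrier (hilbert_schmidt :: 'a :: complex_hilbert_space cbop set) hs_inner"
proof (intro hilbert_carrier.intro[OF pre_hilbert_hs] hilbert_carrier_axioms.intro)
  interpret pre_hilbert_carrier "hilbert_schmidt :: 'a cbop set" hs_inner by (rule pre_hilbert_hs)
  fix s :: "nat \<Rightarrow> 'a cbop"
  let ?q = "\<lambda>T. Re (hs_inner T T)"
  assume s: "\<And>k. s k \<in> hilbert_schmidt"
    and c: "\<And>e. e > 0 \<Longrightarrow> \<exists>k0. \<forall>k\<ge>k0. \<forall>m\<ge>k0. ?q (s k - s m) < e"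
  have sd: "s k - s m \<in> hilbert_schmidt" for k m by (rule diff_mem[OF s s])
  have diff_le: "(norm (app (s k) x - app (s m) x))\<^sup>2 \<le> ?q (s k - s m) * (norm x)\<^sup>2" for k m x
    using norm_app_le_hs[OF sd[of k m], of x] by simp
  have "\<exists>l. (\<lambda>k. app (s k) x) \<longlonglongrightarrow> l" for x
  proof -
    have "Cauchy (\<lambda>k. app (s k) x)"
    proof (rule metric_CauchyI)
      fix e :: real assume e: "e > 0"
      define N where "N = (norm x)\<^sup>2 + 1"
      have N: "N > 0" by (simp add: N_def add_nonneg_pos)
      obtain k0 where k0: "\<And>k m. k \<ge> k0 \<Longrightarrow> m \<ge> k0 \<Longrightarrow> ?q (s k - s m) < e\<^sup>2 / N"
        using c[of "e\<^sup>2 / N"] e N by auto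
      have "dist (app (s k) x) (app (s m) x) < e" if "k \<ge> k0" "m \<ge> k0" for k m
      proof -
        have "(norm (app (s k) x - app (s m) x))\<^sup>2 \<le> ?q (s k - s m) * N"
          using diff_le[of k x m] mult_left_mono[of "(norm x)\<^sup>2" N "?q (s k - s m)"] ip_nonneg[OF sd[of k m]]
          by (simp add: N_def)
        also have "\<dots> < e\<^sup>2" using k0[OF that] N by (simp add: field_simps)
        finally show ?thesis unfolding dist_norm using e power_less_imp_less_base[of _ 2 e] by simp
      qed
      then show "\<exists>K. \<forall>k\<ge>K. \<forall>m\<ge>K. dist (app (s k) x) (app (s m) x) < e" by blast
    qed
    then show ?thesis using Cauchy_convergent convergent_def by blast
  qed
  then obtain L where L: "\<And>x. (\<lambda>k. app (s k) x) \<longlonglongrightarrow> L x" by metis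
  obtain k1 where k1: "\<And>k. k \<ge> k1 \<Longrightarrow> ?q (s k - s k1) < 1" using c[of 1] by auto
  obtain B where B: "B > 0" "\<And>x. norm (app (s k1) x) \<le> B * norm x" using app_bound by blast
  have "app (Cbop L) = L"
  proof (rule app_Cbop)
    show "L (x + y) = L x + L y" for x y
      by (rule LIMSEQ_unique[OF L]) (simp add: app_add tendsto_add L)
    fix a x
    have "bounded_linear (\<lambda>y :: 'a. a *\<^sub>C y)"
      by (rule bounded_linear_intro[of _ "cmod a"])
        (simp_all add: scaleC_add_right scaleR_scaleC scaleC_scaleC norm_scaleC mult.commute)
    then have "(\<lambda>k. a *\<^sub>C app (s k) x) \<longlonglongrightarrow> a *\<^sub>C L x" by (rule bounded_linear.tendsto[OF _ L])
    then show "L (a *\<^sub>C x) = a *\<^sub>C L x" using L[of "a *\<^sub>C x"] by (simp add: app_scaleC LIMSEQ_unique)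
  next
    fix x
    have "norm (app (s k) x) \<le> (B + 1) * norm x" if k: "k \<ge> k1" for k
    proof -
      have "(norm (app (s k) x - app (s k1) x))\<^sup>2 \<le> 1 * (norm x)\<^sup>2"
        by (rule order_trans[OF diff_le]) (intro mult_right_mono; use k1[OF k] in simp)
      then have "norm (app (s k) x - app (s k1) x) \<le> norm x" by simp
      then show ?thesis
        using B(2)[of x] norm_triangle_ineq[of "app (s k) x - app (s k1) x" "app (s k1) x"]
        by (simp add: algebra_simps)
    qed
    then show "norm (L x) \<le> (B + 1) * norm x"
      by (intro LIMSEQ_le_const2[OF tendsto_norm[OF L]]) blast
  qed
  then obtain T where T: "app T = L" by blast
  have "T - s k \<in> hilbert_schmidt \<and> ?q (T - s k) \<le> e"
    if e: "e > 0" and k: "\<And>m. m \<ge> k0 \<Longrightarrow> ?q (s m - s k) < e" for k k0 e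
  proof -
    have fin: "(\<Sum>x\<in>F. (norm (app (T - s k) x))\<^sup>2) \<le> e" if F: "finite F" "F \<subseteq> onb" for F
    proof (rule LIMSEQ_le_const2)
      show "(\<lambda>m. \<Sum>x\<in>F. (norm (app (s m - s k) x))\<^sup>2) \<longlonglongrightarrow> (\<Sum>x\<in>F. (norm (app (T - s k) x))\<^sup>2)"
        by (simp add: T, intro tendsto_intros L)
      show "\<exists>N. \<forall>m\<ge>N. (\<Sum>x\<in>F. (norm (app (s m - s k) x))\<^sup>2) \<le> e"
      proof (intro exI allI impI)
        fix m assume "m \<ge> k0"
        have "(\<Sum>x\<in>F. (norm (app (s m - s k) x))\<^sup>2) \<le> (\<Sum>\<^sub>\<infinity>x\<in>onb. (norm (app (s m - s k) x))\<^sup>2)"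
          by (rule finite_sum_le_infsum[OF hs_summable[OF sd] F]) simp
        also have "\<dots> = ?q (s m - s k)" by (simp add: hs_inner_self[OF sd])
        also have "\<dots> \<le> e" using k[OF \<open>m \<ge> k0\<close>] by simp
        finally show "(\<Sum>x\<in>F. (norm (app (s m - s k) x))\<^sup>2) \<le> e" .
      qed
    qed
    have "(\<lambda>x. (norm (app (T - s k) x))\<^sup>2) summable_on onb"
      by (rule nonneg_bdd_above_summable_on) (use fin in \<open>auto intro!: bdd_aboveI[of _ e]\<close>)
    moreover from this have "(\<Sum>\<^sub>\<infinity>x\<in>onb. (norm (app (T - s k) x))\<^sup>2) \<le> e"
      by (rule infsum_le_finite_sums) (use fin in auto)
    ultimately show ?thesis by (simp add: hilbert_schmidt_def hs_inner_self)
  qed note lim = this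
  show "\<exists>v\<in>hilbert_schmidt. \<forall>e>0. \<exists>k0. \<forall>k\<ge>k0. ?q (v - s k) < e"
  proof (intro bexI[of _ T] allI impI)
    fix e :: real assume e: "e > 0"
    obtain k0 where k0: "\<And>k m. k \<ge> k0 \<Longrightarrow> m \<ge> k0 \<Longrightarrow> ?q (s k - s m) < e / 2" using c[of "e / 2"] e by auto
    have "?q (T - s k) < e" if "k \<ge> k0" for k
      using lim[of "e / 2" k0 k] k0 that e by fastforce
    then show "\<exists>k0. \<forall>k\<ge>k0. ?q (T - s k) < e" by blast
  next
    have "T - s k1 \<in> hilbert_schmidt" using lim[of 1 k1 k1] k1 by simp
    from add_mem[OF this s[of k1]] show "T \<in> hilbert_schmidt" by simp
  qed
qed


text \<open>If the span of the orthonormal set \<open>U\<close> contains the range, then \<open>T x = \<Sum>\<^sub>u \<langle>x, T\<^sup>* u\<rangle> u\<close>.\<close>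

lemma finite_rank_decompose:
  assumes "finite_rank T"
  shows "\<exists>U v. finite U \<and> T = (\<Sum>u\<in>U. outer u (v u))"
proof -
  obtain B where B: "finite B" "\<And>x. \<exists>c. app T x = (\<Sum>b\<in>B. c b *\<^sub>C b)"
    using assms unfolding finite_rank_def by blast
  obtain U where U: "finite U" "\<And>b. b \<in> B \<Longrightarrow> b = (\<Sum>u\<in>U. cinner b u *\<^sub>C u)"
    using pre_hilbert_carrier.finite_orthonormal_span[OF
        hilbert_carrier.axioms(1)[OF hilbert_carrier_UNIV] B(1) subset_UNIV] by blast
  have "T = (\<Sum>u\<in>U. outer u (app (adj T) u))"
  proof (rule cbop_eqI)
    fix x
    obtain c where c: "app T x = (\<Sum>b\<in>B. c b *\<^sub>C b)" using B(2) by blast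
    have "app T x = (\<Sum>b\<in>B. \<Sum>u\<in>U. (c b * cinner b u) *\<^sub>C u)"
      unfolding c by (rule sum.cong[OF refl]) (subst U(2), auto simp: scaleC_sum_right scaleC_scaleC)
    also have "\<dots> = (\<Sum>u\<in>U. \<Sum>b\<in>B. (c b * cinner b u) *\<^sub>C u)" by (rule sum.swap)
    also have "\<dots> = (\<Sum>u\<in>U. cinner (app T x) u *\<^sub>C u)"
      by (simp add: c cinner_sum_left cinner_scaleC_left scaleC_sum_left)
    also have "\<dots> = app (\<Sum>u\<in>U. outer u (app (adj T) u)) x"
      by (simp add: app_sum_left cinner_adj_right)
    finally show "app T x = app (\<Sum>u\<in>U. outer u (app (adj T) u)) x" .
  qed
  then show ?thesis using U(1) by (intro exI[of _ U] exI[of _ "\<lambda>u. app (adj T) u"]) blast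
qed

lemma finite_rank_0: "finite_rank 0"
  by (auto simp: finite_rank_def intro!: exI[of _ "{}"])

lemma finite_rank_add:
  assumes "finite_rank S" "finite_rank T"
  shows "finite_rank (S + T)"
proof -
  obtain B where B: "finite B" "\<And>x. \<exists>c. app S x = (\<Sum>b\<in>B. c b *\<^sub>C b)"
    using assms unfolding finite_rank_def by blast
  obtain C where C: "finite C" "\<And>x. \<exists>c. app T x = (\<Sum>b\<in>C. c b *\<^sub>C b)"
    using assms unfolding finite_rank_def by blast
  have "\<exists>c. app (S + T) x = (\<Sum>b\<in>B \<union> C. c b *\<^sub>C b)" for x
  proof -
    obtain c d where c: "app S x = (\<Sum>b\<in>B. c b *\<^sub>C b)" and d: "app T x = (\<Sum>b\<in>C. d b *\<^sub>C b)"
      using B C by meson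
    have 1: "(\<Sum>b\<in>B. c b *\<^sub>C b) = (\<Sum>b\<in>B \<union> C. (if b \<in> B then c b else 0) *\<^sub>C b)"
      using B C by (intro sum.mono_neutral_cong_left) auto
    have 2: "(\<Sum>b\<in>C. d b *\<^sub>C b) = (\<Sum>b\<in>B \<union> C. (if b \<in> C then d b else 0) *\<^sub>C b)"
      using B C by (intro sum.mono_neutral_cong_left) auto
    show ?thesis
      unfolding app_plus c d 1 2 sum.distrib[symmetric] scaleC_add_left[symmetric]
      by (rule exI[of _ "\<lambda>b. (if b \<in> B then c b else 0) + (if b \<in> C then d b else 0)"]) (rule refl)
  qed
  then show ?thesis using B C unfolding finite_rank_def by blast
qed

lemma finite_rank_outer: "finite_rank (outer u v)"
  unfolding finite_rank_def by (intro exI[of _ "{u}"]) auto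

lemma finite_rank_scale: "finite_rank T \<Longrightarrow> finite_rank (c *\<^sub>C T)"
proof -
  assume "finite_rank T"
  then obtain B where B: "finite B" "\<And>x. \<exists>c. app T x = (\<Sum>b\<in>B. c b *\<^sub>C b)"
    unfolding finite_rank_def by blast
  have "\<exists>d. app (c *\<^sub>C T) x = (\<Sum>b\<in>B. d b *\<^sub>C b)" for x
  proof -
    obtain d where "app T x = (\<Sum>b\<in>B. d b *\<^sub>C b)" using B by blast
    then have "app (c *\<^sub>C T) x = (\<Sum>b\<in>B. (c * d b) *\<^sub>C b)" by (simp add: scaleC_sum_right scaleC_scaleC)
    then show ?thesis by (rule exI[of _ "\<lambda>b. c * d b"])
  qed
  then show ?thesis using B unfolding finite_rank_def by blast
qed

lemma finite_rank_sum: "(\<And>i. i \<in> A \<Longrightarrow> finite_rank (f i)) \<Longrightarrow> finite_rank (\<Sum>i\<in>A. f i)"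
  by (induction A rule: infinite_finite_induct) (auto simp: finite_rank_0 finite_rank_add)

lemma finite_rank_mult: "finite_rank T \<Longrightarrow> finite_rank (R * T * S)"
proof -
  assume "finite_rank T"
  then obtain U v where T: "T = (\<Sum>u\<in>U. outer u (v u))" using finite_rank_decompose by blast
  have "R * T * S = (\<Sum>u\<in>U. outer (app R u) (app (adj S) (v u)))"
    by (simp add: T sum_distrib_left sum_distrib_right mult_outer outer_mult)
  then show ?thesis by (simp add: finite_rank_sum finite_rank_outer)
qed

lemma finite_rank_hs: "finite_rank T \<Longrightarrow> T \<in> hilbert_schmidt"
proof -
  interpret hilbert_carrier "hilbert_schmidt :: 'a cbop set" hs_inner by (rule hilbert_carrier_hs)
  assume "finite_rank T"
  then obtain U v where "T = (\<Sum>u\<in>U. outer u (v u))" using finite_rank_decompose by blast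
  then show ?thesis by (auto intro!: csubspace_sum[OF sub] outer_hs)
qed

lemma hs_inner_sum_right:
  assumes "S \<in> hilbert_schmidt" "\<And>i. i \<in> A \<Longrightarrow> f i \<in> hilbert_schmidt"
  shows "hs_inner S (\<Sum>i\<in>A. f i) = (\<Sum>i\<in>A. hs_inner S (f i))"
proof -
  interpret hilbert_carrier "hilbert_schmidt :: 'a cbop set" hs_inner by (rule hilbert_carrier_hs)
  show ?thesis using assms
  proof (induction A rule: infinite_finite_induct)
    case (insert a A)
    then show ?case using ip_add_right[of "f a" "sum f A" S] csubspace_sum[OF sub, of A f] by simp
  qed (simp_all add: ip_zero_right)
qed

lemma hs_mult:
  assumes "T \<in> hilbert_schmidt"
  shows "R * T \<in> hilbert_schmidt"
proof -
  obtain B where B: "B > 0" "\<And>x. norm (app R x) \<le> B * norm x" using app_bound by blast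
  show ?thesis
  proof (rule hs_dominated)
    show "(\<lambda>e. B\<^sup>2 * (norm (app T e))\<^sup>2) summable_on onb"
      by (intro summable_on_cmult_right hs_summable assms)
    show "(norm (app (R * T) e))\<^sup>2 \<le> B\<^sup>2 * (norm (app T e))\<^sup>2" for e
      using power_mono[OF B(2)[of "app T e"] norm_ge_zero, of 2] by (simp add: power_mult_distrib)
  qed
qed

text \<open>For a finite set \<open>F\<close> of basis vectors let \<open>R\<close> be the projection onto their span times \<open>T\<close>. Both
  \<open>\<langle>T, R\<rangle>\<close> and \<open>\<langle>R, R\<rangle>\<close> are the partial sum over \<open>F\<close> of the squared norm of \<open>T\<^sup>*\<close>, so the Cauchy--Schwarz
  inequality bounds it by \<open>\<langle>T, T\<rangle>\<close>.\<close>

lemma hs_adj: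
  assumes T: "T \<in> hilbert_schmidt"
  shows "adj T \<in> hilbert_schmidt"
proof -
  interpret hilbert_carrier "hilbert_schmidt :: 'a cbop set" hs_inner by (rule hilbert_carrier_hs)
  have "(\<Sum>e\<in>F. (norm (app (adj T) e))\<^sup>2) \<le> Re (hs_inner T T)" if F: "finite F" "F \<subseteq> onb" for F
  proof -
    define s where "s = (\<Sum>e\<in>F. (norm (app (adj T) e))\<^sup>2)"
    define R where "R = (\<Sum>e\<in>F. outer e (app (adj T) e))"
    have R: "R \<in> hilbert_schmidt" unfolding R_def by (rule csubspace_sum[OF sub outer_hs])
    have s0: "s \<ge> 0" by (simp add: s_def sum_nonneg)
    have TR: "hs_inner T R = of_real s"
      unfolding R_def by (simp only: hs_inner_sum_right[OF T outer_hs] hs_inner_outer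
          cinner_adj_right[symmetric] cinner_self s_def of_real_sum)
    have "hs_inner R R = (\<Sum>f\<in>F. cinner (app R (app (adj T) f)) f)"
      by (subst (2) R_def) (simp only: hs_inner_sum_right[OF R outer_hs] hs_inner_outer)
    also have "\<dots> = (\<Sum>f\<in>F. of_real ((norm (app (adj T) f))\<^sup>2))"
    proof (rule sum.cong[OF refl])
      fix f assume f: "f \<in> F"
      have ef: "cinner e f = (if e = f then 1 else 0)" if "e \<in> F" for e
        using onb_orth[of e f] that f F(2) by blast
      have "cinner (app R (app (adj T) f)) f = (\<Sum>e\<in>F. cinner (app (adj T) f) (app (adj T) e) * cinner e f)"
        by (simp add: R_def app_sum_left cinner_sum_left cinner_scaleC_left)
      also have "\<dots> = (\<Sum>e\<in>F. if f = e then cinner (app (adj T) f) (app (adj T) f) else 0)"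
        by (rule sum.cong) (auto simp: ef)
      finally show "cinner (app R (app (adj T) f)) f = of_real ((norm (app (adj T) f))\<^sup>2)"
        using f F(1) by (simp add: sum.delta cinner_self)
    qed
    finally have RR: "Re (hs_inner R R) = s" by (simp add: s_def)
    have "s\<^sup>2 \<le> Re (hs_inner T T) * s"
      using cauchy_schwarz[OF T R] by (simp add: TR RR)
    then have "s \<le> Re (hs_inner T T)"
      using s0 ip_nonneg[OF T] by (cases "s = 0") (auto simp: power2_eq_square)
    then show ?thesis by (simp add: s_def)
  qed
  then show ?thesis unfolding hilbert_schmidt_def
    by (auto intro!: nonneg_bdd_above_summable_on bdd_aboveI[of _ "Re (hs_inner T T)"])
qed

lemma hs_mult_right: "T \<in> hilbert_schmidt \<Longrightarrow> T * S \<in> hilbert_schmidt"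
  using hs_adj[OF hs_mult[OF hs_adj, of T "adj S"]] by (simp add: adj_times)

text \<open>For \<open>T\<close> of finite rank both sides are the same finite sum of matrix coefficients of \<open>\<omega>\<close>.\<close>

lemma hs_inner_finite_rank:
  assumes "finite_rank T" and \<omega>: "\<omega> \<in> hilbert_schmidt"
  shows "hs_inner (R * \<omega> * S) T = hs_inner \<omega> (adj R * T * adj S)"
proof -
  obtain U v where T: "T = (\<Sum>u\<in>U. outer u (v u))" using assms finite_rank_decompose by blast
  have "R * \<omega> * S \<in> hilbert_schmidt" by (intro hs_mult hs_mult_right \<omega>)
  then have "hs_inner (R * \<omega> * S) T = (\<Sum>u\<in>U. cinner (app (R * \<omega> * S) (v u)) u)"
    by (simp add: T hs_inner_sum_right outer_hs hs_inner_outer)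
  also have "\<dots> = (\<Sum>u\<in>U. hs_inner \<omega> (outer (app (adj R) u) (app S (v u))))"
    by (simp add: hs_inner_outer cinner_adj_right)
  also have "\<dots> = hs_inner \<omega> (\<Sum>u\<in>U. outer (app (adj R) u) (app S (v u)))"
    by (simp add: hs_inner_sum_right[OF \<omega>] outer_hs)
  also have "(\<Sum>u\<in>U. outer (app (adj R) u) (app S (v u))) = adj R * T * adj S"
    by (simp add: T sum_distrib_left sum_distrib_right mult_outer outer_mult)
  finally show ?thesis .
qed

section \<open>The standard representation\<close>

locale tracial_L2 = tracial M \<tau>
  for M :: "'h :: complex_hilbert_space cbop set" and \<tau> :: "'h cbop \<Rightarrow> complex" +
  fixes \<Lambda> :: "'h cbop \<Rightarrow> 'l :: complex_hilbert_space"
  assumes L2: "is_L2 M \<tau> \<Lambda>"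
begin

lemma Lam_add: "x \<in> M \<Longrightarrow> y \<in> M \<Longrightarrow> \<Lambda> (x + y) = \<Lambda> x + \<Lambda> y"
  and Lam_scale: "x \<in> M \<Longrightarrow> \<Lambda> (c *\<^sub>C x) = c *\<^sub>C \<Lambda> x"
  and cinner_Lam: "x \<in> M \<Longrightarrow> y \<in> M \<Longrightarrow> cinner (\<Lambda> x) (\<Lambda> y) = \<tau> (adj y * x)"
  and Lam_dense: "closure (\<Lambda> ` M) = UNIV"
  using L2 unfolding is_L2_def by blast+

lemma Lam_zero: "\<Lambda> 0 = 0"
  using Lam_scale[OF zero_M, of 0] by simp
lemma Lam_diff: "x \<in> M \<Longrightarrow> y \<in> M \<Longrightarrow> \<Lambda> (x - y) = \<Lambda> x - \<Lambda> y"
  using Lam_add[of x "(-1) *\<^sub>C y"] Lam_scale[of y "-1"] scale_M[of y "-1"] by simp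
lemma Lam_sum: "(\<And>i. i \<in> A \<Longrightarrow> f i \<in> M) \<Longrightarrow> \<Lambda> (\<Sum>i\<in>A. f i) = (\<Sum>i\<in>A. \<Lambda> (f i))"
proof (induction A rule: infinite_finite_induct)
  case (insert a A)
  then show ?case using Lam_add[of "f a" "sum f A"] sum_M[of A f] by simp
qed (simp_all add: Lam_zero)

lemma norm_Lam: "x \<in> M \<Longrightarrow> (norm (\<Lambda> x))\<^sup>2 = Re (\<tau> (adj x * x))"
  using arg_cong[OF cinner_self[of "\<Lambda> x"], of Re] by (simp add: cinner_Lam)

lemma dense_eqI:
  fixes f g :: "'l \<Rightarrow> 'b :: t2_space"
  assumes "continuous_on UNIV f" "continuous_on UNIV g" "\<And>x. x \<in> M \<Longrightarrow> f (\<Lambda> x) = g (\<Lambda> x)"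
  shows "f \<xi> = g \<xi>"
proof -
  have "closure (\<Lambda> ` M) \<subseteq> {\<xi>. f \<xi> = g \<xi>}"
    by (rule closure_minimal[OF _ closed_Collect_eq[OF assms(1,2)]]) (use assms(3) in auto)
  then show ?thesis unfolding Lam_dense by blast
qed

lemma dense_leI:
  fixes f g :: "'l \<Rightarrow> real"
  assumes "continuous_on UNIV f" "continuous_on UNIV g" "\<And>x. x \<in> M \<Longrightarrow> f (\<Lambda> x) \<le> g (\<Lambda> x)"
  shows "f \<xi> \<le> g \<xi>"
proof -
  have "closure (\<Lambda> ` M) \<subseteq> {\<xi>. f \<xi> \<le> g \<xi>}"
    by (rule closure_minimal[OF _ closed_Collect_le[OF assms(1,2)]]) (use assms(3) in auto)
  then show ?thesis unfolding Lam_dense by blast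
qed

lemma continuous_app: "continuous_on S (app T)"
  by (rule bounded_linear.continuous_on[OF bounded_linear_app continuous_on_id, simplified])

lemma continuous_app_comp: "continuous_on S f \<Longrightarrow> continuous_on S (\<lambda>x. app T (f x))"
  by (rule bounded_linear.continuous_on[OF bounded_linear_app])

lemma continuous_scaleC:
  assumes "continuous_on S f"
  shows "continuous_on S (\<lambda>x. c *\<^sub>C (f x :: 'b :: complex_hilbert_space))"
proof -
  have "bounded_linear (\<lambda>y :: 'b. c *\<^sub>C y)"
    by (rule bounded_linear_intro[of _ "cmod c"])
      (simp_all add: scaleC_add_right scaleR_scaleC scaleC_scaleC norm_scaleC mult.commute)
  then show ?thesis by (rule bounded_linear.continuous_on[OF _ assms])
qed

lemma continuous_cinner_left: "continuous_on S f \<Longrightarrow> continuous_on S (\<lambda>x. cinner (f x) (y :: 'b :: complex_hilbert_space))"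
  by (rule bounded_linear.continuous_on[OF bounded_linear_cinner_left])

lemma continuous_cinner_right: "continuous_on S f \<Longrightarrow> continuous_on S (\<lambda>x. cinner (y :: 'b :: complex_hilbert_space) (f x))"
  by (rule bounded_linear.continuous_on[OF bounded_linear_cinner_right])

text \<open>On the dense subspace \<open>\<Lambda>(M)\<close> the map \<open>\<Lambda> x \<mapsto> F x\<close> is Lipschitz continuous, hence it extends.\<close>

lemma extend_from_Lam:
  fixes F :: "'h cbop \<Rightarrow> 'l"
  assumes add: "\<And>x y. x \<in> M \<Longrightarrow> y \<in> M \<Longrightarrow> F (x + y) = F x + F y"
    and bd: "\<And>x. x \<in> M \<Longrightarrow> norm (F x) \<le> B * norm (\<Lambda> x)" and B: "B > 0"
  shows "\<exists>G. continuous_on UNIV G \<and> (\<forall>x\<in>M. G (\<Lambda> x) = F x) \<and> (\<forall>\<xi> \<eta>. G (\<xi> + \<eta>) = G \<xi> + G \<eta>) \<and>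
    (\<forall>\<xi>. norm (G \<xi>) \<le> B * norm \<xi>)"
proof -
  have diff: "norm (F x - F y) \<le> B * norm (\<Lambda> x - \<Lambda> y)" if "x \<in> M" "y \<in> M" for x y
    using add[of "x - y" y] bd[of "x - y"] that by (simp add: minus_M Lam_diff)
  define f where "f = (\<lambda>\<xi>. F (SOME x. x \<in> M \<and> \<Lambda> x = \<xi>))"
  have f: "f (\<Lambda> x) = F x" if x: "x \<in> M" for x
  proof -
    define y where "y = (SOME y. y \<in> M \<and> \<Lambda> y = \<Lambda> x)"
    have "y \<in> M \<and> \<Lambda> y = \<Lambda> x" unfolding y_def by (rule someI[of _ x]) (use x in simp)
    then show ?thesis using diff[of y x] x by (simp add: f_def y_def[symmetric])
  qed
  have "uniformly_continuous_on (\<Lambda> ` M) f"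
    unfolding uniformly_continuous_on_def
  proof (intro allI impI)
    fix e :: real assume e: "0 < e"
    have "dist (f \<eta>) (f \<xi>) < e" if m: "\<xi> \<in> \<Lambda> ` M" "\<eta> \<in> \<Lambda> ` M" and d: "dist \<eta> \<xi> < e / B" for \<xi> \<eta>
    proof -
      obtain x y where xy: "\<xi> = \<Lambda> x" "\<eta> = \<Lambda> y" "x \<in> M" "y \<in> M" using m by blast
      have "dist (f \<eta>) (f \<xi>) \<le> B * dist \<eta> \<xi>" using diff[OF xy(4,3)] by (simp add: dist_norm xy f)
      also have "\<dots> < e" using d B by (simp add: field_simps)
      finally show ?thesis .
    qed
    then show "\<exists>d>0. \<forall>x\<in>\<Lambda> ` M. \<forall>x'\<in>\<Lambda> ` M. dist x' x < d \<longrightarrow> dist (f x') (f x) < e"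
      using e B by (intro exI[of _ "e / B"]) auto
  qed
  then obtain G where G: "uniformly_continuous_on (closure (\<Lambda> ` M)) G" "\<And>\<xi>. \<xi> \<in> \<Lambda> ` M \<Longrightarrow> f \<xi> = G \<xi>"
    by (rule uniformly_continuous_on_extension_on_closure) blast
  have cont: "continuous_on UNIV G"
    using uniformly_continuous_imp_continuous[OF G(1)] by (simp add: Lam_dense)
  have contc: "continuous_on UNIV (\<lambda>\<xi>. G (h \<xi>))" if "continuous_on UNIV h" for h :: "'l \<Rightarrow> 'l"
    using continuous_on_compose2[OF cont that] by simp
  have GL: "G (\<Lambda> x) = F x" if "x \<in> M" for x using G(2)[of "\<Lambda> x"] f[OF that] that by simp
  have add1: "G (\<xi> + \<Lambda> y) = G \<xi> + G (\<Lambda> y)" if "y \<in> M" for \<xi> y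
    by (rule dense_eqI[of "\<lambda>\<xi>. G (\<xi> + \<Lambda> y)" "\<lambda>\<xi>. G \<xi> + G (\<Lambda> y)"])
      (use that in \<open>auto intro!: contc continuous_intros cont simp: GL Lam_add[symmetric] plus_M add\<close>)
  have "G (\<xi> + \<eta>) = G \<xi> + G \<eta>" for \<xi> \<eta>
    by (rule dense_eqI[of "\<lambda>\<eta>. G (\<xi> + \<eta>)" "\<lambda>\<eta>. G \<xi> + G \<eta>"])
      (auto intro!: contc continuous_intros cont simp: add1)
  moreover have "norm (G \<xi>) \<le> B * norm \<xi>" for \<xi>
    by (rule dense_leI[of "\<lambda>\<xi>. norm (G \<xi>)" "\<lambda>\<xi>. B * norm \<xi>"])
      (auto intro!: continuous_intros cont bd simp: GL)
  ultimately show ?thesis using cont GL by blast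
qed

text \<open>Left multiplication by \<open>a\<close> is bounded in the \<open>2\<close>-norm because \<open>\<tau>\<close> is nonnegative on the
  positive operator \<open>x\<^sup>* (B\<^sup>2 - a\<^sup>* a) x\<close>.\<close>

lemma norm_Lam_mult:
  assumes a: "a \<in> M" and x: "x \<in> M" and B: "B > 0" "\<And>\<xi>. norm (app a \<xi>) \<le> B * norm \<xi>"
  shows "norm (\<Lambda> (a * x)) \<le> B * norm (\<Lambda> x)"
proof -
  let ?s = "of_real (B\<^sup>2) *\<^sub>C (adj x * x) - adj (a * x) * (a * x)"
  have m: "adj x * x \<in> M" "adj (a * x) * (a * x) \<in> M" "of_real (B\<^sup>2) *\<^sub>C (adj x * x) \<in> M"
    using a x by (auto intro!: times_M adj_M scale_M)
  have "cinner (app ?s \<xi>) \<xi> = of_real (B\<^sup>2 * (norm (app x \<xi>))\<^sup>2 - (norm (app a (app x \<xi>)))\<^sup>2)" for \<xi>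
    by (simp add: cinner_diff_left cinner_scaleC_left cinner_adj_left adj_times cinner_self)
  moreover have "(norm (app a (app x \<xi>)))\<^sup>2 \<le> B\<^sup>2 * (norm (app x \<xi>))\<^sup>2" for \<xi>
    using power_mono[OF B(2)[of "app x \<xi>"] norm_ge_zero, of 2] by (simp add: power_mult_distrib)
  ultimately have "positive ?s"
    unfolding positive_iff by (simp only: Re_complex_of_real Im_complex_of_real) simp
  then have "0 \<le> Re (\<tau> ?s)" by (intro tau_positive minus_M m)
  then have "(norm (\<Lambda> (a * x)))\<^sup>2 \<le> (B * norm (\<Lambda> x))\<^sup>2"
    using a x by (simp only: tau_diff m tau_scale norm_Lam times_M power_mult_distrib) simp
  then show ?thesis by (rule power2_le_imp_le) (use B in simp)
qed

abbreviation lm :: "'h cbop \<Rightarrow> 'l cbop"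
  where "lm \<equiv> left_mult M \<Lambda>"

lemma app_lm:
  assumes a: "a \<in> M" and x: "x \<in> M"
  shows "app (lm a) (\<Lambda> x) = \<Lambda> (a * x)"
proof -
  obtain B where B: "B > 0" "\<And>\<xi>. norm (app a \<xi>) \<le> B * norm \<xi>" using app_bound by blast
  have "\<exists>G. continuous_on UNIV G \<and> (\<forall>x\<in>M. G (\<Lambda> x) = \<Lambda> (a * x)) \<and> (\<forall>\<xi> \<eta>. G (\<xi> + \<eta>) = G \<xi> + G \<eta>) \<and>
    (\<forall>\<xi>. norm (G \<xi>) \<le> B * norm \<xi>)"
    by (rule extend_from_Lam[OF _ norm_Lam_mult[OF a _ B] B(1)])
      (simp_all add: distrib_left Lam_add times_M a)
  then obtain G where G: "continuous_on UNIV G" "\<And>x. x \<in> M \<Longrightarrow> G (\<Lambda> x) = \<Lambda> (a * x)"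
    "\<And>\<xi> \<eta>. G (\<xi> + \<eta>) = G \<xi> + G \<eta>" "\<And>\<xi>. norm (G \<xi>) \<le> B * norm \<xi>" by blast
  have contc: "continuous_on UNIV (\<lambda>\<xi>. G (h \<xi>))" if "continuous_on UNIV h" for h :: "'l \<Rightarrow> 'l"
    using continuous_on_compose2[OF G(1) that] by simp
  have "app (Cbop G) = G"
  proof (rule app_Cbop[OF G(3) _ G(4)])
    show "G (c *\<^sub>C \<xi>) = c *\<^sub>C G \<xi>" for c \<xi>
      by (rule dense_eqI[of "\<lambda>\<xi>. G (c *\<^sub>C \<xi>)" "\<lambda>\<xi>. c *\<^sub>C G \<xi>"])
        (auto intro!: contc continuous_scaleC G(1) continuous_on_id 
          simp: G(2) Lam_scale[symmetric] scale_M times_M a scaleC_mult_right)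
  qed
  then have "\<exists>T. \<forall>x\<in>M. app T (\<Lambda> x) = \<Lambda> (a * x)" using G(2) by metis
  then have "\<exists>!T. \<forall>x\<in>M. app T (\<Lambda> x) = \<Lambda> (a * x)"
  proof (rule ex_ex1I)
    fix T S assume "\<forall>x\<in>M. app T (\<Lambda> x) = \<Lambda> (a * x)" "\<forall>x\<in>M. app S (\<Lambda> x) = \<Lambda> (a * x)"
    then have TS: "app T (\<Lambda> x) = app S (\<Lambda> x)" if "x \<in> M" for x using that by simp
    have "app T \<xi> = app S \<xi>" for \<xi>
      by (rule dense_eqI[of "app T" "app S", OF continuous_app continuous_app TS])
    then show "T = S" by (rule cbop_eqI)
  qed
  then have "\<forall>x\<in>M. app (lm a) (\<Lambda> x) = \<Lambda> (a * x)" unfolding left_mult_def by (rule theI')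
  then show ?thesis using x by blast
qed

lemma adj_lm:
  assumes a: "a \<in> M"
  shows "adj (lm a) = lm (adj a)"
proof (rule adj_eqI)
  have 1: "cinner (app (lm a) (\<Lambda> x)) \<eta> = cinner (\<Lambda> x) (app (lm (adj a)) \<eta>)" if x: "x \<in> M" for x \<eta>
  proof (rule dense_eqI[of "\<lambda>\<eta>. cinner (app (lm a) (\<Lambda> x)) \<eta>" "\<lambda>\<eta>. cinner (\<Lambda> x) (app (lm (adj a)) \<eta>)"])
    fix y assume y: "y \<in> M"
    show "cinner (app (lm a) (\<Lambda> x)) (\<Lambda> y) = cinner (\<Lambda> x) (app (lm (adj a)) (\<Lambda> y))"
      using a x y by (simp add: app_lm adj_M cinner_Lam times_M adj_times mult.assoc)
  qed (intro continuous_cinner_right continuous_app_comp continuous_on_id)+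
  show "cinner (app (lm a) \<xi>) \<eta> = cinner \<xi> (app (lm (adj a)) \<eta>)" for \<xi> \<eta>
    by (rule dense_eqI[of "\<lambda>\<xi>. cinner (app (lm a) \<xi>) \<eta>" "\<lambda>\<xi>. cinner \<xi> (app (lm (adj a)) \<eta>)"])
      (auto intro!: continuous_cinner_left continuous_app continuous_on_id 1)
qed

lemma norm_Lam_adj: "x \<in> M \<Longrightarrow> norm (\<Lambda> (adj x)) = norm (\<Lambda> x)"
proof -
  assume x: "x \<in> M"
  have "(norm (\<Lambda> (adj x)))\<^sup>2 = (norm (\<Lambda> x))\<^sup>2"
    using x tau_trace[of x "adj x"] by (simp add: norm_Lam adj_M)
  then show ?thesis by (simp add: power2_eq_iff_nonneg)
qed

abbreviation J :: "'l \<Rightarrow> 'l"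
  where "J \<equiv> modular_conj M \<Lambda>"

lemma modular_conj_props:
  shows J_add: "J (\<xi> + \<eta>) = J \<xi> + J \<eta>" and J_scale: "J (c *\<^sub>C \<xi>) = cnj c *\<^sub>C J \<xi>"
    and J_norm: "norm (J \<xi>) = norm \<xi>" and J_Lam: "x \<in> M \<Longrightarrow> J (\<Lambda> x) = \<Lambda> (adj x)"
    and J_cont: "continuous_on UNIV J"
proof -
  let ?P = "\<lambda>J. (\<forall>\<xi> \<eta>. J (\<xi> + \<eta>) = J \<xi> + J \<eta>) \<and> (\<forall>c \<xi>. J (c *\<^sub>C \<xi>) = cnj c *\<^sub>C J \<xi>) \<and>
      (\<forall>\<xi>. norm (J \<xi>) = norm \<xi>) \<and> (\<forall>x\<in>M. J (\<Lambda> x) = \<Lambda> (adj x))"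
  have cont: "continuous_on UNIV G" if "?P G" for G
  proof -
    have "bounded_linear G"
      by (rule bounded_linear_intro[of _ 1]) (use that in \<open>auto simp: scaleR_scaleC\<close>)
    then show ?thesis by (rule linear_continuous_on)
  qed
  have "\<exists>G. continuous_on UNIV G \<and> (\<forall>x\<in>M. G (\<Lambda> x) = \<Lambda> (adj x)) \<and> (\<forall>\<xi> \<eta>. G (\<xi> + \<eta>) = G \<xi> + G \<eta>) \<and>
    (\<forall>\<xi>. norm (G \<xi>) \<le> 1 * norm \<xi>)"
    by (rule extend_from_Lam) (simp_all add: adj_plus Lam_add adj_M norm_Lam_adj)
  then obtain G where G: "continuous_on UNIV G" "\<And>x. x \<in> M \<Longrightarrow> G (\<Lambda> x) = \<Lambda> (adj x)"
    "\<And>\<xi> \<eta>. G (\<xi> + \<eta>) = G \<xi> + G \<eta>" by blast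
  have contc: "continuous_on UNIV (\<lambda>\<xi>. G (h \<xi>))" if "continuous_on UNIV h" for h :: "'l \<Rightarrow> 'l"
    using continuous_on_compose2[OF G(1) that] by simp
  have "G (c *\<^sub>C \<xi>) = cnj c *\<^sub>C G \<xi>" for c \<xi>
    by (rule dense_eqI[of "\<lambda>\<xi>. G (c *\<^sub>C \<xi>)" "\<lambda>\<xi>. cnj c *\<^sub>C G \<xi>"])
      (auto intro!: contc continuous_scaleC G(1) continuous_on_id 
        simp: G(2) Lam_scale[symmetric] scale_M adj_M adj_scaleC)
  moreover have "norm (G \<xi>) = norm \<xi>" for \<xi>
    by (rule dense_eqI[of "\<lambda>\<xi>. norm (G \<xi>)" norm])
      (auto intro!: continuous_intros G(1) simp: G(2) norm_Lam_adj)
  ultimately have "?P G" using G by blast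
  then have "\<exists>!J. ?P J"
  proof (rule ex1I[of ?P G])
    fix G' assume G': "?P G'"
    have "G' \<xi> = G \<xi>" for \<xi>
      by (rule dense_eqI[of G' G, OF cont[OF G'] G(1)]) (use G' G(2) in simp)
    then show "G' = G" by blast
  qed
  then have P: "?P J" unfolding modular_conj_def by (rule theI')
  then show "J (\<xi> + \<eta>) = J \<xi> + J \<eta>" "J (c *\<^sub>C \<xi>) = cnj c *\<^sub>C J \<xi>" "norm (J \<xi>) = norm \<xi>"
    "x \<in> M \<Longrightarrow> J (\<Lambda> x) = \<Lambda> (adj x)" by blast+
  show "continuous_on UNIV J" by (rule cont[OF P])
qed

text \<open>The operator \<open>J x J\<close> is right multiplication by \<open>x\<^sup>*\<close> on \<open>\<Lambda>(M)\<close>.\<close>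

definition rm :: "'h cbop \<Rightarrow> 'l \<Rightarrow> 'l"
  where "rm x \<xi> = J (app (lm x) (J \<xi>))"

lemma rm_add: "rm x (\<xi> + \<eta>) = rm x \<xi> + rm x \<eta>"
  by (simp add: rm_def J_add app_add)
lemma rm_scale: "rm x (c *\<^sub>C \<xi>) = c *\<^sub>C rm x \<xi>"
  by (simp add: rm_def J_scale app_scaleC)
lemma rm_zero: "rm x 0 = 0"
  using rm_scale[of x 0 0] by simp
lemma rm_sum: "rm x (\<Sum>i\<in>A. f i) = (\<Sum>i\<in>A. rm x (f i))"
  by (induction A rule: infinite_finite_induct) (auto simp: rm_zero rm_add)
lemma rm_cont: "continuous_on UNIV (rm x)"
  unfolding rm_def
  by (rule continuous_on_compose2[OF J_cont continuous_app_comp[OF J_cont]]) simp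

lemma rm_Lam: "x \<in> M \<Longrightarrow> y \<in> M \<Longrightarrow> rm x (\<Lambda> y) = \<Lambda> (y * adj x)"
  by (simp add: rm_def J_Lam app_lm adj_M times_M adj_times)

lemma rm_lm: "x \<in> M \<Longrightarrow> a \<in> M \<Longrightarrow> rm x (app (lm a) \<xi>) = app (lm a) (rm x \<xi>)"
  by (rule dense_eqI[of "\<lambda>\<xi>. rm x (app (lm a) \<xi>)" "\<lambda>\<xi>. app (lm a) (rm x \<xi>)"])
    (auto intro!: continuous_app_comp continuous_app rm_cont continuous_on_compose2[OF rm_cont]
      simp: rm_Lam app_lm times_M adj_M mult.assoc)

lemma cinner_rm:
  assumes x: "x \<in> M" and y: "y \<in> M"
  shows "cinner (rm x \<xi>) (\<Lambda> y) = cinner \<xi> (\<Lambda> (y * x))"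
proof (rule dense_eqI[of "\<lambda>\<xi>. cinner (rm x \<xi>) (\<Lambda> y)" "\<lambda>\<xi>. cinner \<xi> (\<Lambda> (y * x))"])
  fix z assume z: "z \<in> M"
  have "\<tau> (adj y * (z * adj x)) = \<tau> (adj x * (adj y * z))"
    using tau_trace[of "adj y * z" "adj x"] x y z by (simp add: times_M adj_M mult.assoc)
  then show "cinner (rm x (\<Lambda> z)) (\<Lambda> y) = cinner (\<Lambda> z) (\<Lambda> (y * x))"
    using x y z by (simp add: rm_Lam cinner_Lam times_M adj_M adj_times mult.assoc)
qed (intro continuous_cinner_left rm_cont continuous_on_id)+

lemma tau_adj: "x \<in> M \<Longrightarrow> \<tau> (adj x) = cnj (\<tau> x)"
  using cinner_commute[of "\<Lambda> 1" "\<Lambda> x"] by (simp add: cinner_Lam one_M)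


section \<open>Trace vectors and the vanishing of the commuting tuples\<close>

lemma bimodule_span_csubspace:
  "csubspace {\<Sum>i<m. lm (a i) * \<omega> * lm (b i) | (m :: nat) a b. \<forall>i<m. a i \<in> M \<and> b i \<in> M}"
  (is "csubspace ?A")
proof -
  have lm_scale: "lm (c *\<^sub>C a) = c *\<^sub>C lm a" if a: "a \<in> M" for c a
  proof (rule cbop_eqI)
    show "app (lm (c *\<^sub>C a)) \<xi> = app (c *\<^sub>C lm a) \<xi>" for \<xi>
      by (rule dense_eqI[of "app (lm (c *\<^sub>C a))" "app (c *\<^sub>C lm a)"])
        (use a in \<open>auto intro!: continuous_app continuous_scaleC simp: app_lm scale_M scaleC_mult_left Lam_scale times_M\<close>)
  qed
  have split: "(\<Sum>i<m + k. f i) = (\<Sum>i<m. f i) + (\<Sum>i<k. f (m + i))" for f :: "nat \<Rightarrow> 'l cbop" and m k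
    by (induction k) (simp_all add: add.assoc)
  show ?thesis unfolding csubspace_def
  proof (intro conjI ballI allI)
    show "0 \<in> ?A" by (rule CollectI, rule exI[of _ 0]) auto
    fix S assume "S \<in> ?A"
    then obtain m :: nat and a b where S: "S = (\<Sum>i<m. lm (a i) * \<omega> * lm (b i))" "\<forall>i<m. a i \<in> M \<and> b i \<in> M" by blast
    show "c *\<^sub>C S \<in> ?A" for c
      by (rule CollectI, rule exI[of _ m], rule exI[of _ "\<lambda>i. c *\<^sub>C a i"], rule exI[of _ b])
        (use S in \<open>auto simp: scaleC_sum_right lm_scale scaleC_mult_left scale_M\<close>)
    fix T assume "T \<in> ?A"
    then obtain k :: nat and a' b' where T: "T = (\<Sum>i<k. lm (a' i) * \<omega> * lm (b' i))" "\<forall>i<k. a' i \<in> M \<and> b' i \<in> M" by blast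
    show "S + T \<in> ?A"
      by (rule CollectI, rule exI[of _ "m + k"], rule exI[of _ "\<lambda>i. if i < m then a i else a' (i - m)"],
        rule exI[of _ "\<lambda>i. if i < m then b i else b' (i - m)"])
        (use S T in \<open>auto simp: split\<close>)
  qed
qed

text \<open>For the projection \<open>\<omega>\<close> onto the line of \<open>\<Lambda> 1\<close>, the operator \<open>a \<omega> b\<close> is the rank one operator given
  by \<open>\<Lambda> a\<close> and \<open>\<Lambda> (b\<^sup>*)\<close>. An operator orthogonal to all of these has vanishing matrix coefficients on the
  dense subspace \<open>\<Lambda>(M)\<close>.\<close>

lemma trace_vector_exists: "\<exists>\<omega>. trace_vector M \<tau> \<Lambda> \<omega>"
proof
  let ?o = "outer (\<Lambda> 1) (\<Lambda> 1)"
  let ?A = "{\<Sum>i<m. lm (a i) * ?o * lm (b i) | (m :: nat) a b. \<forall>i<m. a i \<in> M \<and> b i \<in> M}"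
  interpret H: hilbert_carrier "hilbert_schmidt :: 'l cbop set" hs_inner by (rule hilbert_carrier_hs)
  have e: "lm a * ?o * lm b = outer (\<Lambda> a) (\<Lambda> (adj b))" if "a \<in> M" "b \<in> M" for a b
    using that by (simp add: mult_outer outer_mult adj_lm app_lm one_M adj_M)
  have A: "?A \<subseteq> hilbert_schmidt"
    by (auto intro!: csubspace_sum[OF H.sub] hs_mult_right[OF hs_mult[OF outer_hs]])
  let ?K = "ip_closure hs_inner hilbert_schmidt ?A"
  note K = H.closure_csubspace[OF bimodule_span_csubspace A] H.closure_subset_carrier H.closure_closed[OF A]
  show "trace_vector M \<tau> \<Lambda> ?o"
    unfolding trace_vector_def
  proof (intro conjI ballI)
    show "?o \<in> hilbert_schmidt" by (rule outer_hs)
    show "hs_inner (lm a * ?o * lm b) ?o = \<tau> a * \<tau> b" if "a \<in> M" "b \<in> M" for a b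
      using that by (simp add: e hs_inner_outer cinner_Lam one_M adj_M cinner_scaleC_left)
    show "?K = hilbert_schmidt"
    proof (rule equalityI[OF H.closure_subset_carrier subsetI])
      fix T :: "'l cbop" assume T: "T \<in> hilbert_schmidt"
      define z where "z = T - orth_proj hs_inner ?K T"
      have "cinner (app z (\<Lambda> b)) (\<Lambda> a) = 0" if "a \<in> M" "b \<in> M" for a b
      proof -
        have "outer (\<Lambda> a) (\<Lambda> b) \<in> ?A"
          by (rule CollectI, rule exI[of _ 1], rule exI[of _ "\<lambda>_. a"], rule exI[of _ "\<lambda>_. adj b"])
            (use that in \<open>simp add: e adj_M\<close>)
        then have "outer (\<Lambda> a) (\<Lambda> b) \<in> ?K" using H.subset_closure[OF A] by blast
        then have "hs_inner z (outer (\<Lambda> a) (\<Lambda> b)) = 0"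
          unfolding z_def by (rule H.orth_proj_orth[OF K T])
        then show ?thesis by (simp add: hs_inner_outer)
      qed
      note z1 = this
      have z2: "cinner (app z (\<Lambda> b)) \<eta> = 0" if "b \<in> M" for b \<eta>
        by (rule dense_eqI[of "\<lambda>\<eta>. cinner (app z (\<Lambda> b)) \<eta>" "\<lambda>_. 0"])
          (use z1 that in \<open>auto intro!: continuous_cinner_right continuous_on_id\<close>)
      have z3: "app z (\<Lambda> b) = 0" if "b \<in> M" for b
        by (rule cinner_eqI) (simp add: z2 that)
      have "app z \<xi> = 0" for \<xi>
        by (rule dense_eqI[of "app z" "\<lambda>_. 0"]) (auto intro!: continuous_app simp: z3)
      then have "z = 0" by (intro cbop_eqI) simp
      then show "T \<in> ?K" using H.orth_proj_mem[OF K T] by (simp add: z_def)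
    qed
  qed
qed

lemma commuting_tuples_iff:
  "T \<in> commuting_tuples M \<Lambda> n X \<longleftrightarrow>
    T \<in> tuples n {S. finite_rank S} \<and> (\<forall>\<xi>. (\<Sum>j<n. app (T j) (rm (X j) \<xi>) - rm (X j) (app (T j) \<xi>)) = 0)"
  by (simp add: commuting_tuples_def Let_def rm_def)

lemma commuting_tuples_csubspace: "csubspace (commuting_tuples M \<Lambda> n X)"
  unfolding csubspace_def
proof (intro conjI ballI allI)
  show "0 \<in> commuting_tuples M \<Lambda> n X"
    by (simp add: commuting_tuples_iff tuples_def finite_rank_0 rm_zero)
  fix S assume S: "S \<in> commuting_tuples M \<Lambda> n X"
  show "c *\<^sub>C S \<in> commuting_tuples M \<Lambda> n X" for c
  proof -
    have "(\<Sum>j<n. app ((c *\<^sub>C S) j) (rm (X j) \<xi>) - rm (X j) (app ((c *\<^sub>C S) j) \<xi>)) =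
      c *\<^sub>C (\<Sum>j<n. app (S j) (rm (X j) \<xi>) - rm (X j) (app (S j) \<xi>))" for \<xi>
      by (simp add: scaleC_sum_right rm_scale scaleC_diff_right)
    then show ?thesis using S by (simp add: commuting_tuples_iff tuples_def finite_rank_scale)
  qed
  fix T assume T: "T \<in> commuting_tuples M \<Lambda> n X"
  have "(\<Sum>j<n. app ((S + T) j) (rm (X j) \<xi>) - rm (X j) (app ((S + T) j) \<xi>)) =
     (\<Sum>j<n. app (S j) (rm (X j) \<xi>) - rm (X j) (app (S j) \<xi>)) + (\<Sum>j<n. app (T j) (rm (X j) \<xi>) - rm (X j) (app (T j) \<xi>))" for \<xi>
    unfolding sum.distrib[symmetric] by (rule sum.cong) (simp_all add: rm_add)
  then show "S + T \<in> commuting_tuples M \<Lambda> n X"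
    using S T by (simp add: commuting_tuples_iff tuples_def finite_rank_add)
qed

text \<open>The commuting tuples are invariant under both actions of \<open>M\<close> because these commute with
  \<open>J X\<^sub>j J\<close>.\<close>

lemma commuting_tuples_bimodule:
  assumes X: "\<forall>j<n. X j \<in> M" and T: "T \<in> commuting_tuples M \<Lambda> n X" and ab: "a \<in> M" "b \<in> M"
  shows "(\<lambda>j. lm a * T j * lm b) \<in> commuting_tuples M \<Lambda> n X"
proof -
  have "(\<Sum>j<n. app (lm a * T j * lm b) (rm (X j) \<xi>) - rm (X j) (app (lm a * T j * lm b) \<xi>)) = 0" for \<xi>
  proof -
    have "(\<Sum>j<n. app (lm a * T j * lm b) (rm (X j) \<xi>) - rm (X j) (app (lm a * T j * lm b) \<xi>)) =
      (\<Sum>j<n. app (lm a) (app (T j) (rm (X j) (app (lm b) \<xi>)) - rm (X j) (app (T j) (app (lm b) \<xi>))))"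
      by (rule sum.cong) (use X ab in \<open>simp_all add: rm_lm app_diff\<close>)
    also have "\<dots> = app (lm a) 0" using T by (simp only: app_sum[symmetric] commuting_tuples_iff)
    finally show ?thesis by simp
  qed
  then show ?thesis using T by (simp add: commuting_tuples_iff tuples_def finite_rank_mult)
qed

text \<open>The \<open>i\<close>-th term of the dimension is the squared norm of the projection of \<open>\<omega> e\<^sub>i\<close> to the closure of the
  commuting tuples, so it vanishes. Hence \<open>\<omega>\<close> is orthogonal to \<open>a\<^sup>* T\<^sub>j b\<^sup>*\<close>, that is \<open>a \<omega> b\<close> is orthogonal to \<open>T\<^sub>j\<close>, for all
  \<open>a\<close> and \<open>b\<close> in \<open>M\<close>.\<close>

lemma commuting_tuples_trivial:
  assumes X: "\<forall>j<n. X j \<in> M" and D: "Delta M \<tau> \<Lambda> n X = real n"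
    and T: "T \<in> commuting_tuples M \<Lambda> n X" and j: "j < n"
  shows "T j = 0"
proof -
  let ?C = "commuting_tuples M \<Lambda> n X" and ?V = "tuples n (hilbert_schmidt :: 'l cbop set)"
  let ?ip = "tuple_ip (hs_inner :: 'l cbop \<Rightarrow> _) n"
  let ?K = "ip_closure ?ip ?V ?C"
  define \<omega> where "\<omega> = (SOME \<omega>. trace_vector M \<tau> \<Lambda> \<omega>)"
  have tv: "trace_vector M \<tau> \<Lambda> \<omega>" unfolding \<omega>_def by (rule someI_ex[OF trace_vector_exists])
  have \<omega>: "\<omega> \<in> hilbert_schmidt" using tv by (simp add: trace_vector_def)
  interpret H: hilbert_carrier "hilbert_schmidt :: 'l cbop set" hs_inner by (rule hilbert_carrier_hs)
  interpret N: hilbert_carrier ?V ?ip by (rule hilbert_carrier_tuples[OF hilbert_carrier_hs])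
  have C: "?C \<subseteq> ?V" by (auto simp: commuting_tuples_iff tuples_def finite_rank_hs)
  note K = N.closure_csubspace[OF commuting_tuples_csubspace C] N.closure_subset_carrier N.closure_closed[OF C]
  have sV: "single i \<omega> \<in> ?V" if "i < n" for i using that \<omega> H.zero_mem by (simp add: single_def tuples_def)
  have ips: "?ip v (single i \<omega>) = hs_inner (v i) \<omega>" if "v \<in> ?V" "i < n" for v i
  proof -
    have "?ip v (single i \<omega>) = (\<Sum>k<n. if i = k then hs_inner (v k) \<omega> else 0)"
      unfolding tuple_ip_def by (rule sum.cong) (use that in \<open>auto simp: single_def tuples_def H.ip_zero_right\<close>)
    then show ?thesis using that by (simp add: sum.delta)
  qed
  let ?P = "orth_proj ?ip ?K"
  have PV: "?P (single i \<omega>) \<in> ?V" if "i < n" for i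
    using N.orth_proj_mem[OF K sV[OF that]] K(2) by blast
  have diag: "hs_inner (?P (single i \<omega>) i) \<omega> = ?ip (?P (single i \<omega>)) (?P (single i \<omega>))" if i: "i < n" for i
  proof -
    let ?w = "?P (single i \<omega>)"
    have "?ip (single i \<omega> - ?w) ?w = 0"
      by (rule N.orth_proj_orth[OF K sV[OF i] N.orth_proj_mem[OF K sV[OF i]]])
    then have "?ip ?w (single i \<omega> - ?w) = 0"
      using N.ip_commute[OF PV[OF i] N.diff_mem[OF sV[OF i] PV[OF i]]] by simp
    then show ?thesis using ips[OF PV[OF i] i] by (simp add: N.ip_diff_right sV[OF i] PV[OF i])
  qed
  have "bimod_dim M \<tau> \<Lambda> n ?K = (\<Sum>i<n. Re (hs_inner (?P (single i \<omega>) i) \<omega>))"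
    unfolding bimod_dim_def \<omega>_def[symmetric] Let_def single_def by (rule refl)
  then have "(\<Sum>i<n. Re (?ip (?P (single i \<omega>)) (?P (single i \<omega>)))) = 0"
    using D by (simp add: Delta_def diag)
  then have "Re (?ip (?P (single j \<omega>)) (?P (single j \<omega>))) = 0"
    by (subst (asm) sum_nonneg_eq_0_iff) (use j in \<open>auto intro!: N.ip_nonneg PV\<close>)
  then have "?ip (?P (single j \<omega>)) (?P (single j \<omega>)) = 0"
    using N.ip_self[OF PV[OF j]] by simp
  then have P0: "?P (single j \<omega>) = 0" by (rule N.ip_definite[OF PV[OF j]])
  have orth: "hs_inner \<omega> (S j) = 0" if S: "S \<in> ?C" for S
  proof -
    have "S \<in> ?K" using S N.subset_closure[OF C] by blast
    from N.orth_proj_orth[OF K sV[OF j] this] have "?ip (single j \<omega>) S = 0" by (simp add: P0)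
    moreover have SV: "S \<in> ?V" using S C by blast
    ultimately have "hs_inner (S j) \<omega> = 0" using N.ip_commute[OF SV sV[OF j]] ips[OF SV j] by simp
    moreover have "S j \<in> hilbert_schmidt" using SV j by (simp add: tuples_def)
    ultimately show ?thesis using H.ip_commute[OF \<omega>, of "S j"] by simp
  qed
  have fr: "finite_rank (T j)" using T j by (simp add: commuting_tuples_iff tuples_def)
  then have Tj: "T j \<in> hilbert_schmidt" by (rule finite_rank_hs)
  let ?A = "{\<Sum>i<m. lm (a i) * \<omega> * lm (b i) | (m :: nat) a b. \<forall>i<m. a i \<in> M \<and> b i \<in> M}"
  have A: "?A \<subseteq> hilbert_schmidt"
    by (auto intro!: csubspace_sum[OF H.sub] hs_mult_right[OF hs_mult[OF \<omega>]])
  have o1: "hs_inner (lm a * \<omega> * lm b) (T j) = 0" if "a \<in> M" "b \<in> M" for a b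
    using orth[OF commuting_tuples_bimodule[OF X T, of "adj a" "adj b"]] that
    by (simp add: hs_inner_finite_rank[OF fr \<omega>] adj_lm adj_M)
  have "hs_inner (T j) S = 0" if S: "S \<in> ?A" for S
  proof -
    obtain m :: nat and a b where S': "S = (\<Sum>i<m. lm (a i) * \<omega> * lm (b i))" "\<forall>i<m. a i \<in> M \<and> b i \<in> M"
      using S by blast
    have "hs_inner S (T j) = (\<Sum>i<m. hs_inner (lm (a i) * \<omega> * lm (b i)) (T j))"
      unfolding S'(1) by (rule H.ip_sum_left[OF _ Tj]) (rule hs_mult_right[OF hs_mult[OF \<omega>]])
    also have "\<dots> = 0" using S'(2) o1 by simp
    finally show ?thesis using H.ip_commute[OF Tj, of S] A S by auto
  qed
  moreover have "T j \<in> ip_closure hs_inner hilbert_schmidt ?A"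
    using tv Tj unfolding trace_vector_def by blast
  ultimately have "hs_inner (T j) (T j) = 0" by (rule H.orth_closure[OF A Tj])
  then show ?thesis by (rule H.ip_definite[OF Tj])
qed


section \<open>The pairing of the kernels of a linear pencil\<close>

definition pencil :: "nat \<Rightarrow> (nat \<Rightarrow> nat \<Rightarrow> complex) \<Rightarrow> (nat \<Rightarrow> nat \<Rightarrow> nat \<Rightarrow> complex) \<Rightarrow> (nat \<Rightarrow> 'h cbop) \<Rightarrow> nat \<Rightarrow> nat \<Rightarrow> 'h cbop"
  where "pencil n a0 a X k l = a0 k l *\<^sub>C 1 + (\<Sum>j<n. a j k l *\<^sub>C X j)"

lemma Lam_linear_relation:
  assumes x: "\<And>l. l < K \<Longrightarrow> x l \<in> M" and y: "\<And>j l. j < n \<Longrightarrow> l < K \<Longrightarrow> y j l \<in> M"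
    and rel: "(\<Sum>l<K. c0 l *\<^sub>C x l + (\<Sum>j<n. c j l *\<^sub>C y j l)) = 0"
  shows "(\<Sum>l<K. \<Sum>j<n. c j l *\<^sub>C \<Lambda> (y j l)) = - (\<Sum>l<K. c0 l *\<^sub>C \<Lambda> (x l))"
proof -
  have sm: "(\<Sum>j<n. c j l *\<^sub>C y j l) \<in> M" if "l < K" for l
    using that by (intro sum_M scale_M y) auto
  have "\<Lambda> (\<Sum>l<K. c0 l *\<^sub>C x l + (\<Sum>j<n. c j l *\<^sub>C y j l)) =
    (\<Sum>l<K. \<Lambda> (c0 l *\<^sub>C x l + (\<Sum>j<n. c j l *\<^sub>C y j l)))"
    by (rule Lam_sum) (auto intro!: plus_M scale_M x sm)
  also have "\<dots> = (\<Sum>l<K. c0 l *\<^sub>C \<Lambda> (x l) + (\<Sum>j<n. c j l *\<^sub>C \<Lambda> (y j l)))"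
  proof (rule sum.cong[OF refl])
    fix l assume "l \<in> {..<K}"
    then have l: "l < K" by simp
    have "\<Lambda> (\<Sum>j<n. c j l *\<^sub>C y j l) = (\<Sum>j<n. \<Lambda> (c j l *\<^sub>C y j l))"
      by (rule Lam_sum) (use l y in \<open>auto intro: scale_M\<close>)
    also have "\<dots> = (\<Sum>j<n. c j l *\<^sub>C \<Lambda> (y j l))"
      by (rule sum.cong) (simp_all add: Lam_scale y l)
    finally show "\<Lambda> (c0 l *\<^sub>C x l + (\<Sum>j<n. c j l *\<^sub>C y j l)) =
      c0 l *\<^sub>C \<Lambda> (x l) + (\<Sum>j<n. c j l *\<^sub>C \<Lambda> (y j l))"
      by (simp add: Lam_add[OF scale_M[OF x[OF l]] sm[OF l]] Lam_scale[OF x[OF l]])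
  qed
  finally have "(\<Sum>l<K. c0 l *\<^sub>C \<Lambda> (x l)) + (\<Sum>l<K. \<Sum>j<n. c j l *\<^sub>C \<Lambda> (y j l)) = 0"
    using rel Lam_zero by (simp add: sum.distrib)
  then show ?thesis by (simp add: eq_neg_iff_add_eq_0 add.commute)
qed

text \<open>Let \<open>R k l\<close> be the rank one operator \<open>\<xi> \<mapsto> \<langle>\<xi>, \<Lambda> (g\<^sub>k\<^sup>*)\<rangle> \<Lambda> (f\<^sub>l\<^sup>*)\<close>. The operators \<open>T j = \<Sum>k l. cnj (a j k l) R k l\<close>
  form a commuting tuple: the equation for \<open>g\<close> shows that \<open>\<Sum>j. T j (J X\<^sub>j J)\<close> equals \<open>- \<Sum>k l. cnj (a0 k l) R k l\<close>,
  and the equation for \<open>f\<close> shows the same for \<open>\<Sum>j. (J X\<^sub>j J) T j\<close>. So \<open>T j = 0\<close>, and the pairing is the complex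
  conjugate of the matrix coefficient of \<open>T j\<close> at \<open>\<Lambda> 1\<close>.\<close>

lemma pencil_pairing:
  assumes X: "\<forall>j<n. X j \<in> M" and D: "Delta M \<tau> \<Lambda> n X = real n"
    and f: "\<And>l. l < K \<Longrightarrow> f l \<in> M" and g: "\<And>k. k < K \<Longrightarrow> g k \<in> M"
    and Af: "\<And>k. k < K \<Longrightarrow> (\<Sum>l<K. pencil n a0 a X k l * f l) = 0"
    and Ag: "\<And>l. l < K \<Longrightarrow> (\<Sum>k<K. adj (pencil n a0 a X k l) * g k) = 0"
    and j: "j < n"
  shows "(\<Sum>k<K. \<Sum>l<K. a j k l * cnj (\<tau> (g k)) * \<tau> (f l)) = 0"
proof -
  define u where "u = (\<lambda>l. \<Lambda> (adj (f l)))"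
  define v where "v = (\<lambda>k. \<Lambda> (adj (g k)))"
  define w where "w = (\<lambda>j k. \<Lambda> (adj (g k) * X j))"
  define T where "T = (\<lambda>j. if j < n then \<Sum>k<K. \<Sum>l<K. cnj (a j k l) *\<^sub>C outer (u l) (v k) else 0)"
  have XM: "X j \<in> M" if "j < n" for j using X that by blast
  have ru: "rm (X j) (u l) = \<Lambda> (adj (X j * f l))" if "j < n" "l < K" for j l
    using that by (simp add: u_def rm_Lam XM adj_M f adj_times)
  have LF: "(\<Sum>l<K. \<Sum>j<n. cnj (a j k l) *\<^sub>C rm (X j) (u l)) = - (\<Sum>l<K. cnj (a0 k l) *\<^sub>C u l)" if k: "k < K" for k
  proof -
    have "0 = adj (\<Sum>l<K. pencil n a0 a X k l * f l)" using Af[OF k] by simp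
    also have "\<dots> = (\<Sum>l<K. cnj (a0 k l) *\<^sub>C adj (f l) + (\<Sum>j<n. cnj (a j k l) *\<^sub>C adj (X j * f l)))"
      by (simp add: pencil_def adj_sum adj_plus adj_scaleC adj_times distrib_left
          scaleC_mult_right sum_distrib_left)
    finally have "(\<Sum>l<K. \<Sum>j<n. cnj (a j k l) *\<^sub>C \<Lambda> (adj (X j * f l))) = - (\<Sum>l<K. cnj (a0 k l) *\<^sub>C u l)"
      unfolding u_def by (intro Lam_linear_relation[OF _ _ sym]) (auto intro!: adj_M times_M XM f)
    moreover have "(\<Sum>l<K. \<Sum>j<n. cnj (a j k l) *\<^sub>C rm (X j) (u l)) =
      (\<Sum>l<K. \<Sum>j<n. cnj (a j k l) *\<^sub>C \<Lambda> (adj (X j * f l)))"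
      by (intro sum.cong refl) (simp add: ru)
    ultimately show ?thesis by simp
  qed
  have LG: "(\<Sum>k<K. \<Sum>j<n. a j k l *\<^sub>C w j k) = - (\<Sum>k<K. a0 k l *\<^sub>C v k)" if l: "l < K" for l
  proof -
    have "0 = adj (\<Sum>k<K. adj (pencil n a0 a X k l) * g k)" using Ag[OF l] by simp
    also have "\<dots> = (\<Sum>k<K. a0 k l *\<^sub>C adj (g k) + (\<Sum>j<n. a j k l *\<^sub>C (adj (g k) * X j)))"
      by (simp add: pencil_def adj_sum adj_plus adj_scaleC adj_times distrib_left
          scaleC_mult_right sum_distrib_left)
    finally show ?thesis
      unfolding v_def w_def by (intro Lam_linear_relation[OF _ _ sym]) (auto intro!: adj_M times_M XM g)
  qed
  have Tapp: "app (T j) \<xi> = (\<Sum>k<K. \<Sum>l<K. (cnj (a j k l) * cinner \<xi> (v k)) *\<^sub>C u l)" if "j < n" for j \<xi>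
    using that by (simp add: T_def app_sum_left scaleC_scaleC)
  have "(\<Sum>j<n. app (T j) (rm (X j) \<xi>) - rm (X j) (app (T j) \<xi>)) = 0" for \<xi>
  proof -
    have "(\<Sum>j<n. app (T j) (rm (X j) \<xi>)) = (\<Sum>j<n. \<Sum>k<K. \<Sum>l<K. (cnj (a j k l) * cinner \<xi> (w j k)) *\<^sub>C u l)"
      by (intro sum.cong refl) (simp add: Tapp v_def w_def cinner_rm XM adj_M g)
    also have "\<dots> = (\<Sum>k<K. \<Sum>j<n. \<Sum>l<K. (cnj (a j k l) * cinner \<xi> (w j k)) *\<^sub>C u l)" by (rule sum.swap)
    also have "\<dots> = (\<Sum>k<K. \<Sum>l<K. \<Sum>j<n. (cnj (a j k l) * cinner \<xi> (w j k)) *\<^sub>C u l)"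
      by (intro sum.cong refl sum.swap)
    also have "\<dots> = (\<Sum>l<K. \<Sum>k<K. \<Sum>j<n. (cnj (a j k l) * cinner \<xi> (w j k)) *\<^sub>C u l)" by (rule sum.swap)
    also have "\<dots> = (\<Sum>l<K. cinner \<xi> (\<Sum>k<K. \<Sum>j<n. a j k l *\<^sub>C w j k) *\<^sub>C u l)"
      by (simp add: cinner_sum_right cinner_scaleC_right scaleC_sum_left)
    also have "\<dots> = (\<Sum>l<K. cinner \<xi> (- (\<Sum>k<K. a0 k l *\<^sub>C v k)) *\<^sub>C u l)" by (simp add: LG)
    also have "\<dots> = - (\<Sum>l<K. \<Sum>k<K. (cnj (a0 k l) * cinner \<xi> (v k)) *\<^sub>C u l)"
      by (simp add: cinner_minus_right cinner_sum_right cinner_scaleC_right scaleC_sum_left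
          scaleC_minus_left sum_negf)
    finally have 1: "(\<Sum>j<n. app (T j) (rm (X j) \<xi>)) = - (\<Sum>l<K. \<Sum>k<K. (cnj (a0 k l) * cinner \<xi> (v k)) *\<^sub>C u l)" .
    have "(\<Sum>j<n. rm (X j) (app (T j) \<xi>)) = (\<Sum>j<n. \<Sum>k<K. \<Sum>l<K. cinner \<xi> (v k) *\<^sub>C cnj (a j k l) *\<^sub>C rm (X j) (u l))"
      by (intro sum.cong refl) (simp add: Tapp rm_sum rm_scale scaleC_scaleC mult.commute)
    also have "\<dots> = (\<Sum>k<K. \<Sum>j<n. \<Sum>l<K. cinner \<xi> (v k) *\<^sub>C cnj (a j k l) *\<^sub>C rm (X j) (u l))" by (rule sum.swap)
    also have "\<dots> = (\<Sum>k<K. \<Sum>l<K. \<Sum>j<n. cinner \<xi> (v k) *\<^sub>C cnj (a j k l) *\<^sub>C rm (X j) (u l))"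
      by (intro sum.cong refl sum.swap)
    also have "\<dots> = (\<Sum>k<K. cinner \<xi> (v k) *\<^sub>C (\<Sum>l<K. \<Sum>j<n. cnj (a j k l) *\<^sub>C rm (X j) (u l)))"
      by (simp add: scaleC_sum_right)
    also have "\<dots> = (\<Sum>k<K. cinner \<xi> (v k) *\<^sub>C (- (\<Sum>l<K. cnj (a0 k l) *\<^sub>C u l)))" by (simp add: LF)
    also have "\<dots> = - (\<Sum>k<K. \<Sum>l<K. (cnj (a0 k l) * cinner \<xi> (v k)) *\<^sub>C u l)"
      by (simp add: scaleC_sum_right scaleC_scaleC scaleC_minus_right sum_negf mult.commute)
    also have "\<dots> = - (\<Sum>l<K. \<Sum>k<K. (cnj (a0 k l) * cinner \<xi> (v k)) *\<^sub>C u l)"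
      by (subst sum.swap) (rule refl)
    finally show ?thesis using 1 by (simp add: sum_subtractf)
  qed
  moreover have "T \<in> tuples n {S. finite_rank S}"
    by (auto simp: tuples_def T_def intro!: finite_rank_sum finite_rank_scale finite_rank_outer)
  ultimately have "T \<in> commuting_tuples M \<Lambda> n X" by (simp add: commuting_tuples_iff)
  then have "T j = 0" by (rule commuting_tuples_trivial[OF X D _ j])
  then have "0 = cnj (cinner (app (T j) (\<Lambda> 1)) (\<Lambda> 1))" by simp
  also have "\<dots> = (\<Sum>k<K. \<Sum>l<K. a j k l * cnj (cinner (\<Lambda> 1) (v k)) * cnj (cinner (u l) (\<Lambda> 1)))"
    by (simp add: Tapp[OF j] cinner_sum_left cinner_scaleC_left)
  also have "\<dots> = (\<Sum>k<K. \<Sum>l<K. a j k l * cnj (\<tau> (g k)) * \<tau> (f l))"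
    by (intro sum.cong refl) (simp add: u_def v_def cinner_Lam one_M adj_M f g tau_adj)
  finally show ?thesis by simp
qed

end

section \<open>Orthogonal projections in finite-dimensional coordinate space\<close>

lemma sum_fun_apply: "(\<Sum>i\<in>A. f i) x = (\<Sum>i\<in>A. f i x)"
  by (induction A rule: infinite_finite_induct) auto

lemma vip_complex: "vip K v w = (\<Sum>k<K. v k * cnj (w k))"
  by (simp add: tuple_ip_def cinner_complex_def)

lemma (in pre_hilbert_carrier) bessel:
  assumes U: "finite U" "orthonormal U" and x: "x \<in> V"
  shows "(\<Sum>u\<in>U. (cmod (ip x u))\<^sup>2) \<le> Re (ip x x)"
proof -
  define s where "s = (\<Sum>u\<in>U. ip x u *\<^sub>C u)"
  have UV: "u \<in> V" if "u \<in> U" for u using U that by (auto simp: orthonormal_def)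
  have s: "s \<in> V" unfolding s_def by (rule csubspace_sum[OF sub]) (auto intro: scale_mem UV)
  have su: "ip (x - s) u = 0" if "u \<in> U" for u
    using ip_orthonormal_sum[OF U that, of "ip x"] x s UV[OF that] by (simp add: ip_diff_left s_def[symmetric])
  have ss: "ip s (x - s) = 0"
  proof -
    have "ip s (x - s) = (\<Sum>u\<in>U. ip (ip x u *\<^sub>C u) (x - s))"
      unfolding s_def[of] by (rule ip_sum_left) (use x s in \<open>auto intro: scale_mem UV diff_mem simp: s_def[symmetric]\<close>)
    also have "\<dots> = 0"
    proof (rule sum.neutral, rule ballI)
      fix u assume u: "u \<in> U"
      have "ip u (x - s) = 0" using su[OF u] ip_commute[OF UV[OF u] diff_mem[OF x s]] by simp
      then show "ip (ip x u *\<^sub>C u) (x - s) = 0" using u x s by (simp add: ip_scale_left UV diff_mem)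
    qed
    finally show ?thesis .
  qed
  have sx: "ip s x = of_real (\<Sum>u\<in>U. (cmod (ip x u))\<^sup>2)"
  proof -
    have "ip s x = (\<Sum>u\<in>U. ip (ip x u *\<^sub>C u) x)"
      unfolding s_def by (rule ip_sum_left) (use x in \<open>auto intro: scale_mem UV\<close>)
    also have "\<dots> = (\<Sum>u\<in>U. of_real ((cmod (ip x u))\<^sup>2))"
    proof (rule sum.cong[OF refl])
      fix u assume u: "u \<in> U"
      show "ip (ip x u *\<^sub>C u) x = of_real ((cmod (ip x u))\<^sup>2)"
        using ip_commute[OF UV[OF u] x] by (simp only: ip_scale_left UV[OF u] x complex_norm_square)
    qed
    finally show ?thesis by simp
  qed
  have "ip s s = ip s x" using ss x s by (simp add: ip_diff_right)
  moreover have "ip x s = cnj (ip s x)" by (rule ip_commute[OF x s])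
  moreover have "0 \<le> Re (ip (x - s) (x - s))" by (rule ip_nonneg[OF diff_mem[OF x s]])
  ultimately show ?thesis using x s sx by (simp add: ip_diff_left ip_diff_right diff_mem)
qed

text \<open>A maximal orthonormal set in \<open>W\<close> exists since, by Bessel's inequality for the unit vectors, no
  orthonormal set in \<open>\<complex>\<^sup>K\<close> has more than \<open>K\<close> elements; the trace of the projection is its size.\<close>

lemma finite_dim_projection:
  fixes W :: "(nat \<Rightarrow> complex) set"
  assumes W: "csubspace W" "W \<subseteq> tuples K UNIV"
  shows "\<exists>p (r :: nat). (\<forall>k l. \<not> (k < K \<and> l < K) \<longrightarrow> p k l = 0) \<and> (\<forall>k l. cnj (p k l) = p l k) \<and>
    (\<Sum>k<K. p k k) = of_nat r \<and> (\<forall>l. (\<lambda>k. p k l) \<in> W) \<and> (\<forall>w\<in>W. \<forall>k. (\<Sum>l<K. p k l * w l) = w k)"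
proof -
  interpret hilbert_carrier "tuples K (UNIV :: complex set)" "vip K"
    by (rule hilbert_carrier_tuples[OF hilbert_carrier_UNIV])
  let ?on = "\<lambda>U. finite U \<and> orthonormal U \<and> U \<subseteq> W"
  have norm1: "(\<Sum>k<K. (cmod (u k))\<^sup>2) = 1" if "orthonormal U" "u \<in> U" for U u
  proof -
    have "vip K u u = 1" using that by (auto simp: orthonormal_def)
    then have "of_real (\<Sum>k<K. (cmod (u k))\<^sup>2) = (1 :: complex)"
      by (simp only: vip_complex of_real_sum complex_norm_square)
    then show ?thesis by (simp only: of_real_eq_1_iff)
  qed
  have card: "card U \<le> K" if U: "?on U" for U
  proof -
    have "real (card U) = (\<Sum>u\<in>U. \<Sum>k<K. (cmod (u k))\<^sup>2)"
      using norm1[of U] U by (simp cong: sum.cong)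
    also have "\<dots> = (\<Sum>k<K. \<Sum>u\<in>U. (cmod (u k))\<^sup>2)" by (rule sum.swap)
    also have "\<dots> \<le> (\<Sum>k<K. 1)"
    proof (rule sum_mono)
      fix k assume "k \<in> {..<K}"
      then have k: "k < K" by simp
      have "(\<Sum>u\<in>U. (cmod (vip K (single k 1) u))\<^sup>2) \<le> Re (vip K (single k 1) (single k (1 :: complex)))"
        using bessel[of U "single k 1"] U single_tuples[OF k, of "1 :: complex"] by blast
      then show "(\<Sum>u\<in>U. (cmod (u k))\<^sup>2) \<le> 1"
        by (simp add: vip_single_left[OF k] cinner_complex_def) (simp add: single_def)
    qed
    also have "\<dots> = real K" by simp
    finally show ?thesis by simp
  qed
  have on0: "?on {}" by (simp add: orthonormal_def)
  have "\<exists>U. ?on U \<and> (\<forall>U'. ?on U' \<longrightarrow> card U' \<le> card U)"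
    by (rule ex_has_greatest_nat[of ?on "{}" card "Suc K", OF on0]) (use card in \<open>simp add: less_Suc_eq_le\<close>)
  then obtain U where U: "?on U" and max: "\<forall>U'. ?on U' \<longrightarrow> card U' \<le> card U"
    by (elim exE conjE) (rule that, simp_all)
  have exp: "w = (\<Sum>u\<in>U. vip K w u *\<^sub>C u)" if w: "w \<in> W" for w
  proof (rule ccontr)
    assume "w \<noteq> (\<Sum>u\<in>U. vip K w u *\<^sub>C u)"
    then obtain e where e: "e \<in> W" "e \<notin> U" "orthonormal (insert e U)"
      using gram_schmidt_step[OF W, of U w] U w by blast
    then have "card (insert e U) \<le> card U" using U by (intro max[rule_format]) auto
    then show False using e U by simp
  qed
  define p where "p = (\<lambda>k l. \<Sum>u\<in>U. u k * cnj (u l))"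
  show ?thesis
  proof (intro exI[of _ p] exI[of _ "card U"] conjI allI impI ballI)
    have z: "u k = 0" if "u \<in> U" "\<not> k < K" for u k
      using that U W by (auto simp: tuples_def subset_eq)
    show "p k l = 0" if "\<not> (k < K \<and> l < K)" for k l
      unfolding p_def using that z by (intro sum.neutral) auto
    show "cnj (p k l) = p l k" for k l by (simp add: p_def mult.commute)
    have "(\<Sum>k<K. p k k) = (\<Sum>u\<in>U. \<Sum>k<K. u k * cnj (u k))"
      unfolding p_def by (rule sum.swap)
    also have "\<dots> = (\<Sum>u\<in>U. 1)"
      using U by (intro sum.cong) (auto simp: vip_complex[symmetric] orthonormal_def)
    finally show "(\<Sum>k<K. p k k) = of_nat (card U)" by simp
    have "(\<lambda>k. p k l) = (\<Sum>u\<in>U. cnj (u l) *\<^sub>C u)" for l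
      by (rule ext) (simp add: p_def sum_fun_apply scaleC_complex_def mult.commute)
    then show "(\<lambda>k. p k l) \<in> W" for l
      using U by (auto intro!: csubspace_sum[OF W(1)] csubspace_scale[OF W(1)])
    fix w k assume w: "w \<in> W"
    have "(\<Sum>l<K. p k l * w l) = (\<Sum>l<K. \<Sum>u\<in>U. u k * cnj (u l) * w l)"
      by (simp add: p_def sum_distrib_right)
    also have "\<dots> = (\<Sum>u\<in>U. \<Sum>l<K. u k * cnj (u l) * w l)" by (rule sum.swap)
    also have "\<dots> = (\<Sum>u\<in>U. vip K w u * u k)"
      by (intro sum.cong refl) (simp add: vip_complex sum_distrib_left mult_ac)
    also have "\<dots> = (\<Sum>u\<in>U. vip K w u *\<^sub>C u) k" by (simp add: sum_fun_apply scaleC_complex_def)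
    finally show "(\<Sum>l<K. p k l * w l) = w k" using exp[OF w] by simp
  qed
qed

definition smat :: "(nat \<Rightarrow> nat \<Rightarrow> complex) \<Rightarrow> nat \<Rightarrow> nat \<Rightarrow> 'a :: complex_hilbert_space cbop"
  where "smat p = (\<lambda>i j. p i j *\<^sub>C 1)"


section \<open>Kernel projections\<close>

context tracial
begin

lemma smat_mats: "(\<And>k l. \<not> (k < K \<and> l < K) \<Longrightarrow> p k l = 0) \<Longrightarrow> smat p \<in> mats K M"
  by (auto simp: mats_def smat_def scale_M one_M)

lemma trN_smat: "trN \<tau> K (smat p) = (\<Sum>k<K. p k k)"
  by (simp add: trN_def smat_def tau_scale one_M tau_one)

definition kerproj :: "nat \<Rightarrow> (nat \<Rightarrow> nat \<Rightarrow> 'h cbop) \<Rightarrow> nat \<Rightarrow> nat \<Rightarrow> 'h cbop"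
  where "kerproj N Q = mone N - range_proj N (madj Q)"

lemma kerproj_props:
  assumes Q: "Q \<in> mats N M"
  shows kerproj_mats: "kerproj N Q \<in> mats N M"
    and kerproj_self_adjoint: "madj (kerproj N Q) = kerproj N Q"
    and kerproj_idem: "mm N (kerproj N Q) (kerproj N Q) = kerproj N Q"
    and mult_kerproj: "mm N Q (kerproj N Q) = 0"
proof -
  have Qa: "madj Q \<in> mats N M" by (rule madj_mats[OF Q])
  let ?p = "range_proj N (madj Q)"
  note p = range_proj_mats[OF Qa] range_proj_self_adjoint[OF Qa] range_proj_idem[OF Qa]
  show "kerproj N Q \<in> mats N M" unfolding kerproj_def by (intro diff_mats mone_mats p)
  show "madj (kerproj N Q) = kerproj N Q" by (simp add: kerproj_def madj_diff p)
  show "mm N (kerproj N Q) (kerproj N Q) = kerproj N Q"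
    by (simp add: kerproj_def mm_diff_left mm_diff_right p mm_one_left[OF p(1)] mm_one_right[OF p(1)]
        mm_one_left[OF mone_mats])
  have "madj (mm N ?p (madj Q)) = madj (madj Q)" by (simp only: range_proj_mult[OF Qa])
  then have "mm N Q ?p = Q" by (simp add: madj_mm p)
  then show "mm N Q (kerproj N Q) = 0" by (simp add: kerproj_def mm_diff_right mm_one_right[OF Q])
qed

lemma kerproj_column:
  assumes Q: "Q \<in> mats N M" and z: "\<And>k. k < N \<Longrightarrow> (\<Sum>i<N. Q k i * f i) = 0" and i: "i < N"
  shows "(\<Sum>k<N. kerproj N Q i k * f k) = f i"
proof -
  have "(\<Sum>k<N. range_proj N (madj Q) i k * f k) = 0"
    by (rule range_proj_annihilates_column[OF madj_mats[OF Q] _ i]) (simp add: madj_def z)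
  moreover have "(\<Sum>k<N. mone N i k * f k) = (\<Sum>k<N. if i = k then f k else 0)"
    by (rule sum.cong) (use i in \<open>auto simp: mone_def\<close>)
  ultimately show ?thesis using i by (simp add: kerproj_def left_diff_distrib sum_subtractf sum.delta)
qed

lemma kerproj_fix:
  assumes Q: "Q \<in> mats N M" and R: "R \<in> mats N M" and z: "mm N Q R = 0"
  shows "mm N (kerproj N Q) R = R"
proof -
  have "mm N (range_proj N (madj Q)) R = 0"
    by (rule range_proj_annihilates_mat[OF madj_mats[OF Q]]) (simp add: z)
  then show ?thesis by (simp add: kerproj_def mm_diff_left mm_one_left[OF R])
qed

text \<open>The rank-nullity theorem: the complement of the kernel of \<open>Q\<close> is the closed range of \<open>Q\<^sup>*\<close>, whose
  dimension is the rank of \<open>Q\<close>.\<close>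

lemma vn_rank_kerproj:
  assumes Q: "Q \<in> mats N M"
  shows "vn_rank \<tau> N Q = of_nat N - trN \<tau> N (kerproj N Q)"
proof -
  have "trN \<tau> N (kerproj N Q) = of_nat N - vn_rank \<tau> N (madj Q)"
    by (simp add: kerproj_def trN_diff mone_mats range_proj_mats madj_mats Q trN_mone vn_rank_trN)
  then show ?thesis by (simp add: vn_rank_madj[OF Q])
qed

lemma tau_zeroI:
  assumes h: "h \<in> M" and z: "\<And>y. y \<in> M \<Longrightarrow> \<tau> (h * y) = 0"
  shows "h = 0"
  using z[OF adj_M[OF h]] tau_trace[OF h adj_M[OF h]] tau_faithful[OF h] by simp

end


section \<open>The kernel of a linear pencil has integral dimension\<close>

context tracial_L2
begin

definition pencil_mat :: "nat \<Rightarrow> nat \<Rightarrow> (nat \<Rightarrow> nat \<Rightarrow> complex) \<Rightarrow> (nat \<Rightarrow> nat \<Rightarrow> nat \<Rightarrow> complex) \<Rightarrow> (nat \<Rightarrow> 'h cbop) \<Rightarrow> nat \<Rightarrow> nat \<Rightarrow> 'h cbop"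
  where "pencil_mat K n a0 a X k l = (if k < K \<and> l < K then pencil n a0 a X k l else 0)"

lemma pencil_mat_mats: "\<forall>j<n. X j \<in> M \<Longrightarrow> pencil_mat K n a0 a X \<in> mats K M"
  by (auto simp: mats_def pencil_mat_def pencil_def intro!: plus_M scale_M one_M sum_M)

text \<open>In the terms of the proof, \<open>r = dim V\<close> and \<open>s = dim U\<close>: the pencil \<open>A\<close> maps \<open>V \<otimes> H\<close> to a dense subspace of
  \<open>U \<otimes> H\<close>, and its kernel is contained in \<open>V \<otimes> H\<close>.\<close>

lemma pencil_kernel_trace:
  assumes X: "\<forall>j<n. X j \<in> M" and D: "Delta M \<tau> \<Lambda> n X = real n"
  shows "\<exists>r s :: nat. trN \<tau> K (kerproj K (pencil_mat K n a0 a X)) = of_nat r - of_nat s"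
proof -
  let ?A = "pencil_mat K n a0 a X"
  let ?T = "tuples K (UNIV :: complex set)"
  have A: "?A \<in> mats K M" by (rule pencil_mat_mats[OF X])
  interpret C: hilbert_carrier ?T "vip K"
    by (rule hilbert_carrier_tuples[OF hilbert_carrier_UNIV])
  define Ker where "Ker = {f. (\<forall>l<K. f l \<in> M) \<and> (\<forall>k<K. (\<Sum>l<K. ?A k l * f l) = 0)}"
  have KerM: "f l \<in> M" if "f \<in> Ker" "l < K" for f l using that by (simp add: Ker_def)
  have Ker_right: "(\<lambda>l. f l * y) \<in> Ker" if "f \<in> Ker" "y \<in> M" for f y
  proof -
    have "(\<Sum>l<K. ?A k l * (f l * y)) = (\<Sum>l<K. ?A k l * f l) * y" for k
      by (simp add: sum_distrib_right mult.assoc)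
    then show ?thesis using that by (simp add: Ker_def times_M)
  qed
  define tv where "tv = (\<lambda>(f :: nat \<Rightarrow> 'h cbop) l. if l < K then \<tau> (f l) else 0)"
  define V where "V = tv ` Ker"
  have VT: "V \<subseteq> ?T" by (auto simp: V_def tv_def tuples_def)
  have V: "csubspace V" unfolding csubspace_def
  proof (intro conjI ballI allI)
    show "0 \<in> V" unfolding V_def
      by (rule image_eqI[of _ _ "\<lambda>_. 0"]) (auto simp: tv_def Ker_def zero_M tau_zero fun_eq_iff)
    fix v assume "v \<in> V"
    then obtain f where f: "v = tv f" "f \<in> Ker" by (auto simp: V_def)
    show "c *\<^sub>C v \<in> V" for c unfolding V_def
      by (rule image_eqI[of _ _ "\<lambda>l. c *\<^sub>C f l"])
        (use f in \<open>auto simp: tv_def Ker_def scale_M tau_scale fun_eq_iff scaleC_complex_def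
          scaleC_mult_right scaleC_sum_right[symmetric]\<close>)
    fix w assume "w \<in> V"
    then obtain g where g: "w = tv g" "g \<in> Ker" by (auto simp: V_def)
    show "v + w \<in> V" unfolding V_def
      by (rule image_eqI[of _ _ "\<lambda>l. f l + g l"])
        (use f g in \<open>auto simp: tv_def Ker_def plus_M tau_add fun_eq_iff distrib_left sum.distrib\<close>)
  qed
  obtain p r where p0: "\<And>k l. \<not> (k < K \<and> l < K) \<Longrightarrow> p k l = 0" and pa: "\<And>k l. cnj (p k l) = p l k"
    and ptr: "(\<Sum>k<K. p k k) = of_nat r" and pV: "\<And>l. (\<lambda>k. p k l) \<in> V"
    and pfix: "\<And>w k. w \<in> V \<Longrightarrow> (\<Sum>l<K. p k l * w l) = w k"
    using finite_dim_projection[OF V VT] by blast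
  \<comment> \<open>\<open>act\<close> applies a scalar matrix to a vector, and \<open>U\<close> is the span of \<open>a0 V\<close> and all \<open>a j V\<close>,
    written as a double orthogonal complement.\<close>
  define act where "act = (\<lambda>(b :: nat \<Rightarrow> nat \<Rightarrow> complex) (v :: nat \<Rightarrow> complex) k. if k < K then \<Sum>l<K. b k l * v l else 0)"
  have actT: "act b v \<in> ?T" for b v by (simp add: act_def tuples_def)
  define Sp where "Sp = (\<lambda>s. \<forall>v\<in>V. vip K (act a0 v) s = 0 \<and> (\<forall>j<n. vip K (act (a j) v) s = 0))"
  define U where "U = {t\<in>?T. \<forall>s\<in>?T. Sp s \<longrightarrow> vip K t s = 0}"
  have UT: "U \<subseteq> ?T" by (auto simp: U_def)
  have U: "csubspace U"
    unfolding csubspace_def U_def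
    by (auto simp: C.zero_mem C.ip_zero_left C.add_mem C.ip_add_left C.scale_mem C.ip_scale_left)
  obtain q s where q0: "\<And>k l. \<not> (k < K \<and> l < K) \<Longrightarrow> q k l = 0" and qa: "\<And>k l. cnj (q k l) = q l k"
    and qtr: "(\<Sum>k<K. q k k) = of_nat s" and qU: "\<And>l. (\<lambda>k. q k l) \<in> U"
    and qfix: "\<And>w k. w \<in> U \<Longrightarrow> (\<Sum>l<K. q k l * w l) = w k"
    using finite_dim_projection[OF U UT] by blast
  let ?P = "smat p :: nat \<Rightarrow> nat \<Rightarrow> 'h cbop" and ?Q = "smat q :: nat \<Rightarrow> nat \<Rightarrow> 'h cbop"
  have PM: "?P \<in> mats K M" by (rule smat_mats[OF p0])
  have QM: "?Q \<in> mats K M" by (rule smat_mats[OF q0])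
  have smat_mult: "mm K (smat b) R i j = (\<Sum>k<K. b i k *\<^sub>C R k j)" for b i j and R :: "nat \<Rightarrow> nat \<Rightarrow> 'h cbop"
    by (simp add: mm_def smat_def scaleC_mult_left)
  have Pa: "madj ?P = ?P" by (simp add: madj_def smat_def adj_scaleC pa)
  have Qa: "madj ?Q = ?Q" by (simp add: madj_def smat_def adj_scaleC qa)
  have PP: "mm K ?P ?P = ?P"
  proof (intro ext)
    fix i j
    show "mm K ?P ?P i j = ?P i j"
      using pfix[OF pV[of j], of i]
      by (simp only: smat_mult) (simp add: smat_def scaleC_scaleC scaleC_sum_left[symmetric])
  qed
  have QQ: "mm K ?Q ?Q = ?Q"
  proof (intro ext)
    fix i j
    show "mm K ?Q ?Q i j = ?Q i j"
      using qfix[OF qU[of j], of i]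
      by (simp only: smat_mult) (simp add: smat_def scaleC_scaleC scaleC_sum_left[symmetric])
  qed
  let ?E = "kerproj K ?A"
  note E = kerproj_mats[OF A] kerproj_self_adjoint[OF A] kerproj_idem[OF A] mult_kerproj[OF A]
  \<comment> \<open>The kernel is contained in \<open>V \<otimes> M\<close>: \<open>f - p f\<close> is orthogonal to \<open>M\<close> for the trace since all \<open>\<tau>(f y)\<close>
    lie in \<open>V\<close>.\<close>
  have Pf: "(\<Sum>m<K. p l m *\<^sub>C f m) = f l" if f: "f \<in> Ker" and l: "l < K" for f l
  proof -
    have m: "(\<Sum>m<K. p l m *\<^sub>C f m) \<in> M" by (intro sum_M scale_M KerM[OF f]) auto
    have "f l - (\<Sum>m<K. p l m *\<^sub>C f m) = 0"
    proof (rule tau_zeroI)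
      show "f l - (\<Sum>m<K. p l m *\<^sub>C f m) \<in> M" by (rule minus_M[OF KerM[OF f l] m])
      fix y assume y: "y \<in> M"
      have "tv (\<lambda>l. f l * y) \<in> V" unfolding V_def by (rule imageI[OF Ker_right[OF f y]])
      from pfix[OF this, of l] have "(\<Sum>m<K. p l m * \<tau> (f m * y)) = \<tau> (f l * y)"
        using l by (simp add: tv_def)
      moreover have "\<tau> (\<Sum>m<K. p l m *\<^sub>C (f m * y)) = (\<Sum>m<K. \<tau> (p l m *\<^sub>C (f m * y)))"
        by (rule tau_sum) (use y in \<open>auto intro!: scale_M times_M KerM[OF f]\<close>)
      moreover have "\<dots> = (\<Sum>m<K. p l m * \<tau> (f m * y))"
        by (rule sum.cong) (use y in \<open>auto simp: tau_scale times_M KerM[OF f]\<close>)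
      moreover have "(f l - (\<Sum>m<K. p l m *\<^sub>C f m)) * y = f l * y - (\<Sum>m<K. p l m *\<^sub>C (f m * y))"
        by (simp add: left_diff_distrib sum_distrib_right scaleC_mult_left)
      moreover have "(\<Sum>m<K. p l m *\<^sub>C (f m * y)) \<in> M"
        using y by (intro sum_M scale_M times_M KerM[OF f]) auto
      ultimately show "\<tau> ((f l - (\<Sum>m<K. p l m *\<^sub>C f m)) * y) = 0"
        using l y by (simp add: tau_diff times_M KerM[OF f])
    qed
    then show ?thesis by simp
  qed
  have E_Ker: "(\<lambda>l. ?E l k) \<in> Ker" if k: "k < K" for k
  proof -
    have "(\<Sum>l<K. ?A i l * ?E l k) = 0" for i
      using fun_cong[OF fun_cong[OF E(4)], of i k] by (simp add: mm_def)
    then show ?thesis using mats_entry[OF E(1) _ k] by (simp add: Ker_def)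
  qed
  have PE: "mm K ?P ?E = ?E"
  proof (rule mats_eqI[OF mm_mats[OF PM E(1)] E(1)])
    show "mm K ?P ?E i j = ?E i j" if "i < K" "j < K" for i j
      using Pf[OF E_Ker[OF that(2)] that(1)] by (simp add: smat_mult)
  qed
  have EP: "mm K ?E ?P = ?E"
    using arg_cong[OF PE, of madj] by (simp add: madj_mm Pa E)
  \<comment> \<open>The restriction \<open>B\<close> of the pencil to \<open>V\<close> is again a pencil.\<close>
  define b0 where "b0 = (\<lambda>k l. \<Sum>m<K. a0 k m * p m l)"
  define b where "b = (\<lambda>j k l. \<Sum>m<K. a j k m * p m l)"
  let ?B = "mm K ?A ?P"
  have BM: "?B \<in> mats K M" by (rule mm_mats[OF A PM])
  have Bpen: "?B k l = pencil n b0 b X k l" if "k < K" "l < K" for k l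
  proof -
    have "?B k l = (\<Sum>m<K. p m l *\<^sub>C pencil n a0 a X k m)"
      using that by (simp add: mm_def smat_def pencil_mat_def scaleC_mult_right)
    also have "\<dots> = (\<Sum>m<K. (a0 k m * p m l) *\<^sub>C 1) + (\<Sum>m<K. \<Sum>j<n. (a j k m * p m l) *\<^sub>C X j)"
      by (simp add: pencil_def scaleC_add_right scaleC_sum_right scaleC_scaleC sum.distrib mult.commute)
    also have "(\<Sum>m<K. \<Sum>j<n. (a j k m * p m l) *\<^sub>C X j) = (\<Sum>j<n. \<Sum>m<K. (a j k m * p m l) *\<^sub>C X j)"
      by (rule sum.swap)
    finally show ?thesis by (simp add: pencil_def b0_def b_def scaleC_sum_left)
  qed
  have act_b: "act (\<lambda>k l. \<Sum>m<K. c k m * p m l) v = act c v" if v: "v \<in> V" for c v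
  proof
    fix k
    have "(\<Sum>l<K. (\<Sum>m<K. c k m * p m l) * v l) = (\<Sum>l<K. \<Sum>m<K. c k m * (p m l * v l))"
      by (simp add: sum_distrib_right mult.assoc)
    also have "\<dots> = (\<Sum>m<K. \<Sum>l<K. c k m * (p m l * v l))" by (rule sum.swap)
    also have "\<dots> = (\<Sum>m<K. c k m * v m)" by (simp add: sum_distrib_left[symmetric] pfix[OF v])
    finally show "act (\<lambda>k l. \<Sum>m<K. c k m * p m l) v k = act c v k" by (simp add: act_def)
  qed
  have act_U: "act a0 v \<in> U" "j < n \<Longrightarrow> act (a j) v \<in> U" if "v \<in> V" for v j
    using that actT by (auto simp: U_def Sp_def)
  have b_col: "k < K \<Longrightarrow> b0 k l = act a0 (\<lambda>m. p m l) k" "k < K \<Longrightarrow> b j k l = act (a j) (\<lambda>m. p m l) k" for j k l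
    by (simp_all add: b0_def b_def act_def)
  have QB: "mm K ?Q ?B = ?B"
  proof (rule mats_eqI[OF mm_mats[OF QM BM] BM])
    fix i l assume il: "i < K" "l < K"
    have e0: "(\<Sum>k<K. q i k * b0 k l) = b0 i l"
    proof -
      have "(\<Sum>k<K. q i k * b0 k l) = (\<Sum>k<K. q i k * act a0 (\<lambda>m. p m l) k)"
        by (rule sum.cong) (auto simp: b_col)
      also have "\<dots> = act a0 (\<lambda>m. p m l) i" by (rule qfix[OF act_U(1)[OF pV]])
      finally show ?thesis using il by (simp add: b_col)
    qed
    have ej: "(\<Sum>k<K. q i k * b j k l) = b j i l" if "j < n" for j
    proof -
      have "(\<Sum>k<K. q i k * b j k l) = (\<Sum>k<K. q i k * act (a j) (\<lambda>m. p m l) k)"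
        by (rule sum.cong) (auto simp: b_col)
      also have "\<dots> = act (a j) (\<lambda>m. p m l) i" by (rule qfix[OF act_U(2)[OF pV that]])
      finally show ?thesis using il by (simp add: b_col)
    qed
    have "mm K ?Q ?B i l = (\<Sum>k<K. q i k *\<^sub>C pencil n b0 b X k l)"
      using il by (simp add: smat_mult Bpen)
    also have "\<dots> = (\<Sum>k<K. q i k * b0 k l) *\<^sub>C 1 + (\<Sum>k<K. \<Sum>j<n. (q i k * b j k l) *\<^sub>C X j)"
      by (simp add: pencil_def scaleC_add_right scaleC_sum_right scaleC_scaleC sum.distrib scaleC_sum_left)
    also have "(\<Sum>k<K. \<Sum>j<n. (q i k * b j k l) *\<^sub>C X j) = (\<Sum>j<n. \<Sum>k<K. (q i k * b j k l) *\<^sub>C X j)"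
      by (rule sum.swap)
    also have "\<dots> = (\<Sum>j<n. b j i l *\<^sub>C X j)"
      by (rule sum.cong) (simp_all add: scaleC_sum_left[symmetric] ej)
    finally show "mm K ?Q ?B i l = ?B i l" using il by (simp add: e0 Bpen pencil_def)
  qed
  \<comment> \<open>A column \<open>g\<close> over \<open>U\<close> that is annihilated by \<open>B\<^sup>*\<close> vanishes: the traces of its entries are
    orthogonal to \<open>a j V\<close> by the pairing, which removes all terms but those of \<open>a0\<close> from the equation
    \<open>B\<^sup>* g = 0\<close>, so they are also orthogonal to \<open>a0 V\<close>.\<close>
  have vanish: "g k = 0"
    if gM: "\<And>k. k < K \<Longrightarrow> g k \<in> M" and Bg: "\<And>l. l < K \<Longrightarrow> (\<Sum>k<K. adj (?B k l) * g k) = 0"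
      and Qg: "\<And>k. k < K \<Longrightarrow> (\<Sum>l<K. q k l *\<^sub>C g l) = g k" and k: "k < K" for g k
  proof -
    have pair: "vip K (act (a j) v) (tv (\<lambda>k. g k * y)) = 0" if j: "j < n" and v: "v \<in> V" and y: "y \<in> M" for j v y
    proof -
      obtain f where f: "f \<in> Ker" "v = tv f" using v by (auto simp: V_def)
      have "(\<Sum>k<K. \<Sum>l<K. b j k l * cnj (\<tau> (g k * y)) * \<tau> (f l)) = 0"
      proof (rule pencil_pairing[OF X D _ _ _ _ j])
        show "f l \<in> M" if "l < K" for l using KerM[OF f(1) that] .
        show "g k * y \<in> M" if "k < K" for k using gM[OF that] y by (rule times_M)
        show "(\<Sum>l<K. pencil n b0 b X i l * f l) = 0" if i: "i < K" for i
        proof -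
          have "(\<Sum>l<K. pencil n b0 b X i l * f l) = (\<Sum>l<K. \<Sum>m<K. ?A i m * (p m l *\<^sub>C f l))"
            using i by (intro sum.cong refl)
              (simp add: Bpen[symmetric] mm_def smat_def sum_distrib_right mult.assoc scaleC_mult_left scaleC_mult_right)
          also have "\<dots> = (\<Sum>m<K. \<Sum>l<K. ?A i m * (p m l *\<^sub>C f l))" by (rule sum.swap)
          also have "\<dots> = (\<Sum>m<K. ?A i m * f m)"
            by (rule sum.cong) (simp_all add: sum_distrib_left[symmetric] Pf[OF f(1)])
          finally show ?thesis using f(1) i by (simp add: Ker_def)
        qed
        show "(\<Sum>k<K. adj (pencil n b0 b X k l) * (g k * y)) = 0" if l: "l < K" for l
        proof -
          have "(\<Sum>k<K. adj (pencil n b0 b X k l) * (g k * y)) = (\<Sum>k<K. adj (?B k l) * g k) * y"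
            using l by (simp add: Bpen sum_distrib_right mult.assoc)
          then show ?thesis using Bg[OF l] by simp
        qed
      qed
      moreover have "vip K (act (b j) v) (tv (\<lambda>k. g k * y)) = (\<Sum>k<K. \<Sum>l<K. b j k l * cnj (\<tau> (g k * y)) * \<tau> (f l))"
        by (simp add: vip_complex act_def tv_def f sum_distrib_left sum_distrib_right mult_ac)
      moreover have "act (b j) v = act (a j) v" unfolding b_def by (rule act_b[OF v])
      ultimately show ?thesis by simp
    qed
    have tau_comb: "\<tau> ((\<Sum>k<K. cnj (c k) *\<^sub>C g k) * y) = cnj (vip K (\<lambda>k. if k < K then c k else 0) (tv (\<lambda>k. g k * y)))"
      if "y \<in> M" for c y
    proof -
      have "\<tau> ((\<Sum>k<K. cnj (c k) *\<^sub>C g k) * y) = \<tau> (\<Sum>k<K. cnj (c k) *\<^sub>C (g k * y))"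
        by (simp add: sum_distrib_right scaleC_mult_left)
      also have "\<dots> = (\<Sum>k<K. \<tau> (cnj (c k) *\<^sub>C (g k * y)))"
        by (rule tau_sum) (use gM that in \<open>auto intro!: scale_M times_M\<close>)
      also have "\<dots> = (\<Sum>k<K. cnj (c k) * \<tau> (g k * y))"
        by (rule sum.cong) (use gM that in \<open>auto simp: tau_scale times_M\<close>)
      finally show ?thesis by (simp add: vip_complex tv_def)
    qed
    have bj0: "(\<Sum>k<K. cnj (b j k l) *\<^sub>C g k) = 0" if j: "j < n" for j l
    proof (rule tau_zeroI)
      show "(\<Sum>k<K. cnj (b j k l) *\<^sub>C g k) \<in> M" by (intro sum_M scale_M gM) simp
      fix y assume y: "y \<in> M"
      have "(\<lambda>k. if k < K then b j k l else 0) = act (a j) (\<lambda>m. p m l)"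
        by (rule ext) (simp add: b_def act_def)
      then show "\<tau> ((\<Sum>k<K. cnj (b j k l) *\<^sub>C g k) * y) = 0"
        using tau_comb[OF y, of "\<lambda>k. b j k l"] pair[OF j pV y, of l] by simp
    qed
    have b00: "(\<Sum>k<K. cnj (b0 k l) *\<^sub>C g k) = 0" if l: "l < K" for l
    proof -
      have "0 = (\<Sum>k<K. adj (pencil n b0 b X k l) * g k)" using Bg[OF l] l by (simp add: Bpen)
      also have "\<dots> = (\<Sum>k<K. cnj (b0 k l) *\<^sub>C g k) + (\<Sum>k<K. \<Sum>j<n. adj (X j) * (cnj (b j k l) *\<^sub>C g k))"
        by (simp add: pencil_def adj_plus adj_sum adj_scaleC distrib_right scaleC_mult_left
            scaleC_mult_right sum_distrib_right sum.distrib)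
      also have "(\<Sum>k<K. \<Sum>j<n. adj (X j) * (cnj (b j k l) *\<^sub>C g k)) = (\<Sum>j<n. \<Sum>k<K. adj (X j) * (cnj (b j k l) *\<^sub>C g k))"
        by (rule sum.swap)
      also have "\<dots> = 0" by (simp add: sum_distrib_left[symmetric] bj0)
      finally show ?thesis by simp
    qed
    have pair0: "vip K (act a0 v) (tv (\<lambda>k. g k * y)) = 0" if v: "v \<in> V" and y: "y \<in> M" for v y
    proof -
      have "vip K (act a0 v) (tv (\<lambda>k. g k * y)) = vip K (act b0 v) (tv (\<lambda>k. g k * y))"
        unfolding b0_def act_b[OF v] ..
      also have "\<dots> = (\<Sum>k<K. \<Sum>l<K. v l * (b0 k l * cnj (tv (\<lambda>k. g k * y) k)))"
        by (simp add: vip_complex act_def sum_distrib_left sum_distrib_right mult_ac)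
      also have "\<dots> = (\<Sum>l<K. \<Sum>k<K. v l * (b0 k l * cnj (tv (\<lambda>k. g k * y) k)))" by (rule sum.swap)
      also have "\<dots> = (\<Sum>l<K. v l * vip K (\<lambda>k. if k < K then b0 k l else 0) (tv (\<lambda>k. g k * y)))"
        by (simp add: vip_complex sum_distrib_left)
      also have "\<dots> = 0"
      proof (rule sum.neutral, rule ballI)
        fix l assume "l \<in> {..<K}"
        then have "cnj (vip K (\<lambda>k. if k < K then b0 k l else 0) (tv (\<lambda>k. g k * y))) = 0"
          using tau_comb[OF y, of "\<lambda>k. b0 k l"] b00[of l] by (simp add: tau_zero)
        then show "v l * vip K (\<lambda>k. if k < K then b0 k l else 0) (tv (\<lambda>k. g k * y)) = 0" by simp
      qed
      finally show ?thesis .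
    qed
    show "g k = 0"
    proof (rule tau_zeroI[OF gM[OF k]])
      fix y assume y: "y \<in> M"
      let ?\<gamma> = "tv (\<lambda>k. g k * y)"
      have gT: "?\<gamma> \<in> ?T" by (simp add: tv_def tuples_def)
      have Sp: "Sp ?\<gamma>" using pair pair0 y by (simp add: Sp_def)
      have "?\<gamma> = (\<Sum>l<K. ?\<gamma> l *\<^sub>C (\<lambda>k. q k l))"
      proof
        fix i
        have "?\<gamma> i = (\<Sum>l<K. q i l * ?\<gamma> l)"
        proof (cases "i < K")
          case True
          have "\<tau> (g i * y) = \<tau> ((\<Sum>l<K. cnj (cnj (q i l)) *\<^sub>C g l) * y)" using Qg[OF True] by simp
          also have "\<dots> = (\<Sum>l<K. q i l * ?\<gamma> l)" unfolding tau_comb[OF y] by (simp add: vip_complex)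
          finally show ?thesis using True by (simp add: tv_def)
        next
          case False
          then show ?thesis using q0 by (simp add: tv_def)
        qed
        then show "?\<gamma> i = (\<Sum>l<K. ?\<gamma> l *\<^sub>C (\<lambda>k. q k l)) i"
          by (simp add: sum_fun_apply scaleC_complex_def mult.commute)
      qed
      also have "\<dots> \<in> U" by (intro csubspace_sum[OF U] csubspace_scale[OF U] qU)
      finally have "vip K ?\<gamma> ?\<gamma> = 0" using Sp gT by (simp add: U_def)
      then have "?\<gamma> = 0" by (rule C.ip_definite[OF gT])
      then have "?\<gamma> k = 0" by simp
      then show "\<tau> (g k * y) = 0" using k by (simp add: tv_def)
    qed
  qed
  let ?R = "range_proj K ?B"
  note R = range_proj_mats[OF BM] range_proj_self_adjoint[OF BM] range_proj_idem[OF BM] range_proj_mult[OF BM]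
  have Ba: "mm K (madj ?B) ?Q = madj ?B" using arg_cong[OF QB, of madj] by (simp only: madj_mm[of K ?Q ?B] Qa)
  have BaR: "mm K (madj ?B) ?R = madj ?B" using arg_cong[OF R(4), of madj] by (simp only: madj_mm[of K ?R ?B] R(2))
  have "mm K ?R (mone K - ?Q) = 0"
    by (rule range_proj_annihilates_mat[OF BM])
      (simp add: mm_diff_right mm_one_right[OF madj_mats[OF BM]] Ba)
  then have RQ: "mm K ?R ?Q = ?R" by (simp add: mm_diff_right mm_one_right[OF R(1)])
  have QR: "mm K ?Q ?R = ?R" using arg_cong[OF RQ, of madj] by (simp only: madj_mm[of K ?R ?Q] Qa R(2))
  let ?G = "?Q - ?R"
  have GM: "?G \<in> mats K M" by (rule diff_mats[OF QM R(1)])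
  have BG: "mm K (madj ?B) ?G = 0" by (simp add: mm_diff_right Ba BaR)
  have QG: "mm K ?Q ?G = ?G" by (simp add: mm_diff_right QQ QR)
  have "?G i k = 0" if "i < K" "k < K" for i k
  proof (rule vanish[of "\<lambda>i. ?G i k"])
    show "?G i k \<in> M" if "i < K" for i using mats_entry[OF GM that \<open>k < K\<close>] .
    show "(\<Sum>i<K. adj (?B i l) * ?G i k) = 0" for l
      using fun_cong[OF fun_cong[OF BG], of l k] by (simp add: mm_def madj_def)
    show "(\<Sum>l<K. q i l *\<^sub>C ?G l k) = ?G i k" for i
      using fun_cong[OF fun_cong[OF QG], of i k] by (simp only: smat_mult)
  qed fact
  then have "?R = ?Q" by (intro mats_eqI[OF R(1) QM]) simp
  then have rankB: "vn_rank \<tau> K ?B = of_nat s" by (simp add: vn_rank_trN trN_smat qtr)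
  \<comment> \<open>The kernel of \<open>B\<close> is the kernel of the pencil together with the complement of \<open>V\<close>.\<close>
  let ?F = "kerproj K ?B" and ?H = "?E + (mone K - ?P)"
  note F = kerproj_mats[OF BM] kerproj_self_adjoint[OF BM] kerproj_idem[OF BM] mult_kerproj[OF BM]
  have HM: "?H \<in> mats K M" by (intro add_mats diff_mats E mone_mats PM)
  have "mm K ?B ?H = 0"
    by (simp add: mm_add_right mm_diff_right mm_one_right[OF BM]) (simp add: mm_assoc PE PP E)
  then have FH: "mm K ?F ?H = ?H" by (rule kerproj_fix[OF BM HM])
  have "mm K ?E (mm K ?P ?F) = mm K ?P ?F"
    by (rule kerproj_fix[OF A mm_mats[OF PM F(1)]]) (simp add: mm_assoc[symmetric] F)
  then have EF: "mm K ?E ?F = mm K ?P ?F" by (simp add: mm_assoc[symmetric] EP)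
  have HF: "mm K ?H ?F = ?F"
    by (simp add: mm_add_left mm_diff_left mm_one_left[OF F(1)] EF)
  have "madj ?H = ?H" by (simp add: madj_add madj_diff E Pa)
  then have "?F = ?H" using arg_cong[OF FH, of madj] HF by (simp add: madj_mm F)
  then have "trN \<tau> K ?F = trN \<tau> K ?E + (of_nat K - of_nat r)"
    by (simp add: trN_add trN_diff E mone_mats PM diff_mats trN_mone trN_smat ptr)
  moreover have "trN \<tau> K ?F = of_nat K - of_nat s"
    using vn_rank_kerproj[OF BM] rankB by (simp add: algebra_simps)
  ultimately have "trN \<tau> K ?E = of_nat r - of_nat s" by (simp add: algebra_simps)
  then show ?thesis by blast
qed

end

section \<open>Linearization\<close>

lemma suffix_closed_enumeration:
  assumes F: "finite F" "F \<subseteq> lists A"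
  shows "\<exists>ws. distinct ws \<and> ws \<noteq> [] \<and> ws ! 0 = [] \<and> F \<subseteq> set ws \<and> set ws \<subseteq> lists A \<and>
    (\<forall>w\<in>set ws. w \<noteq> [] \<longrightarrow> tl w \<in> set ws)"
proof -
  define S where "S = insert [] (\<Union>w\<in>F. (\<lambda>d. drop d w) ` {..length w})"
  have fin: "finite (S - {[]})" using F by (simp add: S_def)
  obtain vs where vs: "set vs = S - {[]}" "distinct vs" using finite_distinct_list[OF fin] by blast
  have S0: "[] \<in> S" by (simp add: S_def)
  have set: "set ([] # vs) = S" using vs S0 by auto
  have FS: "F \<subseteq> S"
  proof
    fix w assume "w \<in> F"
    moreover have "w = drop 0 w" by simp
    ultimately show "w \<in> S" unfolding S_def by blast
  qed
  have SA: "S \<subseteq> lists A"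
  proof
    fix w assume "w \<in> S"
    then consider "w = []" | d v where "v \<in> F" "w = drop d v" unfolding S_def by blast
    then show "w \<in> lists A"
    proof cases
      case 2
      then show ?thesis using F set_drop_subset[of d v] by (auto simp: in_lists_conv_set)
    qed simp
  qed
  have tlS: "tl w \<in> S" if w: "w \<in> S" "w \<noteq> []" for w
  proof -
    obtain d v where v: "v \<in> F" "w = drop d v" using w unfolding S_def by blast
    then have "Suc d \<le> length v" using w(2) by (simp add: Suc_le_eq)
    moreover have "tl w = drop (Suc d) v" using v by (simp add: drop_Suc tl_drop)
    ultimately show ?thesis unfolding S_def using v(1) by blast
  qed
  show ?thesis
    by (rule exI[of _ "[] # vs"]) (unfold set, use vs FS SA tlS in auto)
qed

lemma sum_blocks: "(\<Sum>k<m * N. f k) = (\<Sum>b<m. \<Sum>l<N. f (b * N + l))" for f :: "nat \<Rightarrow> 'b :: comm_monoid_add"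
proof (induction m)
  case (Suc m)
  have split: "(\<Sum>i<a + c. f i) = (\<Sum>i<a. f i) + (\<Sum>i<c. f (a + i))" for a c
    by (induction c) (simp_all add: add.assoc)
  have "(\<Sum>k<Suc m * N. f k) = (\<Sum>k<m * N + N. f k)" by (simp add: add.commute)
  then show ?case by (simp add: split Suc)
qed simp

context tracial_L2
begin

lemma prod_word_M: "\<forall>j<n. X j \<in> M \<Longrightarrow> w \<in> lists {..<n} \<Longrightarrow> prod_list (map X w) \<in> M"
  by (induction w) (auto simp: one_M times_M)

text \<open>The pencil is a system of linear equations for unknowns \<open>h w l\<close>, where \<open>w\<close> runs through a suffix-closed
  list \<open>ws\<close> of words and \<open>l < N\<close>. The equations \<open>h (x # w) l = X\<^sub>x (h w l)\<close> say that \<open>h w l = w(X) (h [] l)\<close>, and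
  then the \<open>N\<close> equations \<open>\<Sum>w l. c w k l (h w l) = 0\<close>, where \<open>c w k l\<close> is the coefficient of \<open>w\<close> in \<open>P k l\<close>, say
  that \<open>h []\<close> lies in the kernel of \<open>P(X)\<close>. The unknown \<open>h (ws ! b) l\<close> has the number \<open>b * N + l\<close>. So has the
  equation that determines it from the tail of \<open>ws ! b\<close>, and the other \<open>N\<close> equations take the numbers below \<open>N\<close>,
  which are those of \<open>h [] l\<close>.\<close>

lemma linearization:
  assumes X: "\<forall>j<n. X j \<in> M" and N: "N \<ge> 1"
    and P: "\<And>i j. i < N \<Longrightarrow> j < N \<Longrightarrow> P i j \<in> free_algebra n"
    and Q: "Q = (\<lambda>i j. if i < N \<and> j < N then nc_eval X (P i j) else 0)"
  shows "Q \<in> mats N M \<and> (\<exists>K a0 a. trN \<tau> N (kerproj N Q) = trN \<tau> K (kerproj K (pencil_mat K n a0 a X)))"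
proof -
  define F where "F = (\<Union>i<N. \<Union>j<N. Poly_Mapping.keys (P i j))"
  have finF: "finite F" "F \<subseteq> lists {..<n}" using P by (auto simp: F_def free_algebra_def)
  obtain ws where dist: "distinct ws" and ws: "ws \<noteq> []" "ws ! 0 = []" and F: "F \<subseteq> set ws"
    and wsA: "set ws \<subseteq> lists {..<n}" and tl: "\<And>w. w \<in> set ws \<Longrightarrow> w \<noteq> [] \<Longrightarrow> tl w \<in> set ws"
    using suffix_closed_enumeration[OF finF] by blast
  define m where "m = length ws"
  define ev where "ev = (\<lambda>b. prod_list (map X (ws ! b)))"
  have m0: "0 < m" using ws by (simp add: m_def)
  have evM: "ev b \<in> M" if "b < m" for b
    unfolding ev_def by (rule prod_word_M[OF X subsetD[OF wsA]]) (use that in \<open>simp add: m_def\<close>)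
  have ev0: "ev 0 = 1" by (simp add: ev_def ws)
  define K where "K = m * N"
  have NK: "N \<le> K" using m0 by (simp add: K_def)
  have bl: "b * N + l < K" if "b < m" "l < N" for b l
  proof -
    have "b * N + l < Suc b * N" using that by simp
    also have "\<dots> \<le> K" unfolding K_def using that by (intro mult_right_mono) auto
    finally show ?thesis .
  qed
  have dm: "i div N < m" "i mod N < N" if "i < K" for i
    using that N by (simp_all add: K_def less_mult_imp_div_less)
  have div0: "i div N = 0 \<longleftrightarrow> i < N" for i using N by (auto simp: div_eq_0_iff)
  have eval: "nc_eval X (P i j) = (\<Sum>b<m. Poly_Mapping.lookup (P i j) (ws ! b) *\<^sub>C ev b)" if "i < N" "j < N" for i j
  proof -
    have "Poly_Mapping.keys (P i j) \<subseteq> set ws" using F that by (auto simp: F_def)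
    then have "nc_eval X (P i j) = (\<Sum>w\<in>set ws. Poly_Mapping.lookup (P i j) w *\<^sub>C prod_list (map X w))"
      unfolding nc_eval_def by (intro sum.mono_neutral_left) (auto simp: in_keys_iff)
    also have "\<dots> = (\<Sum>b<m. Poly_Mapping.lookup (P i j) (ws ! b) *\<^sub>C ev b)"
      unfolding ev_def m_def
      by (rule sum.reindex_bij_betw[symmetric]) (rule bij_betw_nth[OF dist refl refl])
    finally show ?thesis .
  qed
  have QM: "Q \<in> mats N M"
    unfolding mats_def using evM by (auto simp: Q eval intro!: sum_M scale_M)
  define a0 where "a0 = (\<lambda>i k. if i < N then Poly_Mapping.lookup (P i (k mod N)) (ws ! (k div N))
    else if i = k then 1 else 0 :: complex)"
  define a where "a = (\<lambda>j i k. if N \<le> i \<and> ws ! (i div N) = j # ws ! (k div N) \<and> i mod N = k mod N then -1 else 0 :: complex)"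
  let ?A = "pencil_mat K n a0 a X"
  have A: "?A \<in> mats K M" by (rule pencil_mat_mats[OF X])
  have row0: "(\<Sum>k<K. ?A i k * f k) = (\<Sum>b<m. \<Sum>l<N. Poly_Mapping.lookup (P i l) (ws ! b) *\<^sub>C f (b * N + l))"
    if i: "i < N" for i f
  proof -
    have "(\<Sum>k<K. ?A i k * f k) = (\<Sum>k<K. a0 i k *\<^sub>C f k)"
      using i NK by (intro sum.cong) (auto simp: pencil_mat_def pencil_def a_def scaleC_mult_left)
    also have "\<dots> = (\<Sum>b<m. \<Sum>l<N. a0 i (b * N + l) *\<^sub>C f (b * N + l))"
      unfolding K_def by (rule sum_blocks)
    also have "\<dots> = (\<Sum>b<m. \<Sum>l<N. Poly_Mapping.lookup (P i l) (ws ! b) *\<^sub>C f (b * N + l))"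
      using i by (intro sum.cong refl) (simp add: a0_def)
    finally show ?thesis .
  qed
  have pred: "\<exists>x b. x < n \<and> b < m \<and> ws ! (i div N) = x # ws ! b \<and>
      (\<forall>f. (\<Sum>k<K. ?A i k * f k) = f i - X x * f (b * N + i mod N))"
    if i: "i < K" "N \<le> i" for i
  proof -
    have d: "i div N < m" "i div N \<noteq> 0" using dm[OF i(1)] div0[of i] i by auto
    then have ne: "ws ! (i div N) \<noteq> []"
      using nth_eq_iff_index_eq[OF dist, of "i div N" 0] ws m0 by (simp add: m_def)
    have wsi: "ws ! (i div N) \<in> set ws" using d by (simp add: m_def)
    obtain x w where xw: "ws ! (i div N) = x # w" using ne by (cases "ws ! (i div N)") auto
    have "w \<in> set ws" using tl[OF wsi ne] xw by simp
    then obtain b where b: "b < m" "ws ! b = w" by (auto simp: in_set_conv_nth m_def)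
    have xn: "x < n" using wsA wsi xw by (auto simp: subset_eq)
    let ?t = "b * N + i mod N"
    have imod: "i mod N < N" using dm[OF i(1)] by simp
    have t: "?t < K" by (rule bl[OF b(1) imod])
    have aik: "a j i k = (if j = x then (if k = ?t then -1 else 0) else 0)" if k: "k < K" for j k
    proof -
      have "ws ! (k div N) = w \<longleftrightarrow> k div N = b"
        using nth_eq_iff_index_eq[OF dist, of "k div N" b] dm[OF k] b by (auto simp: m_def)
      moreover have "k div N = b \<and> i mod N = k mod N \<longleftrightarrow> k = ?t"
        using imod by (metis add.commute div_mult_mod_eq div_mult_self3 div_less mod_less mod_mult_self3 
            add_0 mult.commute less_nat_zero_code)
      ultimately show ?thesis using i by (auto simp: a_def xw)
    qed
    have "(\<Sum>k<K. ?A i k * f k) = f i - X x * f ?t" for f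
    proof -
      have "?A i k * f k = (if i = k then f k else 0) - (if ?t = k then X x * f k else 0)" if k: "k < K" for k
      proof -
        have "(\<Sum>j<n. a j i k *\<^sub>C X j) = (\<Sum>j<n. if x = j then (if k = ?t then - X x else 0) else 0)"
          by (rule sum.cong) (auto simp: aik[OF k])
        also have "\<dots> = (if k = ?t then - X x else 0)" using xn by (simp add: sum.delta)
        finally show ?thesis using i k by (simp add: pencil_mat_def pencil_def a0_def scaleC_one left_diff_distrib)
      qed
      then have "(\<Sum>k<K. ?A i k * f k) = (\<Sum>k<K. (if i = k then f k else 0) - (if ?t = k then X x * f k else 0))"
        by (intro sum.cong) auto
      then show ?thesis using i t by (simp add: sum_subtractf sum.delta)
    qed
    then show ?thesis using xn b xw by blast
  qed
  have ker_lift: "f i = ev (i div N) * f (i mod N)"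
    if f: "\<And>k. k < K \<Longrightarrow> (\<Sum>l<K. ?A k l * f l) = 0" and i: "i < K" for f i
    using i
  proof (induction "length (ws ! (i div N))" arbitrary: i rule: less_induct)
    case less
    show ?case
    proof (cases "i < N")
      case True
      then show ?thesis by (simp add: ev0)
    next
      case False
      then obtain x b where xb: "b < m" "ws ! (i div N) = x # ws ! b"
        "(\<Sum>k<K. ?A i k * f k) = f i - X x * f (b * N + i mod N)" using pred[OF less.prems] by force
      have imod: "i mod N < N" using dm[OF less.prems] by simp
      have dmt: "(b * N + i mod N) div N = b" "(b * N + i mod N) mod N = i mod N" using imod by simp_all
      have "f (b * N + i mod N) = ev b * f (i mod N)"
        using less.hyps[of "b * N + i mod N"] bl[OF xb(1) imod] by (simp add: dmt xb(2))
      moreover have "f i = X x * f (b * N + i mod N)" using f[OF less.prems] xb(3) by simp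
      ultimately show ?thesis by (simp add: ev_def xb(2) mult.assoc)
    qed
  qed
  have row0_lift: "(\<Sum>b<m. \<Sum>l<N. Poly_Mapping.lookup (P i l) (ws ! b) *\<^sub>C (ev b * f l)) = (\<Sum>l<N. Q i l * f l)"
    if i: "i < N" for i f
  proof -
    have "(\<Sum>b<m. \<Sum>l<N. Poly_Mapping.lookup (P i l) (ws ! b) *\<^sub>C (ev b * f l)) =
      (\<Sum>l<N. \<Sum>b<m. Poly_Mapping.lookup (P i l) (ws ! b) *\<^sub>C (ev b * f l))" by (rule sum.swap)
    also have "\<dots> = (\<Sum>l<N. Q i l * f l)"
      using i by (intro sum.cong) (auto simp: Q eval sum_distrib_right scaleC_mult_left)
    finally show ?thesis .
  qed
  have ker_down: "(\<Sum>l<N. Q i l * f l) = 0"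
    if f: "\<And>k. k < K \<Longrightarrow> (\<Sum>l<K. ?A k l * f l) = 0" and i: "i < N" for f i
  proof -
    have "f (b * N + l) = ev b * f l" if "b < m" "l < N" for b l
      using ker_lift[OF f bl[OF that]] that by simp
    then have "(\<Sum>k<K. ?A i k * f k) = (\<Sum>b<m. \<Sum>l<N. Poly_Mapping.lookup (P i l) (ws ! b) *\<^sub>C (ev b * f l))"
      unfolding row0[OF i] by (intro sum.cong) auto
    then show ?thesis using f[of i] i NK row0_lift[OF i, of f] by simp
  qed
  have ker_up: "(\<Sum>k<K. ?A i k * (ev (k div N) * f (k mod N))) = 0"
    if f: "\<And>k. k < N \<Longrightarrow> (\<Sum>l<N. Q k l * f l) = 0" and i: "i < K" for f i
  proof (cases "i < N")
    case True
    have "(\<Sum>k<K. ?A i k * (ev (k div N) * f (k mod N))) =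
      (\<Sum>b<m. \<Sum>l<N. Poly_Mapping.lookup (P i l) (ws ! b) *\<^sub>C (ev b * f l))"
      unfolding row0[OF True] by (intro sum.cong refl) auto
    then show ?thesis using row0_lift[OF True, of f] f[OF True] by simp
  next
    case False
    then obtain x b where xb: "b < m" "ws ! (i div N) = x # ws ! b"
      "\<And>f. (\<Sum>k<K. ?A i k * f k) = f i - X x * f (b * N + i mod N)" using pred[OF i] by force
    have imod: "i mod N < N" using dm[OF i] by simp
    have dmt: "(b * N + i mod N) div N = b" "(b * N + i mod N) mod N = i mod N" using imod by simp_all
    show ?thesis unfolding xb(3) dmt by (simp add: ev_def xb(2) mult.assoc)
  qed
  \<comment> \<open>The two kernel projections are \<open>?b ?a\<close> and \<open>?a ?b\<close>, where \<open>?a\<close> maps the kernel of \<open>P(X)\<close> to that of the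
    pencil and \<open>?b\<close> restricts a solution to the unknowns \<open>h [] l\<close>.\<close>
  define G where "G = (\<lambda>i l. if i < K \<and> l < N \<and> i mod N = l then ev (i div N) else 0)"
  have GM: "G \<in> mats K M" using NK evM dm by (auto simp: mats_def G_def zero_M)
  have RM: "mone N \<in> mats K M" using NK by (auto simp: mats_def mone_def zero_M one_M)
  let ?EP = "kerproj N Q" and ?EL = "kerproj K ?A"
  have EPN: "?EP \<in> mats N M" by (rule kerproj_mats[OF QM])
  have EPK: "?EP \<in> mats K M"
    unfolding mats_def
  proof (intro CollectI conjI allI impI)
    show "?EP i j \<in> M" for i j
      using mats_entry[OF EPN, of i j] mats_zero[OF EPN, of i j] zero_M by (cases "i < N \<and> j < N") auto
    show "?EP i j = 0" if "\<not> (i < K \<and> j < K)" for i j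
      by (rule mats_zero[OF EPN]) (use that NK in auto)
  qed
  have ELK: "?EL \<in> mats K M" by (rule kerproj_mats[OF A])
  have Gmult: "mm K G R i k = (if i < K then ev (i div N) * R (i mod N) k else 0)" for R i k
  proof -
    have "mm K G R i k = (\<Sum>l<K. if i mod N = l then (if i < K then ev (i div N) * R l k else 0) else 0)"
      unfolding mm_def G_def by (rule sum.cong) (use dm in \<open>auto split: if_splits\<close>)
    then show ?thesis using dm[of i] NK by (auto simp: sum.delta)
  qed
  have Rmult: "mm K (mone N) R i k = (if i < N then R i k else 0)" for R :: "nat \<Rightarrow> nat \<Rightarrow> 'h cbop" and i k
  proof -
    have "mm K (mone N) R i k = (\<Sum>l<K. if i = l then (if i < N then R l k else 0) else 0)"
      unfolding mm_def mone_def by (rule sum.cong) auto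
    then show ?thesis using NK by (auto simp: sum.delta)
  qed
  have EPmult: "mm K ?EP R i k = (\<Sum>l<N. ?EP i l * R l k)" for R i k
    unfolding mm_def
    by (rule sum.mono_neutral_right) (use NK mats_zero[OF EPN] in auto)
  have AEL: "(\<Sum>l<K. ?A i l * ?EL l k) = 0" for i k
    using fun_cong[OF fun_cong[OF mult_kerproj[OF A]], of i k] by (simp add: mm_def)
  have QEP: "(\<Sum>l<N. Q i l * ?EP l k) = 0" for i k
    using fun_cong[OF fun_cong[OF mult_kerproj[OF QM]], of i k] by (simp add: mm_def)
  let ?b = "mm K (mone N) ?EL" and ?a = "mm K G ?EP"
  have bM: "?b \<in> mats K M" by (rule mm_mats[OF RM ELK])
  have aM: "?a \<in> mats K M" by (rule mm_mats[OF GM EPK])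
  have EPb: "mm K ?EP ?b = ?b"
  proof (rule mats_eqI[OF mm_mats[OF EPK bM] bM])
    fix i k assume ik: "i < K" "k < K"
    show "mm K ?EP ?b i k = ?b i k"
    proof (cases "i < N")
      case True
      have "(\<Sum>l<N. ?EP i l * ?EL l k) = ?EL i k"
        by (rule kerproj_column[OF QM ker_down[OF AEL] True])
      then show ?thesis using True by (simp add: EPmult Rmult)
    next
      case False
      then show ?thesis using mats_zero[OF EPN, of i] by (simp add: EPmult Rmult)
    qed
  qed
  have Gb: "mm K G ?b = ?EL"
  proof (rule mats_eqI[OF mm_mats[OF GM bM] ELK])
    fix i k assume ik: "i < K" "k < K"
    have "?EL i k = ev (i div N) * ?EL (i mod N) k"
      by (rule ker_lift[of "\<lambda>i. ?EL i k", OF AEL ik(1)])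
    then show "mm K G ?b i k = ?EL i k" using ik dm(2)[OF ik(1)] by (simp add: Gmult Rmult)
  qed
  have ab: "mm K ?a ?b = ?EL" by (simp add: mm_assoc EPb Gb)
  have "mm K ?A ?a = 0"
  proof (intro ext)
    fix i k
    have "mm K ?A ?a i k = (\<Sum>l<K. ?A i l * (ev (l div N) * ?EP (l mod N) k))"
      unfolding mm_def[of K ?A] by (rule sum.cong) (auto simp: Gmult)
    also have "\<dots> = 0"
    proof (cases "i < K")
      case True
      show ?thesis by (rule ker_up[OF QEP True])
    next
      case False
      then show ?thesis by (simp add: pencil_mat_def)
    qed
    finally show "mm K ?A ?a i k = 0 i k" by simp
  qed
  then have "mm K ?EL ?a = ?a" by (rule kerproj_fix[OF A aM])
  moreover have "mm K (mone N) ?a = ?EP"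
  proof (rule mats_eqI[OF mm_mats[OF RM aM] EPK])
    fix i k assume "i < K" "k < K"
    then show "mm K (mone N) ?a i k = ?EP i k"
      using mats_zero[OF EPN, of i k] by (auto simp: Rmult Gmult ev0)
  qed
  ultimately have ba: "mm K ?b ?a = ?EP" by (simp add: mm_assoc)
  have "trN \<tau> N ?EP = trN \<tau> K ?EP"
    unfolding trN_def
    by (rule sum.mono_neutral_left) (use NK mats_zero[OF EPN] tau_zero in auto)
  also have "\<dots> = trN \<tau> K ?EL"
    using trN_comm[OF aM bM] by (simp add: ab ba)
  finally show ?thesis using QM by blast
qed

end

section \<open>The strong Atiyah property\<close>

theorem theorem5p22:
  fixes M :: "'h :: complex_hilbert_space cbop set"
    and \<tau> :: "'h cbop \<Rightarrow> complex"
    and \<Lambda> :: "'h cbop \<Rightarrow> 'l :: complex_hilbert_space"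
    and n :: nat
    and X :: "nat \<Rightarrow> 'h cbop"
  assumes "tracial_wstar_space M \<tau>"
    and "is_L2 M \<tau> \<Lambda>"
    and "\<forall>j<n. X j \<in> M"
    and "Delta M \<tau> \<Lambda> n X = real n"
  shows "strong_atiyah \<tau> n X"
  unfolding strong_atiyah_def
proof (intro allI impI)
  interpret tracial_L2 M \<tau> \<Lambda>
    by unfold_locales (use assms in auto)
  fix N :: nat and P :: "nat \<Rightarrow> nat \<Rightarrow> nat list \<Rightarrow>\<^sub>0 complex"
  assume N: "1 \<le> N" and P: "\<forall>i<N. \<forall>j<N. P i j \<in> free_algebra n"
  define Q where "Q = (\<lambda>i j. if i < N \<and> j < N then nc_eval X (P i j) else 0)"
  obtain K a0 a where Q: "Q \<in> mats N M"
    and lin: "trN \<tau> N (kerproj N Q) = trN \<tau> K (kerproj K (pencil_mat K n a0 a X))"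
    using linearization[OF assms(3) N _ Q_def] P by blast
  obtain r s :: nat where "trN \<tau> N (kerproj N Q) = of_nat r - of_nat s"
    using pencil_kernel_trace[OF assms(3,4), of K a0 a] lin by auto
  then have rk: "vn_rank \<tau> N Q = of_int (int N - (int r - int s))"
    by (simp add: vn_rank_kerproj[OF Q])
  have "0 \<le> Re (vn_rank \<tau> N Q)"
    unfolding vn_rank_trN
    by (rule trN_projection[OF range_proj_mats range_proj_self_adjoint range_proj_idem, OF Q Q Q])
  then have "0 \<le> int N - (int r - int s)" unfolding rk by simp
  then obtain k :: nat where "int N - (int r - int s) = int k" using zero_le_imp_eq_int by blast
  then have "vn_rank \<tau> N Q \<in> \<nat>" unfolding rk by (simp only: of_int_of_nat_eq of_nat_in_Nats)
  moreover have "mat_app N Q = mat_app N (\<lambda>i j. nc_eval X (P i j))"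
    by (auto simp: fun_eq_iff mat_app_def Q_def intro!: sum.cong)
  then have "range_proj N (\<lambda>i j. nc_eval X (P i j)) = range_proj N Q"
    unfolding range_proj_def by simp
  ultimately show "vn_rank \<tau> N (\<lambda>i j. nc_eval X (P i j)) \<in> \<nat>" by (simp add: vn_rank_def)
qed

end
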